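(* Let $d\in[1,+\infty]$. (i) For any evolution family $(\varphi_{s,t})_{0\le s\le t<+\infty}$ of order $d$ in the unit disc $\mathbb{D}$ there exists a Herglotz vector field $G:\mathbb{D}\times[0,+\infty)\to\mathbb{C}$ of order $d$ such that for all $z\in\mathbb{D}$ and all $s\ge 0$ $$\frac{\partial \varphi_{s,t}(z)}{\partial t}=G(\varphi_{s,t}(z),t)\quad\text{for a.e. } t\in[s,+\infty).\qquad ( * )$$ Moreover $G$ is essentially unique: if $H$ is another Herglotz vector field which satisfies $( * )$ (with $H$ in place of $G$), then $G(\cdot,t)=H(\cdot,t)$ for almost every $t\in[0,+\infty)$. (ii) Conversely, for any Herglotz vector field $G$ of order $d$ in the unit disc there exists a unique evolution family $(\varphi_{s,t})$ of order $d$ such that $( * )$ is satisfied for all $z\in\mathbb{D}$ and all $s\ge0$.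
   Context: $\mathbb{D}=\{\zeta\in\mathbb{C}:|\zeta|<1\}$. Evolution family: for $d\in[1,+\infty]$, a family $(\varphi_{s,t})_{0\le s\le t<+\infty}$ of holomorphic self-maps of $\mathbb{D}$ is an evolution family of order $d$ if (1) $\varphi_{s,s}=\mathrm{id}_{\mathbb{D}}$ for all $s\ge 0$; (2) $\varphi_{s,t}=\varphi_{u,t}\circ\varphi_{s,u}$ for all $0\le s\le u\le t<+\infty$; (3) for all $z\in\mathbb{D}$ and all $T>0$ there is a non-negative $k_{z,T}\in L^d([0,T],\mathbb{R})$ with $|\varphi_{s,u}(z)-\varphi_{s,t}(z)|\le\int_u^t k_{z,T}(\xi)\,d\xi$ for all $0\le s\le u\le t\le T$. Infinitesimal generator: a semigroup of holomorphic self-maps of $\mathbb{D}$ is a family $(\phi_t)_{t\ge0}$ of holomorphic self-maps of $\mathbb{D}$ with $\phi_0=\mathrm{id}$, $\phi_{t+s}=\phi_t\circ\phi_s$, and $\phi_t\to\mathrm{id}$ uniformly on compact sets as $t\to0$; its infinitesimal generator is the unique holomorphic $F:\mathbb{D}\to\mathbb{C}$ with $\frac{\partial\phi_t(z)}{\partial t}=F(\phi_t(z))$ for all $z\in\mathbb{D}$, $t\ge0$. $\mathrm{Gen}(\mathbb{D})$ denotes the set of all such generators. Herglotz vector field: a weak holomorphic vector field of order $d$ on $\mathbb{D}$ is a function $G:\mathbb{D}\times[0,+\infty)\to\mathbb{C}$ such that $t\mapsto G(z,t)$ is measurable for every $z\in\mathbb{D}$, $z\mapsto G(z,t)$ is holomorphic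 for every $t\ge0$, and for every compact $K\subset\mathbb{D}$ and $T>0$ there is a non-negative $k_{K,T}\in L^d([0,T],\mathbb{R})$ with $|G(z,t)|\le k_{K,T}(t)$ for all $z\in K$ and a.e. $t\in[0,T]$. It is a Herglotz vector field of order $d$ if moreover $G(\cdot,t)\in\mathrm{Gen}(\mathbb{D})$ for almost every $t\in[0,+\infty)$. *)

theory Defs
  imports "HOL-Complex_Analysis.Complex_Analysis"
begin

abbreviation unit_disc :: "complex set" where
  "unit_disc \<equiv> ball 0 1"

definition holomorphic_self_map :: "(complex \<Rightarrow> complex) \<Rightarrow> bool" where
  "holomorphic_self_map f \<longleftrightarrow> f holomorphic_on unit_disc \<and> f ` unit_disc \<subseteq> unit_disc"

text \<open>Membership in \<open>L\<^sup>d([0,T], \<real>)\<close> for \<open>1 \<le> d \<le> \<infinity>\<close>, with respect to Lebesgue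
  measure.\<close>

definition Lp_interval :: "ennreal \<Rightarrow> real \<Rightarrow> (real \<Rightarrow> real) \<Rightarrow> bool" where
  "Lp_interval d T k \<longleftrightarrow>
     k \<in> borel_measurable (lebesgue_on {0..T}) \<and>
     (if d = \<infinity> then \<exists>C. AE t in lebesgue_on {0..T}. \<bar>k t\<bar> \<le> C
      else integrable (lebesgue_on {0..T}) (\<lambda>t. \<bar>k t\<bar> powr enn2real d))"

text \<open>The argument \<open>\<phi> s t z\<close> stands for \<open>\<phi>\<^bsub>s,t\<^esub>(z)\<close>; only the values with
  \<open>0 \<le> s \<le> t\<close> and \<open>z\<close> in the unit disc are relevant.\<close>

definition evolution_family :: "ennreal \<Rightarrow> (real \<Rightarrow> real \<Rightarrow> complex \<Rightarrow> complex) \<Rightarrow> bool" where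
  "evolution_family d \<phi> \<longleftrightarrow>
     (\<forall>s t. 0 \<le> s \<and> s \<le> t \<longrightarrow> holomorphic_self_map (\<phi> s t)) \<and>
     (\<forall>s\<ge>0. \<forall>z\<in>unit_disc. \<phi> s s z = z) \<and>
     (\<forall>s u t. 0 \<le> s \<and> s \<le> u \<and> u \<le> t \<longrightarrow> (\<forall>z\<in>unit_disc. \<phi> s t z = \<phi> u t (\<phi> s u z))) \<and>
     (\<forall>z\<in>unit_disc. \<forall>T>0. \<exists>k. Lp_interval d T k \<and> (\<forall>\<xi>\<in>{0..T}. 0 \<le> k \<xi>) \<and>
        (\<forall>s u t. 0 \<le> s \<and> s \<le> u \<and> u \<le> t \<and> t \<le> T \<longrightarrow>
           cmod (\<phi> s u z - \<phi> s t z) \<le> (LINT \<xi>:{u..t}|lebesgue. k \<xi>)))"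

definition disc_semigroup :: "(real \<Rightarrow> complex \<Rightarrow> complex) \<Rightarrow> bool" where
  "disc_semigroup \<phi> \<longleftrightarrow>
     (\<forall>t\<ge>0. holomorphic_self_map (\<phi> t)) \<and>
     (\<forall>z\<in>unit_disc. \<phi> 0 z = z) \<and>
     (\<forall>s\<ge>0. \<forall>t\<ge>0. \<forall>z\<in>unit_disc. \<phi> (t + s) z = \<phi> t (\<phi> s z)) \<and>
     (\<forall>K. compact K \<and> K \<subseteq> unit_disc \<longrightarrow> uniform_limit K \<phi> (\<lambda>z. z) (at_right 0))"

definition infinitesimal_generator ::
    "(real \<Rightarrow> complex \<Rightarrow> complex) \<Rightarrow> (complex \<Rightarrow> complex) \<Rightarrow> bool" where
  "infinitesimal_generator \<phi> F \<longleftrightarrow>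
     F holomorphic_on unit_disc \<and>
     (\<forall>z\<in>unit_disc. \<forall>t\<ge>0.
        ((\<lambda>t. \<phi> t z) has_vector_derivative F (\<phi> t z)) (at t within {0..}))"

definition Gen_disc :: "(complex \<Rightarrow> complex) set" where
  "Gen_disc = {F. \<exists>\<phi>. disc_semigroup \<phi> \<and> infinitesimal_generator \<phi> F}"

definition weak_holomorphic_vector_field :: "ennreal \<Rightarrow> (complex \<Rightarrow> real \<Rightarrow> complex) \<Rightarrow> bool" where
  "weak_holomorphic_vector_field d G \<longleftrightarrow>
     (\<forall>z\<in>unit_disc. (\<lambda>t. G z t) \<in> borel_measurable (lebesgue_on {0..})) \<and>
     (\<forall>t\<ge>0. (\<lambda>z. G z t) holomorphic_on unit_disc) \<and>
     (\<forall>K T. compact K \<and> K \<subseteq> unit_disc \<and> 0 < T \<longrightarrow>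
        (\<exists>k. Lp_interval d T k \<and> (\<forall>t\<in>{0..T}. 0 \<le> k t) \<and>
           (\<forall>z\<in>K. AE t in lebesgue_on {0..T}. cmod (G z t) \<le> k t)))"

definition herglotz_vector_field :: "ennreal \<Rightarrow> (complex \<Rightarrow> real \<Rightarrow> complex) \<Rightarrow> bool" where
  "herglotz_vector_field d G \<longleftrightarrow>
     weak_holomorphic_vector_field d G \<and>
     (AE t in lebesgue_on {0..}. (\<lambda>z. G z t) \<in> Gen_disc)"

text \<open>The equation \<open>\<partial>\<phi>\<^bsub>s,t\<^esub>(z)/\<partial>t = G(\<phi>\<^bsub>s,t\<^esub>(z), t)\<close>; the exceptional null set of
  times may depend on \<open>z\<close> and \<open>s\<close>.\<close>

definition solves_evolution_equation ::
    "(real \<Rightarrow> real \<Rightarrow> complex \<Rightarrow> complex) \<Rightarrow> (complex \<Rightarrow> real \<Rightarrow> complex) \<Rightarrow> bool" where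
  "solves_evolution_equation \<phi> G \<longleftrightarrow>
     (\<forall>z\<in>unit_disc. \<forall>s\<ge>0. AE t in lebesgue_on {s..}.
        ((\<lambda>t. \<phi> s t z) has_vector_derivative G (\<phi> s t z) t) (at t within {s..}))"

end

theory Submission
  imports Defs
begin

text \<open>
  Everything rests on one inequality. A holomorphic \<open>F\<close> on the disc is an infinitesimal generator
  if and only if \<open>Re (cnj z * F z) \<le> Re (cnj (F 0) * z) * (1 - |z|\<^sup>2)\<close> for all \<open>z\<close>; this is
  called \<open>disc_generator F\<close> below. If \<open>f\<close> is a self-map, then \<open>f - id\<close> satisfies it: it is the
  derivative at \<open>\<epsilon> = 0\<close> of the Schwarz-Pick inequality of \<open>(1 - \<epsilon>) id + \<epsilon> f\<close> with respect to the
  origin (\<open>disc_generator_self_map_minus_id\<close>). The condition survives positive multiples and pointwise limits, so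
  it holds for generators, and it also holds for limits of difference quotients of an evolution
  family. It says that \<open>F z = a - cnj a * z\<^sup>2 - z * q z\<close> with \<open>Re q \<ge> 0\<close>, so Harnack's inequality
  bounds \<open>F\<close> on every smaller disc by its values at the two points \<open>0\<close> and \<open>1/2\<close>
  (\<open>disc_generator_bound\<close>).

  From fields to evolution families. Suppose that \<open>G\<close> satisfies the inequality at almost every time and
  is dominated on smaller discs by integrable functions of time. Along a solution of \<open>w' = G(w, t)\<close> the
  inequality gives \<open>(1 - |w|\<^sup>2)' \<ge> - 2 |G(0, t)| (1 - |w|\<^sup>2)\<close>, so solutions stay away from
  the unit circle on bounded time intervals (\<open>trajectory_escape\<close>). They exist because the equation can be
  truncated to a globally Lipschitz one and solved by Picard iteration in a weighted norm; by the estimate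
  the truncation is never felt (\<open>trajectory_exists\<close>). Cauchy's estimates make \<open>G\<close>
  Lipschitz on smaller discs, which gives uniqueness and hence the composition law. The difference
  of two solutions solves a linear equation, so it equals the difference of the initial values times an exponential
  of an integral; dominated convergence then shows that the flow is complex differentiable
  (\<open>flow_holomorphic\<close>). For a field that does not depend on time the flow is a semigroup, and this
  is the missing implication from the inequality to the generator property
  (\<open>Gen_disc_if_disc_generator\<close>).

  From evolution families to fields. For every \<open>t\<close> the quotients
  \<open>(\<phi>\<^bsub>t,t+h\<^esub>(z) - z) / h\<close> satisfy the inequality, and for almost every \<open>t\<close> they are bounded at \<open>0\<close> and
  \<open>1/2\<close> as \<open>h\<close> tends to \<open>0\<close>, hence uniformly bounded on smaller discs. For almost every \<open>t\<close> they
  converge at all points \<open>\<phi>\<^bsub>s,t\<^esub>(z)\<close> with rational \<open>s < t\<close> and \<open>z\<close> in a countable dense set, because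
  there they are difference quotients of the orbit of \<open>z\<close>, which is differentiable almost
  everywhere. These points are dense, as \<open>\<phi>\<^bsub>s,t\<^esub>\<close> tends to the identity when \<open>s\<close> tends to \<open>t\<close>. An
  equicontinuity argument with Montel's theorem gives convergence on the whole disc, and the limit is
  the field. The same dense set shows that two fields with the same evolution family agree.

  Both halves need the calculus of functions \<open>g\<close> with
  \<open>|g t - g u| \<le> \<integral>\<^bsub>u\<^esub>\<^bsup>t\<^esup> k\<close> for an integrable \<open>k\<close>, called \<open>ac_on g a b\<close> here. Such
  functions are indefinite integrals by the Radon-Nikodym theorem, and indefinite integrals are
  differentiable almost everywhere by Henstock's lemma and Vitali's covering theorem. Equations and
  inequalities between derivatives that hold almost everywhere can therefore be integrated.
\<close>

section \<open>Differentiating an indefinite integral almost everywhere\<close>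

lemma AE_lebesgue_on_iff:
  "S \<in> sets lebesgue \<Longrightarrow> (AE x in lebesgue_on S. P x) \<longleftrightarrow> (AE x in lebesgue. x \<in> S \<longrightarrow> P x)"
  by (simp add: AE_restrict_space_iff)

lemma AE_lebesgue_iff_negligible: "(AE x in lebesgue. P x) \<longleftrightarrow> negligible {x. \<not> P x}"
proof
  assume "AE x in lebesgue. P x"
  then obtain N where "N \<in> null_sets lebesgue" "{x. \<not> P x} \<subseteq> N"
    by (auto simp: eventually_ae_filter)
  then show "negligible {x. \<not> P x}"
    using negligible_iff_null_sets negligible_subset by blast
next
  assume "negligible {x. \<not> P x}"
  then show "AE x in lebesgue. P x"
    by (intro AE_I') (auto simp: negligible_iff_null_sets)
qed

text \<open>
  The intervals with end point \<open>x\<close> on which the increment of \<open>F\<close> is off by the factor \<open>e\<close> form a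
  Vitali cover of the set in question. On any finite disjoint subfamily fine enough for
  Henstock's lemma, the total error of the Riemann sum is less than \<open>e * \<epsilon>\<close>, while it is at least
  \<open>e\<close> times the total length. Hence disjoint subfamilies have total length at most \<open>\<epsilon>\<close>.
\<close>

lemma bad_increments_negligible:
  fixes f :: "real \<Rightarrow> 'a::euclidean_space"
  assumes f: "f integrable_on {a..b}" and e: "e > 0"
  defines "F \<equiv> \<lambda>x. integral {a..x} f"
  shows "negligible {x\<in>{a..b}. \<forall>d>0. \<exists>y\<in>{a..b}. y \<noteq> x \<and> \<bar>y - x\<bar> < d \<and>
                       e * \<bar>y - x\<bar> \<le> norm (F y - F x - (y - x) *\<^sub>R f x)}" (is "negligible ?E")
  unfolding negligible_outer_le
proof (intro allI impI)
  fix \<epsilon> :: real assume eps: "\<epsilon> > 0"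
  have "f integrable_on cbox a b" using f by simp
  then obtain \<gamma> where \<gamma>: "gauge \<gamma>" and H: "\<And>p. \<lbrakk>p tagged_partial_division_of (cbox a b); \<gamma> fine p\<rbrakk> \<Longrightarrow>
             sum (\<lambda>(x,k). norm(measure lborel k *\<^sub>R f x - integral k f)) p < e * \<epsilon>"
    using Henstock_lemma[of f a b "e * \<epsilon>"] e eps mult_pos_pos[OF e eps] by blast
  \<comment> \<open>An index is a pair of a tag and the other end of its interval; on the line this interval is the closed ball with centre c and radius r.\<close>
  define I where "I = (\<lambda>i::real\<times>real. {min (fst i) (snd i)..max (fst i) (snd i)})"
  define K where "K = {i. fst i \<in> {a..b} \<and> snd i \<in> {a..b} \<and> snd i \<noteq> fst i \<and> I i \<subseteq> \<gamma> (fst i) \<and>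
     e * \<bar>snd i - fst i\<bar> \<le> norm (F (snd i) - F (fst i) - (snd i - fst i) *\<^sub>R f (fst i))}"
  define c where "c = (\<lambda>i::real\<times>real. (fst i + snd i) / 2)"
  define r where "r = (\<lambda>i::real\<times>real. \<bar>snd i - fst i\<bar> / 2)"
  have cI: "cball (c i) (r i) = I i" for i
    by (auto simp: c_def r_def I_def dist_real_def min_def max_def abs_if field_simps split: if_splits)
  obtain C where C: "countable C" "C \<subseteq> K"
     and pw: "pairwise (\<lambda>i j. disjnt (cball (c i) (r i)) (cball (c j) (r j))) C"
     and neg: "negligible (?E - (\<Union>i \<in> C. cball (c i) (r i)))"
  proof (rule Vitali_covering_theorem_cballs[of K r ?E c])
    show "0 < r i" if "i \<in> K" for i using that by (auto simp: K_def r_def)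
  next
    fix x d :: real assume x: "x \<in> ?E" and d: "0 < d"
    obtain d' where d': "d' > 0" "ball x d' \<subseteq> \<gamma> x"
      using \<gamma> by (metis gaugeD openE)
    have "min d d' > 0" using d d' by auto
    with x obtain y where y: "y \<in> {a..b}" "y \<noteq> x" "\<bar>y - x\<bar> < min d d'"
        "e * \<bar>y - x\<bar> \<le> norm (F y - F x - (y - x) *\<^sub>R f x)" by blast
    have "I (x,y) \<subseteq> ball x d'" using y(3) by (auto simp: I_def dist_real_def)
    then have "(x,y) \<in> K" using x y d' by (auto simp: K_def)
    moreover have "x \<in> cball (c (x,y)) (r (x,y))" unfolding cI by (auto simp: I_def)
    moreover have "r (x,y) < d" using y(3) by (auto simp: r_def)
    ultimately show "\<exists>i. i \<in> K \<and> x \<in> cball (c i) (r i) \<and> r i < d" by blast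
  qed
  have bound: "measure lebesgue (\<Union>i\<in>C'. I i) \<le> \<epsilon>" if C': "C' \<subseteq> C" "finite C'" for C'
  proof -
    have disj: "I i \<inter> I j = {}" if "i \<in> C'" "j \<in> C'" "i \<noteq> j" for i j
      using pw that C' unfolding pairwise_def cI disjnt_def by blast
    have ne: "I i \<noteq> {}" for i by (auto simp: I_def)
    have CK: "i \<in> K" if "i \<in> C'" for i using C C' that by auto
    define p where "p = (\<lambda>i. (fst i, I i)) ` C'"
    have "p tagged_partial_division_of (cbox a b)"
      unfolding tagged_partial_division_of_def
    proof (intro conjI allI impI)
      show "finite p" using C' by (simp add: p_def)
    next
      fix x k assume "(x,k) \<in> p"
      then obtain i where i: "i \<in> C'" "x = fst i" "k = I i" by (auto simp: p_def)
      show "x \<in> k" using i by (auto simp: I_def)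
      show "k \<subseteq> cbox a b" using i CK[of i] by (auto simp: I_def K_def)
      show "\<exists>a b. k = cbox a b" using i by (auto simp: I_def)
    next
      fix x1 K1 x2 K2
      assume "(x1, K1) \<in> p \<and> (x2, K2) \<in> p \<and> (x1, K1) \<noteq> (x2, K2)"
      then obtain i j where "i \<in> C'" "j \<in> C'" "i \<noteq> j" "K1 = I i" "K2 = I j" by (auto simp: p_def)
      then have "K1 \<inter> K2 = {}" using disj by simp
      then show "interior K1 \<inter> interior K2 = {}" using interior_subset by blast
    qed
    moreover have "\<gamma> fine p" unfolding fine_def p_def using CK by (auto simp: K_def)
    ultimately have less: "sum (\<lambda>(x,k). norm(measure lborel k *\<^sub>R f x - integral k f)) p < e * \<epsilon>" by (rule H)
    have inj: "inj_on (\<lambda>i. (fst i, I i)) C'"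
      unfolding inj_on_def using disj ne by (metis Int_absorb Pair_inject)
    have ineq: "e * measure lebesgue (I i) \<le> norm(measure lborel (I i) *\<^sub>R f (fst i) - integral (I i) f)"
      if i: "i \<in> C'" for i
    proof -
      obtain x y where xy: "i = (x,y)" by fastforce
      have k: "x \<in> {a..b}" "y \<in> {a..b}" "x \<noteq> y" "e * \<bar>y - x\<bar> \<le> norm (F y - F x - (y - x) *\<^sub>R f x)"
        using CK[OF i] by (auto simp: K_def xy)
      have int: "integral {a..v} f = integral {a..u} f + integral {u..v} f"
        if "a \<le> u" "u \<le> v" "v \<le> b" for u v
      proof -
        have "f integrable_on {a..v}"
          using f that by (intro integrable_subinterval_real[OF f]) auto
        with that show ?thesis
          by (intro Henstock_Kurzweil_Integration.integral_combine[symmetric]) auto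
      qed
      show ?thesis
      proof (cases "x < y")
        case True
        then have "I i = {x..y}" by (auto simp: I_def xy)
        moreover have "F y = F x + integral {x..y} f" unfolding F_def using int[of x y] k True by auto
        ultimately show ?thesis using k True by (auto simp: xy norm_minus_commute)
      next
        case False
        then have "I i = {y..x}" using k by (auto simp: I_def xy)
        moreover have "F x = F y + integral {y..x} f" unfolding F_def using int[of y x] k False by auto
        ultimately show ?thesis using k False by (auto simp: xy norm_minus_commute algebra_simps)
      qed
    qed
    have "e * measure lebesgue (\<Union>i\<in>C'. I i) \<le> e * (\<Sum>i\<in>C'. measure lebesgue (I i))"
      using e C' by (intro mult_left_mono measure_UNION_le) (auto simp: I_def)
    also have "\<dots> \<le> (\<Sum>i\<in>C'. norm(measure lborel (I i) *\<^sub>R f (fst i) - integral (I i) f))"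
      unfolding sum_distrib_left by (intro sum_mono ineq)
    also have "\<dots> = sum (\<lambda>(x,k). norm(measure lborel k *\<^sub>R f x - integral k f)) p"
      unfolding p_def by (subst sum.reindex[OF inj]) (simp add: o_def)
    also have "\<dots> < e * \<epsilon>" by (rule less)
    finally show ?thesis using e by auto
  qed
  have fm: "I i \<in> fmeasurable lebesgue" for i by (auto simp: I_def)
  have U: "(\<Union>i\<in>C. I i) \<in> lmeasurable" "measure lebesgue (\<Union>i\<in>C. I i) \<le> \<epsilon>"
    using fmeasurable_UN_bound[OF C(1) fm bound] measure_UN_bound[OF C(1) fm bound] by auto
  define N where "N = ?E - (\<Union>i \<in> C. I i)"
  have "negligible N" using neg by (simp add: N_def cI)
  then have "measure lebesgue (N \<union> (\<Union>i\<in>C. I i)) \<le> measure lebesgue N + measure lebesgue (\<Union>i\<in>C. I i)"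
    using U by (intro measure_Un_le) (auto simp: negligible_imp_measurable fmeasurableD negligible_imp_sets)
  then have "measure lebesgue (N \<union> (\<Union>i\<in>C. I i)) \<le> \<epsilon>"
    using U negligible_imp_measure0[OF \<open>negligible N\<close>] by auto
  moreover have "N \<union> (\<Union>i\<in>C. I i) \<in> lmeasurable"
    using \<open>negligible N\<close> U by (simp add: negligible_imp_measurable fmeasurable.Un)
  moreover have "?E \<subseteq> N \<union> (\<Union>i\<in>C. I i)" by (auto simp: N_def)
  ultimately show "\<exists>T. ?E \<subseteq> T \<and> T \<in> lmeasurable \<and> measure lebesgue T \<le> \<epsilon>" by blast
qed

text \<open>
  Failure of differentiability with derivative \<open>f x\<close> at \<open>x\<close> means that \<open>x\<close> lies in one of the
  exceptional sets of the preceding lemma with \<open>e = 1/(n+1)\<close>.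
\<close>

lemma AE_integral_has_vector_derivative:
  fixes f :: "real \<Rightarrow> 'a::euclidean_space"
  assumes f: "f integrable_on {a..b}"
  shows "AE x in lebesgue. x \<in> {a..b} \<longrightarrow>
           ((\<lambda>x. integral {a..x} f) has_vector_derivative f x) (at x within {a..b})"
proof -
  define F where "F = (\<lambda>x. integral {a..x} f)"
  define B where "B = (\<lambda>n::nat. {x\<in>{a..b}. \<forall>d>0. \<exists>y\<in>{a..b}. y \<noteq> x \<and> \<bar>y - x\<bar> < d \<and>
                       inverse (Suc n) * \<bar>y - x\<bar> \<le> norm (F y - F x - (y - x) *\<^sub>R f x)})"
  have "negligible (B n)" for n
    unfolding B_def F_def using bad_increments_negligible[OF f, of "inverse (Suc n)"] by simp
  then have "negligible (\<Union>n. B n)" by (intro negligible_countable_Union) auto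
  moreover have "{x. \<not> (x \<in> {a..b} \<longrightarrow> (F has_vector_derivative f x) (at x within {a..b}))} \<subseteq> (\<Union>n. B n)"
  proof (rule subsetI)
    fix x assume "x \<in> {x. \<not> (x \<in> {a..b} \<longrightarrow> (F has_vector_derivative f x) (at x within {a..b}))}"
    then have x: "x \<in> {a..b}" and nd: "\<not> (F has_vector_derivative f x) (at x within {a..b})" by auto
    show "x \<in> (\<Union>n. B n)"
    proof (rule ccontr)
      assume nB: "x \<notin> (\<Union>n. B n)"
      have *: "\<exists>d>0. \<forall>y\<in>{a..b}. y \<noteq> x \<longrightarrow> \<bar>y - x\<bar> < d \<longrightarrow>
         norm (F y - F x - (y - x) *\<^sub>R f x) < inverse (Suc n) * \<bar>y - x\<bar>" (is "?th n") for n
      proof (rule ccontr)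
        assume "\<not> ?th n"
        then have "x \<in> B n" using x unfolding B_def by (simp add: not_less del: of_nat_Suc) (meson not_le)
        with nB show False by blast
      qed
      have "(F has_vector_derivative f x) (at x within {a..b})"
        unfolding has_vector_derivative_def has_derivative_within_alt
      proof (intro conjI allI impI)
        show "bounded_linear (\<lambda>h. h *\<^sub>R f x)" by (rule bounded_linear_scaleR_left)
      next
        fix e :: real assume "0 < e"
        then obtain n where n: "inverse (real (Suc n)) < e" using reals_Archimedean by blast
        from *[of n] obtain d where d: "d > 0" "\<And>y. y\<in>{a..b} \<Longrightarrow> y \<noteq> x \<Longrightarrow> \<bar>y - x\<bar> < d \<Longrightarrow>
           norm (F y - F x - (y - x) *\<^sub>R f x) < inverse (Suc n) * \<bar>y - x\<bar>" by blast
        show "\<exists>d>0. \<forall>y\<in>{a..b}. norm (y - x) < d \<longrightarrow>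
                norm (F y - F x - (y - x) *\<^sub>R f x) \<le> e * norm (y - x)"
        proof (intro exI[of _ d] conjI d ballI impI)
          fix y assume y: "y \<in> {a..b}" "norm (y - x) < d"
          show "norm (F y - F x - (y - x) *\<^sub>R f x) \<le> e * norm (y - x)"
          proof (cases "y = x")
            case False
            then have "norm (F y - F x - (y - x) *\<^sub>R f x) < inverse (Suc n) * \<bar>y - x\<bar>" using d y by auto
            also have "\<dots> \<le> e * norm (y - x)" using n by (auto intro!: mult_right_mono)
            finally show ?thesis by simp
          qed auto
        qed
      qed
      with nd show False by simp
    qed
  qed
  ultimately show ?thesis unfolding AE_lebesgue_iff_negligible F_def[symmetric] by (rule negligible_subset)
qed

section \<open>Functions dominated by an integral\<close>

text \<open>
  This is absolute continuity on \<open>{a..b}\<close>, encoded by a majorant of the increments, which is the form in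
  which the definition of an evolution family provides it.
\<close>

definition ac_on :: "(real \<Rightarrow> 'a::real_normed_vector) \<Rightarrow> real \<Rightarrow> real \<Rightarrow> bool" where
  "ac_on g a b \<longleftrightarrow> (\<exists>k::real \<Rightarrow> real. k integrable_on {a..b} \<and> (\<forall>x\<in>{a..b}. 0 \<le> k x) \<and>
     (\<forall>u t. a \<le> u \<and> u \<le> t \<and> t \<le> b \<longrightarrow> norm (g t - g u) \<le> integral {u..t} k))"

lemma ac_onI:
  assumes "k integrable_on {a..b}" "\<And>x. x \<in> {a..b} \<Longrightarrow> 0 \<le> k x"
    "\<And>u t. a \<le> u \<Longrightarrow> u \<le> t \<Longrightarrow> t \<le> b \<Longrightarrow> norm (g t - g u) \<le> integral {u..t} k"
  shows "ac_on g a b"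
  using assms unfolding ac_on_def by blast

lemma ac_onE:
  assumes "ac_on g a b"
  obtains k :: "real \<Rightarrow> real" where "k integrable_on {a..b}" "\<And>x. x \<in> {a..b} \<Longrightarrow> 0 \<le> k x"
    "\<And>u t. a \<le> u \<Longrightarrow> u \<le> t \<Longrightarrow> t \<le> b \<Longrightarrow> norm (g t - g u) \<le> integral {u..t} k"
  using assms unfolding ac_on_def by blast

lemma integral_diff_eq_integral:
  fixes f :: "real \<Rightarrow> 'a::banach"
  assumes "f integrable_on {a..b}" "a \<le> u" "u \<le> t" "t \<le> b"
  shows "integral {a..t} f - integral {a..u} f = integral {u..t} f"
proof -
  have "f integrable_on {a..t}" using assms by (intro integrable_subinterval_real[OF assms(1)]) auto
  then have "integral {a..u} f + integral {u..t} f = integral {a..t} f"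
    using assms by (intro Henstock_Kurzweil_Integration.integral_combine) auto
  then show ?thesis by (simp add: algebra_simps)
qed

lemma ac_on_subinterval:
  assumes "ac_on g a b" "a \<le> c" "d \<le> b"
  shows "ac_on g c d"
proof -
  obtain k where k: "k integrable_on {a..b}" "\<And>x. x \<in> {a..b} \<Longrightarrow> 0 \<le> k x"
    "\<And>u t. a \<le> u \<Longrightarrow> u \<le> t \<Longrightarrow> t \<le> b \<Longrightarrow> norm (g t - g u) \<le> integral {u..t} k"
    using ac_onE[OF assms(1)] by blast
  show ?thesis
    by (rule ac_onI[of k]) (use assms k in \<open>auto intro: integrable_subinterval_real[OF k(1)]\<close>)
qed

text \<open>
  One comparison serves for sums, for products of bounded functions and for compositions with Lipschitz
  functions.
\<close>

lemma ac_on_compare: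
  assumes f: "ac_on f a b" and g: "ac_on g a b" and C: "0 \<le> C" "0 \<le> D"
    and le: "\<And>u t. u \<in> {a..b} \<Longrightarrow> t \<in> {a..b} \<Longrightarrow> u \<le> t \<Longrightarrow>
      norm (h t - h u) \<le> C * norm (f t - f u) + D * norm (g t - g u)"
  shows "ac_on h a b"
proof -
  obtain k where k: "k integrable_on {a..b}" "\<And>x. x \<in> {a..b} \<Longrightarrow> 0 \<le> k x"
    "\<And>u t. a \<le> u \<Longrightarrow> u \<le> t \<Longrightarrow> t \<le> b \<Longrightarrow> norm (f t - f u) \<le> integral {u..t} k"
    using ac_onE[OF f] by blast
  obtain l where l: "l integrable_on {a..b}" "\<And>x. x \<in> {a..b} \<Longrightarrow> 0 \<le> l x"
    "\<And>u t. a \<le> u \<Longrightarrow> u \<le> t \<Longrightarrow> t \<le> b \<Longrightarrow> norm (g t - g u) \<le> integral {u..t} l"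
    using ac_onE[OF g] by blast
  show ?thesis
  proof (rule ac_onI[of "\<lambda>x. C * k x + D * l x"])
    show "(\<lambda>x. C * k x + D * l x) integrable_on {a..b}"
      using k l by (intro integrable_add integrable_on_mult_right)
    show "0 \<le> C * k x + D * l x" if "x \<in> {a..b}" for x using C k(2) l(2) that by auto
    show "norm (h t - h u) \<le> integral {u..t} (\<lambda>x. C * k x + D * l x)" if ut: "a \<le> u" "u \<le> t" "t \<le> b" for u t
    proof -
      have i: "k integrable_on {u..t}" "l integrable_on {u..t}"
        using ut by (auto intro: integrable_subinterval_real[OF k(1)] integrable_subinterval_real[OF l(1)])
      have "norm (h t - h u) \<le> C * norm (f t - f u) + D * norm (g t - g u)" using ut by (intro le) auto
      also have "\<dots> \<le> C * integral {u..t} k + D * integral {u..t} l"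
        using k(3)[OF ut] l(3)[OF ut] C by (intro add_mono mult_left_mono)
      also have "\<dots> = integral {u..t} (\<lambda>x. C * k x + D * l x)"
        using i by (simp add: integral_add integrable_on_mult_right)
      finally show ?thesis .
    qed
  qed
qed

lemma ac_on_lipschitz_compose:
  assumes f: "ac_on f a b" and C: "0 \<le> C"
    and le: "\<And>u t. u \<in> {a..b} \<Longrightarrow> t \<in> {a..b} \<Longrightarrow> u \<le> t \<Longrightarrow> norm (h t - h u) \<le> C * norm (f t - f u)"
  shows "ac_on h a b"
  by (rule ac_on_compare[OF f f, of C 0]) (use C le in auto)

lemma ac_on_integral:
  fixes f :: "real \<Rightarrow> 'a::euclidean_space"
  assumes f: "f absolutely_integrable_on {a..b}"
  shows "ac_on (\<lambda>x. integral {a..x} f) a b"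
proof (rule ac_onI[of "\<lambda>x. norm (f x)"])
  show "(\<lambda>x. norm (f x)) integrable_on {a..b}" using f by (simp add: absolutely_integrable_on_def)
  show "norm (integral {a..t} f - integral {a..u} f) \<le> integral {u..t} (\<lambda>x. norm (f x))"
    if ut: "a \<le> u" "u \<le> t" "t \<le> b" for u t
  proof -
    have "f absolutely_integrable_on {u..t}"
      using absolutely_integrable_on_subinterval[OF f, of u t] ut by auto
    then have "norm (integral {u..t} f) \<le> integral {u..t} (\<lambda>x. norm (f x))"
      by (intro integral_norm_bound_integral) (auto simp: absolutely_integrable_on_def)
    moreover have "f integrable_on {a..b}" using f by (simp add: absolutely_integrable_on_def)
    ultimately show ?thesis using ut by (simp add: integral_diff_eq_integral)
  qed
qed auto

lemma ac_on_imp_continuous_on: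
  fixes g :: "real \<Rightarrow> 'a::real_normed_vector"
  assumes g: "ac_on g a b"
  shows "continuous_on {a..b} g"
proof -
  obtain k where k: "k integrable_on {a..b}" "\<And>x. x \<in> {a..b} \<Longrightarrow> 0 \<le> k x"
    "\<And>u t. a \<le> u \<Longrightarrow> u \<le> t \<Longrightarrow> t \<le> b \<Longrightarrow> norm (g t - g u) \<le> integral {u..t} k"
    using ac_onE[OF g] by blast
  define K where "K = (\<lambda>x. integral {a..x} k)"
  have "continuous_on {a..b} K" unfolding K_def by (rule indefinite_integral_continuous_1[OF k(1)])
  have le: "norm (g t - g u) \<le> \<bar>K t - K u\<bar>" if "t \<in> {a..b}" "u \<in> {a..b}" for t u
  proof (cases "u \<le> t")
    case True
    then show ?thesis using k(3)[of u t] integral_diff_eq_integral[OF k(1), of u t] that by (simp add: K_def)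
  next
    case False
    then show ?thesis using k(3)[of t u] integral_diff_eq_integral[OF k(1), of t u] that
      by (simp add: K_def norm_minus_commute)
  qed
  show ?thesis
    unfolding continuous_on_def
  proof
    fix x assume x: "x \<in> {a..b}"
    have "(K \<longlongrightarrow> K x) (at x within {a..b})" using \<open>continuous_on {a..b} K\<close> x by (auto simp: continuous_on_def)
    then have "((\<lambda>y. \<bar>K y - K x\<bar>) \<longlongrightarrow> 0) (at x within {a..b})"
      by (simp add: LIM_zero_iff tendsto_rabs_zero_iff)
    then have "((\<lambda>y. g y - g x) \<longlongrightarrow> 0) (at x within {a..b})"
      by (rule Lim_null_comparison[rotated]) (use le x in \<open>auto simp: eventually_at_filter\<close>)
    then show "(g \<longlongrightarrow> g x) (at x within {a..b})" by (simp add: LIM_zero_iff)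
  qed
qed

lemma symmetric_Ioc_exhaust:
  "incseq (\<lambda>n. {-real n<..real n})" "(\<Union>n. {-real n<..real n}) = UNIV"
proof -
  show "incseq (\<lambda>n. {-real n<..real n})"
    unfolding incseq_def
  proof (intro allI impI subsetI)
    fix m n :: nat and x assume "m \<le> n" "x \<in> {- real m<..real m}"
    moreover from this have "real m \<le> real n" by simp
    ultimately show "x \<in> {- real n<..real n}" unfolding greaterThanAtMost_iff by linarith
  qed
  show "(\<Union>n. {-real n<..real n}) = UNIV"
  proof (intro set_eqI iffI UNIV_I)
    fix x :: real
    obtain n where "\<bar>x\<bar> < real n" using reals_Archimedean2 by blast
    then show "x \<in> (\<Union>n. {-real n<..real n})" by (intro UN_I[of n]) auto
  qed
qed

text \<open>
  A statement about the sum of two measures, obtained from the half-open intervals by Dynkin's argument.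
  It is used to dominate one Stieltjes measure by a measure with a density: the difference of the two is
  again a Stieltjes measure.
\<close>

lemma emeasure_sum_eqI_Ioc:
  fixes M1 M2 N :: "real measure"
  assumes s: "sets M1 = sets borel" "sets M2 = sets borel" "sets N = sets borel"
    and fin: "finite_measure M1" "finite_measure M2" "finite_measure N"
    and eq: "\<And>u v. u \<le> v \<Longrightarrow> emeasure M1 {u<..v} + emeasure M2 {u<..v} = emeasure N {u<..v}"
    and A: "A \<in> sets borel"
  shows "emeasure M1 A + emeasure M2 A = emeasure N A"
proof -
  interpret M1: finite_measure M1 by fact
  interpret M2: finite_measure M2 by fact
  interpret N: finite_measure N by fact
  have sp: "space M1 = UNIV" "space M2 = UNIV" "space N = UNIV"
    using s[THEN sets_eq_imp_space_eq] by simp_all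
  have eq': "emeasure M1 {u<..v} + emeasure M2 {u<..v} = emeasure N {u<..v}" for u v
    using eq[of u v] by (cases "u \<le> v") auto
  have lim: "(\<lambda>n. emeasure M {-real n<..real n}) \<longlonglongrightarrow> emeasure M UNIV" if "sets M = sets borel" for M
  proof -
    have "(\<lambda>n. emeasure M {-real n<..real n}) \<longlonglongrightarrow> emeasure M (\<Union>n. {-real n<..real n})"
      using that symmetric_Ioc_exhaust(1) by (intro Lim_emeasure_incseq) (simp_all add: image_subset_iff)
    then show ?thesis by (simp only: symmetric_Ioc_exhaust(2))
  qed
  have U: "emeasure M1 UNIV + emeasure M2 UNIV = emeasure N UNIV"
    using tendsto_add[OF lim[OF s(1)] lim[OF s(2)]] lim[OF s(3)] unfolding eq' by (rule LIMSEQ_unique)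
  have gen: "sets (borel::real measure) = sigma_sets UNIV (range (\<lambda>(a, b). {a <.. b}))"
    unfolding borel_sigma_sets_Ioc by (simp add: sets_measure_of_conv)
  have A': "A \<in> sigma_sets UNIV (range (\<lambda>(a, b). {a <.. b}))" using A unfolding gen .
  have IS: "Int_stable (range (\<lambda>(a::real, b). {a <.. b}))"
  proof (rule Int_stableI)
    fix X Y assume "X \<in> range (\<lambda>(a::real, b). {a <.. b})" "Y \<in> range (\<lambda>(a::real, b). {a <.. b})"
    then obtain a b c d where "X = {a<..b}" "Y = {c<..d}" by (metis (no_types, lifting) imageE case_prod_beta)
    then have "X \<inter> Y = (\<lambda>(a, b). {a <.. b}) (max a c, min b d)" by (simp add: Int_greaterThanAtMost)
    then show "X \<inter> Y \<in> range (\<lambda>(a::real, b). {a <.. b})" by (rule range_eqI)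
  qed
  have P: "range (\<lambda>(a::real, b). {a <.. b}) \<subseteq> Pow UNIV" by simp
  from IS P A' show ?thesis
  proof (induction rule: sigma_sets_induct_disjoint)
    case (basic B)
    then show ?case using eq' by (auto simp del: greaterThanAtMost_iff)
  next
    case empty
    then show ?case by simp
  next
    case (compl B)
    then have B: "B \<in> sets borel" unfolding gen by simp
    have c: "emeasure M B + emeasure M (UNIV - B) = emeasure M UNIV" if "sets M = sets borel" for M
      using plus_emeasure[of B M "UNIV - B"] that B by simp
    have "emeasure N B + (emeasure M1 (UNIV - B) + emeasure M2 (UNIV - B)) = emeasure M1 UNIV + emeasure M2 UNIV"
      unfolding c[OF s(1), symmetric] c[OF s(2), symmetric] using compl by (simp add: ac_simps flip: compl.IH)
    also have "\<dots> = emeasure N B + emeasure N (UNIV - B)" using U c[OF s(3)] by simp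
    finally show ?case using N.emeasure_finite[of B] by (simp add: ennreal_add_left_cancel)
  next
    case (union B)
    then have B: "range B \<subseteq> sets borel" unfolding gen by simp
    have d: "disjoint_family B" using union by simp
    have "(\<Sum>i. emeasure M1 (B i)) + (\<Sum>i. emeasure M2 (B i)) = (\<Sum>i. emeasure M1 (B i) + emeasure M2 (B i))"
      by (intro suminf_add) auto
    also have "\<dots> = (\<Sum>i. emeasure N (B i))" using union by simp
    finally show ?case using B d s by (simp add: suminf_emeasure)
  qed
qed

lemma finite_interval_measure:
  fixes F :: "real \<Rightarrow> real"
  assumes mono: "\<And>x y. x \<le> y \<Longrightarrow> F x \<le> F y" and rc: "\<And>a. continuous (at_right a) F"
    and bd: "\<And>x y. F y - F x \<le> B"
  shows "finite_measure (interval_measure F)"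
proof (rule finite_measureI)
  have "(SUP n. emeasure (interval_measure F) {-real n<..real n}) = emeasure (interval_measure F) UNIV"
    using SUP_emeasure_incseq[of "\<lambda>n. {-real n<..real n}" "interval_measure F"]
      symmetric_Ioc_exhaust
    by (simp add: image_subset_iff)
  moreover have "(SUP n. emeasure (interval_measure F) {-real n<..real n}) \<le> ennreal B"
    using bd by (intro SUP_least) (auto simp: emeasure_interval_measure_Ioc[OF _ mono rc] ennreal_leI)
  ultimately show "emeasure (interval_measure F) (space (interval_measure F)) \<noteq> \<infinity>"
    by (simp add: top_unique) (metis ennreal_neq_top top_unique)
qed

lemma has_integral_Icc_iff_Ioc:
  fixes f :: "real \<Rightarrow> 'a::banach"
  shows "(f has_integral I) {a..b} \<longleftrightarrow> (f has_integral I) {a<..b}"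
  by (rule has_integral_spike_set_eq; rule negligible_subset[of "{a}"]) auto

text \<open>
  With \<open>K\<close> the indefinite integral of the majorant, \<open>K + g\<close> and \<open>K - g\<close> are increasing, and their
  Stieltjes measures add up to the measure with density \<open>2 k\<close>. So the measure of \<open>K + g\<close> is absolutely
  continuous, and its Radon-Nikodym density minus \<open>k\<close> is the required integrand.
\<close>

lemma ac_on_real_eq_integral:
  fixes g :: "real \<Rightarrow> real"
  assumes g: "ac_on g a b" and ab: "a \<le> b"
  shows "\<exists>f. f absolutely_integrable_on {a..b} \<and> (\<forall>x\<in>{a..b}. (f has_integral g x - g a) {a..x})"
proof -
  obtain k where k: "k integrable_on {a..b}" "\<And>x. x \<in> {a..b} \<Longrightarrow> 0 \<le> k x"
    "\<And>u t. a \<le> u \<Longrightarrow> u \<le> t \<Longrightarrow> t \<le> b \<Longrightarrow> norm (g t - g u) \<le> integral {u..t} k"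
    using ac_onE[OF g] by blast
  \<comment> \<open>Outside the interval, g and K are continued by constants.\<close>
  define cl where "cl = (\<lambda>x. max a (min b x))"
  define K where "K = (\<lambda>x. integral {a..x} k)"
  have cl: "cl x \<in> {a..b}" for x using ab by (auto simp: cl_def)
  have clm: "cl x \<le> cl y" if "x \<le> y" for x y using that by (auto simp: cl_def)
  have cl_id: "cl x = x" if "x \<in> {a..b}" for x using that by (auto simp: cl_def)
  have Kd: "K y - K x = integral {x..y} k" if "a \<le> x" "x \<le> y" "y \<le> b" for x y
    unfolding K_def using integral_diff_eq_integral[OF k(1)] that by auto
  have cont: "continuous_on UNIV (\<lambda>x. h (cl x))" if "continuous_on {a..b} h" for h :: "real \<Rightarrow> real"
    by (rule continuous_on_compose2[OF that]) (use cl in \<open>auto simp: cl_def intro!: continuous_intros\<close>)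
  have contK: "continuous_on {a..b} K" unfolding K_def by (rule indefinite_integral_continuous_1[OF k(1)])
  define F where "F = (\<lambda>x. K (cl x) + g (cl x))"
  define H where "H = (\<lambda>x. K (cl x) - g (cl x))"
  have gK: "\<bar>g (cl y) - g (cl x)\<bar> \<le> K (cl y) - K (cl x)" if "x \<le> y" for x y
    using k(3)[of "cl x" "cl y"] Kd[of "cl x" "cl y"] cl clm[OF that] by auto
  have Fm: "F x \<le> F y" and Hm: "H x \<le> H y" if "x \<le> y" for x y
    using gK[OF that] by (auto simp: F_def H_def)
  have Fc: "continuous (at_right x) F" and Hc: "continuous (at_right x) H" for x
    using cont[OF contK] cont[OF ac_on_imp_continuous_on[OF g]] 
    unfolding F_def H_def continuous_on_eq_continuous_within
    by (auto intro!: continuous_intros intro: continuous_at_imp_continuous_within)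
  have idem: "cl (cl x) = cl x" for x using cl cl_id by blast
  have Fi: "F x = F (cl x)" and Hi: "H x = H (cl x)" for x by (auto simp: F_def H_def idem)
  have bnd: "h y - h x \<le> h b - h a" if m: "\<And>x y. x \<le> y \<Longrightarrow> h x \<le> h y" and i: "\<And>x. h x = h (cl x)"
    for h :: "real\<Rightarrow>real" and x y
    using m[of "cl y" b] m[of a "cl x"] cl[of x] cl[of y] unfolding i[of x] i[of y] by auto
  have Fb: "F y - F x \<le> F b - F a" and Hb: "H y - H x \<le> H b - H a" for x y
    using bnd[of F y x] bnd[of H y x] Fm Hm Fi Hi by blast+
  define M1 where "M1 = interval_measure F"
  define M2 where "M2 = interval_measure H"
  \<comment> \<open>A Borel version k' of the majorant is needed for the density.\<close>
  define kk where "kk = (\<lambda>x. if x \<in> {a..b} then k x else 0)"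
  have kk0: "0 \<le> kk x" for x using k(2) by (auto simp: kk_def)
  have kkU: "kk integrable_on UNIV" unfolding kk_def using k(1) integrable_restrict_UNIV by blast
  then have kkm: "kk \<in> borel_measurable lebesgue"
    using has_integral_iff_nn_integral_lebesgue[of kk, OF kk0] unfolding integrable_on_def by blast
  then obtain k' where k': "k' \<in> borel_measurable lborel" "AE x in lborel. kk x = k' x"
    using completion_ex_borel_measurable_real by blast
  have kkI: "integral {u..v} kk = K (cl v) - K (cl u)" if uv: "u \<le> v" for u v
  proof -
    have "integral {u..v} kk = integral ({u..v} \<inter> {a..b}) k"
      unfolding kk_def integral_restrict_Int by (simp only: Int_commute)
    also have "\<dots> = K (cl v) - K (cl u)"
    proof (cases "{u..v} \<inter> {a..b} = {}")
      case True
      then have "min v b < max u a"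
        by (simp only: Int_atLeastAtMost atLeastatMost_empty_iff not_le)
      then have "cl u = cl v" using uv ab unfolding cl_def by linarith
      then show ?thesis by (simp only: True integral_empty diff_self)
    next
      case False
      then have "max u a \<le> min v b"
        by (simp only: Int_atLeastAtMost atLeastatMost_empty_iff not_not)
      then have "cl u = max u a" "cl v = min v b" using uv ab unfolding cl_def by linarith+
      then have "{u..v} \<inter> {a..b} = {cl u..cl v}" by (simp only: Int_atLeastAtMost)
      then show ?thesis using Kd[of "cl u" "cl v"] cl clm[OF uv] by auto
    qed
    finally show ?thesis .
  qed
  define N where "N = density lborel (\<lambda>x. ennreal (2 * k' x))"
  have nnk: "(\<integral>\<^sup>+x. ennreal (2 * k' x) * indicator A x \<partial>lborel) = ennreal (2 * r)"
    if "(kk has_integral r) A" for A r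
  proof -
    have "(\<integral>\<^sup>+x. ennreal (2 * k' x) * indicator A x \<partial>lborel) = (\<integral>\<^sup>+x. ennreal (2 * kk x) * indicator A x \<partial>lborel)"
      using k'(2) by (intro nn_integral_cong_AE) auto
    also have "\<dots> = ennreal (2 * r)"
      by (rule nn_integral_has_integral_lebesgue') (use kk0 has_integral_mult_right[OF that, of 2] in auto)
    finally show ?thesis .
  qed
  have Nem: "emeasure N A = (\<integral>\<^sup>+x. ennreal (2 * k' x) * indicator A x \<partial>lborel)" if "A \<in> sets borel" for A
    unfolding N_def using that k'(1) by (intro emeasure_density) auto
  have NI: "emeasure N {u<..v} = ennreal (2 * (K (cl v) - K (cl u)))" if "u \<le> v" for u v
  proof -
    have "kk integrable_on {u..v}" using kkU integrable_on_subinterval by blast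
    then have "(kk has_integral K (cl v) - K (cl u)) {u..v}" using kkI[OF that] by (metis integrable_integral)
    then have "(kk has_integral K (cl v) - K (cl u)) {u<..v}"
      by (simp only: has_integral_Icc_iff_Ioc)
    then show ?thesis using nnk Nem by auto
  qed
  have finN: "finite_measure N"
  proof (rule finite_measureI)
    have "(kk has_integral integral UNIV kk) UNIV" using kkU by (rule integrable_integral)
    then show "emeasure N (space N) \<noteq> \<infinity>" using nnk[of _ UNIV] Nem[of UNIV] by (simp add: N_def)
  qed
  have le: "emeasure M1 A + emeasure M2 A = emeasure N A" if "A \<in> sets borel" for A
  proof (rule emeasure_sum_eqI_Ioc[OF _ _ _ _ _ finN _ that])
    show "finite_measure M1" unfolding M1_def using Fm Fc Fb by (rule finite_interval_measure)
    show "finite_measure M2" unfolding M2_def using Hm Hc Hb by (rule finite_interval_measure)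
    show "emeasure M1 {u<..v} + emeasure M2 {u<..v} = emeasure N {u<..v}" if "u \<le> v" for u v
    proof -
      have "emeasure M1 {u<..v} = ennreal (F v - F u)" "emeasure M2 {u<..v} = ennreal (H v - H u)"
        unfolding M1_def M2_def using that
        by (auto intro!: emeasure_interval_measure_Ioc Fm Hm Fc Hc)
      then have "emeasure M1 {u<..v} + emeasure M2 {u<..v} = ennreal ((F v - F u) + (H v - H u))"
        using Fm[OF that] Hm[OF that] by (simp add: ennreal_plus)
      then show ?thesis using NI[OF that] by (simp add: F_def H_def algebra_simps)
    qed
  qed (simp_all add: M1_def M2_def N_def)
  have "absolutely_continuous lborel M1"
    unfolding absolutely_continuous_def
  proof
    fix A assume A: "A \<in> null_sets (lborel :: real measure)"
    then have "A \<in> null_sets N" unfolding N_def using k'(1)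
      using absolutely_continuousI_density[of "\<lambda>x. ennreal (2 * k' x)" lborel] by (auto simp: absolutely_continuous_def)
    then have "emeasure N A = 0" by auto
    with le[of A] A have "emeasure M1 A = 0" by auto
    moreover have "A \<in> sets M1" using null_setsD2[OF A] by (simp add: M1_def)
    ultimately show "A \<in> null_sets M1" by (rule null_setsI)
  qed
  then obtain f0 where f0: "f0 \<in> borel_measurable lborel" "density lborel f0 = M1"
    using sigma_finite_measure.Radon_Nikodym[OF sigma_finite_lborel, of M1] by (auto simp: M1_def)
  define f where "f = (\<lambda>x. enn2real (f0 x))"
  have em: "(\<integral>\<^sup>+y. f0 y * indicator {a<..x} y \<partial>lborel) = ennreal (F x - F a)" if "x \<in> {a..b}" for x
  proof -
    have "(\<integral>\<^sup>+y. f0 y * indicator {a<..x} y \<partial>lborel) = emeasure M1 {a<..x}"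
      using f0 emeasure_density[of f0 lborel "{a<..x}"] by simp
    also have "\<dots> = ennreal (F x - F a)" unfolding M1_def using that
      by (intro emeasure_interval_measure_Ioc Fm Fc) auto
    finally show ?thesis .
  qed
  have fin: "AE y in lborel. f0 y * indicator {a<..b} y \<noteq> \<infinity>"
    using em[of b] ab f0(1) by (intro nn_integral_PInf_AE) auto
  have fint: "(f has_integral F x - F a) {a..x}" if x: "x \<in> {a..b}" for x
  proof -
    have "((\<lambda>y. f y * indicator {a<..x} y) has_integral F x - F a) UNIV"
    proof (rule nn_integral_has_integral)
      have "(\<integral>\<^sup>+y. ennreal (f y * indicator {a<..x} y) \<partial>lborel) = (\<integral>\<^sup>+y. f0 y * indicator {a<..x} y \<partial>lborel)"
        using fin x by (intro nn_integral_cong_AE)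
          (auto elim!: eventually_mono simp: f_def indicator_def ennreal_enn2real_if split: if_splits)
      then show "(\<integral>\<^sup>+y. ennreal (f y * indicator {a<..x} y) \<partial>lborel) = ennreal (F x - F a)" using em[OF x] by simp
      show "(\<lambda>y. f y * indicator {a<..x} y) \<in> borel_measurable borel"
        unfolding f_def using f0(1) by measurable
      show "0 \<le> F x - F a" using Fm[of a x] x by auto
    qed (auto simp: f_def)
    then have "((\<lambda>y. if y \<in> {a<..x} then f y else 0) has_integral F x - F a) UNIV"
      by (rule has_integral_eq[rotated]) (auto simp: indicator_def)
    then have "(f has_integral F x - F a) {a<..x}" by (simp only: has_integral_restrict_UNIV)
    then show ?thesis by (simp only: has_integral_Icc_iff_Ioc)
  qed
  have f_abs: "f absolutely_integrable_on {a..b}"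
    using fint[of b] ab by (intro nonnegative_absolutely_integrable_1) (auto simp: f_def integrable_on_def)
  have k_abs: "k absolutely_integrable_on {a..b}"
    using k by (intro nonnegative_absolutely_integrable_1) auto
  show ?thesis
  proof (intro exI[of _ "\<lambda>x. f x - k x"] conjI ballI)
    show "(\<lambda>x. f x - k x) absolutely_integrable_on {a..b}"
      using f_abs k_abs by (rule set_integral_diff(1))
    fix x assume x: "x \<in> {a..b}"
    have "k integrable_on {a..x}" using x by (intro integrable_subinterval_real[OF k(1)]) auto
    then have "(k has_integral K x) {a..x}" unfolding K_def by (rule integrable_integral)
    with fint[OF x] have "((\<lambda>x. f x - k x) has_integral (F x - F a) - K x) {a..x}" by (rule has_integral_diff)
    moreover have "(F x - F a) - K x = g x - g a"
      using cl_id[OF x] cl_id[of a] ab by (simp add: F_def K_def)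
    ultimately show "((\<lambda>x. f x - k x) has_integral g x - g a) {a..x}" by simp
  qed
qed

lemma ac_on_has_derivative_AE:
  fixes g :: "real \<Rightarrow> 'a::euclidean_space"
  assumes g: "ac_on g a b" and ab: "a \<le> b"
  obtains f where "f absolutely_integrable_on {a..b}"
    "\<And>x. x \<in> {a..b} \<Longrightarrow> (f has_integral g x - g a) {a..x}"
    "AE x in lebesgue. x \<in> {a..b} \<longrightarrow> (g has_vector_derivative f x) (at x within {a..b})"
proof -
  have "\<exists>f. f absolutely_integrable_on {a..b} \<and> (\<forall>x\<in>{a..b}. (f has_integral g x \<bullet> i - g a \<bullet> i) {a..x})" if "i \<in> Basis" for i
  proof -
    have "ac_on (\<lambda>x. g x \<bullet> i) a b"
      by (rule ac_on_lipschitz_compose[OF g, of 1])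
        (use that in \<open>auto simp flip: inner_diff_left intro: order_trans[OF Basis_le_norm]\<close>)
    then show ?thesis by (rule ac_on_real_eq_integral[OF _ ab])
  qed
  then obtain F where F: "\<And>i. i \<in> Basis \<Longrightarrow> F i absolutely_integrable_on {a..b}"
    "\<And>i x. i \<in> Basis \<Longrightarrow> x \<in> {a..b} \<Longrightarrow> (F i has_integral g x \<bullet> i - g a \<bullet> i) {a..x}"
    by metis
  define f where "f = (\<lambda>x. \<Sum>i\<in>Basis. F i x *\<^sub>R i)"
  have 1: "f absolutely_integrable_on {a..b}"
    unfolding f_def using F(1) by (intro absolutely_integrable_sum absolutely_integrable_scaleR_right
        finite_Basis) (auto intro: set_integrable_scaleR_left)
  have 2: "(f has_integral g x - g a) {a..x}" if "x \<in> {a..b}" for x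
  proof -
    have "(f has_integral (\<Sum>i\<in>Basis. (g x \<bullet> i - g a \<bullet> i) *\<^sub>R i)) {a..x}"
      unfolding f_def using F(2) that by (intro has_integral_sum has_integral_scaleR_left) auto
    also have "(\<Sum>i\<in>Basis. (g x \<bullet> i - g a \<bullet> i) *\<^sub>R i) = g x - g a"
      by (simp add: euclidean_representation flip: inner_diff_left)
    finally show ?thesis .
  qed
  have "f integrable_on {a..b}" using 1 by (simp add: absolutely_integrable_on_def)
  from AE_integral_has_vector_derivative[OF this]
  have 3: "AE x in lebesgue. x \<in> {a..b} \<longrightarrow> (g has_vector_derivative f x) (at x within {a..b})"
  proof (rule eventually_mono)
    fix x assume *: "x \<in> {a..b} \<longrightarrow> ((\<lambda>x. integral {a..x} f) has_vector_derivative f x) (at x within {a..b})"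
    show "x \<in> {a..b} \<longrightarrow> (g has_vector_derivative f x) (at x within {a..b})"
    proof
      assume x: "x \<in> {a..b}"
      have "((\<lambda>x. integral {a..x} f + g a) has_vector_derivative f x) (at x within {a..b})"
        using * x by (auto intro!: derivative_eq_intros)
      then show "(g has_vector_derivative f x) (at x within {a..b})"
        by (rule has_vector_derivative_transform[OF x, rotated]) (use 2 in \<open>simp add: integral_unique[OF 2]\<close>)
    qed
  qed
  show thesis using 1 2 3 that by blast
qed

text \<open>
  The fundamental theorem in its absolutely continuous form: the derivative may fail to exist on a null
  set, because it agrees almost everywhere with the integrand found above.
\<close>

lemma ac_on_FTC:
  fixes g :: "real \<Rightarrow> 'a::euclidean_space"
  assumes g: "ac_on g a b" and ab: "a \<le> b"
    and d: "AE x in lebesgue. x \<in> {a..b} \<longrightarrow> (g has_vector_derivative g' x) (at x within {a..b})"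
  shows "g' absolutely_integrable_on {a..b}" "(g' has_integral g b - g a) {a..b}"
proof -
  obtain f where f: "f absolutely_integrable_on {a..b}"
    "\<And>x. x \<in> {a..b} \<Longrightarrow> (f has_integral g x - g a) {a..x}"
    "AE x in lebesgue. x \<in> {a..b} \<longrightarrow> (g has_vector_derivative f x) (at x within {a..b})"
    using ac_on_has_derivative_AE[OF g ab] by blast
  have "g' absolutely_integrable_on {a..b} \<and> (g' has_integral g b - g a) {a..b}"
  proof (cases "a = b")
    case True
    then show ?thesis using integrable_on_refl[of g' b] integrable_on_refl[of "\<lambda>x. norm (g' x)" b]
        has_integral_refl(2)[of g' b]
      by (simp add: absolutely_integrable_on_def)
  next
    case False
    with ab have "a < b" by simp
    have "AE x in lebesgue. x \<in> {a..b} \<longrightarrow> g' x = f x"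
      using d f(3)
    proof eventually_elim
      case (elim x)
      then show ?case using \<open>a < b\<close>
        by (auto intro!: vector_derivative_unique_within_closed_interval[of a b x g] simp: cbox_interval)
    qed
    then have N: "negligible {x \<in> {a..b}. g' x \<noteq> f x}"
      by (simp add: AE_lebesgue_iff_negligible)
    have "(g' has_integral g b - g a) {a..b}"
      by (rule has_integral_spike[OF N _ f(2)]) (use ab in auto)
    moreover have "g' absolutely_integrable_on {a..b}"
      by (rule absolutely_integrable_spike[OF f(1) N]) auto
    ultimately show ?thesis by blast
  qed
  then show "g' absolutely_integrable_on {a..b}" "(g' has_integral g b - g a) {a..b}" by auto
qed

lemma ac_on_antimono:
  fixes g :: "real \<Rightarrow> real"
  assumes g: "ac_on g a b" and ab: "a \<le> b"
    and d: "AE x in lebesgue. x \<in> {a..b} \<longrightarrow> (\<exists>D\<le>0. (g has_vector_derivative D) (at x within {a..b}))"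
  shows "g b \<le> g a"
proof -
  define g' where "g' = (\<lambda>x. if \<exists>D\<le>0. (g has_vector_derivative D) (at x within {a..b})
     then SOME D. D \<le> 0 \<and> (g has_vector_derivative D) (at x within {a..b}) else 0)"
  have le: "g' x \<le> 0" for x unfolding g'_def using someI_ex[of "\<lambda>D. D \<le> 0 \<and> (g has_vector_derivative D) (at x within {a..b})"] by auto
  have "AE x in lebesgue. x \<in> {a..b} \<longrightarrow> (g has_vector_derivative g' x) (at x within {a..b})"
    using d by eventually_elim
      (auto simp: g'_def intro: someI2[where P = "\<lambda>D. D \<le> 0 \<and> (g has_vector_derivative D) (at x within {a..b})" for x])
  from ac_on_FTC(2)[OF g ab this] have "g b - g a \<le> 0"
    by (rule has_integral_le[OF _ has_integral_0]) (use le in auto)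
  then show ?thesis by simp
qed

lemma ac_on_constant:
  fixes g :: "real \<Rightarrow> 'a::euclidean_space"
  assumes g: "ac_on g a b" and ab: "a \<le> b"
    and d: "AE x in lebesgue. x \<in> {a..b} \<longrightarrow> (g has_vector_derivative 0) (at x within {a..b})"
  shows "g b = g a"
  using ac_on_FTC(2)[OF g ab d] by (metis eq_iff_diff_eq_0 has_integral_0 has_integral_unique)

section \<open>The inequality that characterises infinitesimal generators\<close>

lemma compact_in_unit_disc_radius:
  assumes "compact K" "K \<subseteq> unit_disc"
  shows "\<exists>\<rho><1. \<forall>z\<in>K. cmod z \<le> \<rho>"
proof (cases "K = {}")
  case False
  then obtain x where "x \<in> K" "\<forall>y\<in>K. cmod y \<le> cmod x"
    using continuous_attains_sup[of K cmod] assms continuous_on_norm_id by blast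
  then show ?thesis using assms by (intro exI[of _ "cmod x"]) auto
qed (auto intro: exI[of _ 0])

text \<open>
  The inequality turns out to characterise \<open>Gen_disc\<close>. It is real-linear in \<open>F\<close> and involves point values
  only, so unlike the definition by semigroups it passes to limits at once.
\<close>

definition disc_generator :: "(complex \<Rightarrow> complex) \<Rightarrow> bool" where
  "disc_generator F \<longleftrightarrow> F holomorphic_on unit_disc \<and>
     (\<forall>z\<in>unit_disc. Re (cnj z * F z) \<le> Re (cnj (F 0) * z) * (1 - (cmod z)\<^sup>2))"

lemma disc_generator_limit:
  assumes F: "F holomorphic_on unit_disc" and Fn: "\<And>n. disc_generator (Fn n)"
    and lim: "\<And>z. z \<in> unit_disc \<Longrightarrow> (\<lambda>n::nat. Fn n z) \<longlonglongrightarrow> F z"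
  shows "disc_generator F"
  unfolding disc_generator_def
proof (intro conjI F ballI)
  fix z assume z: "z \<in> unit_disc"
  have "(\<lambda>n. Re (cnj (Fn n 0) * z) * (1 - (cmod z)\<^sup>2)) \<longlonglongrightarrow> Re (cnj (F 0) * z) * (1 - (cmod z)\<^sup>2)"
    by (intro tendsto_intros lim) auto
  moreover have "(\<lambda>n. Re (cnj z * Fn n z)) \<longlonglongrightarrow> Re (cnj z * F z)"
    by (intro tendsto_intros lim z)
  ultimately show "Re (cnj z * F z) \<le> Re (cnj (F 0) * z) * (1 - (cmod z)\<^sup>2)"
    using Fn z unfolding disc_generator_def by (intro LIMSEQ_le) auto
qed

lemma disc_generator_scaleR:
  assumes "disc_generator F" "0 \<le> c"
  shows "disc_generator (\<lambda>z. c *\<^sub>R F z)"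
proof -
  have h: "F holomorphic_on unit_disc"
    and le: "\<And>z. z \<in> unit_disc \<Longrightarrow> Re (cnj z * F z) \<le> Re (cnj (F 0) * z) * (1 - (cmod z)\<^sup>2)"
    using assms unfolding disc_generator_def by auto
  have "Re (cnj z * (c *\<^sub>R F z)) \<le> Re (cnj (c *\<^sub>R F 0) * z) * (1 - (cmod z)\<^sup>2)" if "z \<in> unit_disc" for z
    using mult_left_mono[OF le[OF that] \<open>0 \<le> c\<close>] by (simp add: algebra_simps)
  moreover have "(\<lambda>z. c *\<^sub>R F z) holomorphic_on unit_disc"
    unfolding scaleR_conv_of_real by (intro holomorphic_intros h)
  ultimately show ?thesis unfolding disc_generator_def by blast
qed

text \<open>
  The Schwarz lemma for \<open>f\<close> followed by the disc automorphism that sends \<open>f 0\<close> to \<open>0\<close>.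
\<close>

lemma Schwarz_Pick_origin:
  assumes f: "holomorphic_self_map f" and z: "cmod z < 1"
  shows "cmod (f z - f 0) \<le> cmod z * cmod (1 - cnj (f 0) * f z)"
proof -
  have hol: "f holomorphic_on ball 0 1" and im: "\<And>z. cmod z < 1 \<Longrightarrow> cmod (f z) < 1"
    using f unfolding holomorphic_self_map_def by (auto simp: image_subset_iff)
  define M where "M = Moebius_function 0 (f 0)"
  have "norm ((M \<circ> f) z) \<le> norm z"
  proof (rule Schwarz_Lemma(1))
    show "(M \<circ> f) holomorphic_on ball 0 1"
      unfolding M_def using im
      by (intro holomorphic_on_compose_gen[OF hol Moebius_function_holomorphic]) auto
    show "(M \<circ> f) 0 = 0" by (simp add: M_def Moebius_function_eq_zero)
    show "cmod ((M \<circ> f) w) < 1" if "cmod w < 1" for w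
      unfolding M_def comp_def using im that by (intro Moebius_function_norm_lt_1) auto
  qed (use z in auto)
  moreover have "cmod (cnj (f 0) * f z) < 1"
    using mult_strict_mono'[OF im[of 0] im[OF z]] by (simp add: norm_mult)
  then have "1 - cnj (f 0) * f z \<noteq> 0" by auto
  ultimately show ?thesis
    by (simp add: M_def Moebius_function_simple norm_divide divide_simps)
qed

text \<open>
  The maps \<open>h = id + e (f - id)\<close> with \<open>0 < e < 1\<close> are self-maps. For \<open>e = 0\<close> the Schwarz-Pick
  inequality is an equality, so its first-order term in \<open>e\<close> is an inequality as well, and this is the
  claim.
\<close>

lemma disc_generator_self_map_minus_id:
  assumes f: "holomorphic_self_map f"
  shows "disc_generator (\<lambda>z. f z - z)"
  unfolding disc_generator_def
proof (intro conjI ballI)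
  have hol: "f holomorphic_on ball 0 1" and im: "\<And>z. cmod z < 1 \<Longrightarrow> cmod (f z) < 1"
    using f unfolding holomorphic_self_map_def by (auto simp: image_subset_iff)
  show "(\<lambda>z. f z - z) holomorphic_on unit_disc" by (intro holomorphic_intros hol)
  fix z :: complex assume "z \<in> unit_disc"
  then have z: "cmod z < 1" by simp
  define a where "a = f 0"
  define D where "D = f z - z"
  have key: "2 * Re (cnj z * (D - a)) + e * (cmod (D - a))\<^sup>2
     \<le> (cmod z)\<^sup>2 * (- 2 * Re (cnj a * (z + e *\<^sub>R D)) + e * (cmod (cnj a * (z + e *\<^sub>R D)))\<^sup>2)"
    if e: "0 < e" "e < 1" for e :: real
  proof -
    define h where "h = (\<lambda>z. z + e *\<^sub>R (f z - z))"
    have "holomorphic_self_map h"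
      unfolding holomorphic_self_map_def
    proof
      show "h holomorphic_on unit_disc"
        unfolding h_def scaleR_conv_of_real by (intro holomorphic_intros hol)
      show "h ` unit_disc \<subseteq> unit_disc"
      proof clarsimp
        fix w :: complex assume w: "cmod w < 1"
        have "h w = (1 - e) *\<^sub>R w + e *\<^sub>R f w" by (simp add: h_def algebra_simps)
        then have "cmod (h w) \<le> (1 - e) * cmod w + e * cmod (f w)"
          using e by (metis norm_triangle_ineq norm_scaleR abs_of_pos diff_gt_0_iff_gt)
        also have "\<dots> < (1 - e) * 1 + e * 1"
          using w im[OF w] e by (intro add_strict_mono mult_strict_left_mono) auto
        finally show "cmod (h w) < 1" by simp
      qed
    qed
    define b where "b = cnj a * (z + e *\<^sub>R D)"
    have sq: "(cmod (v + e *\<^sub>R w))\<^sup>2 = (cmod v)\<^sup>2 + e * (2 * Re (cnj v * w) + e * (cmod w)\<^sup>2)" for v w :: complex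
      by (simp only: cmod_power2) (simp add: algebra_simps power2_eq_square)
    define X where "X = 2 * Re (cnj z * (D - a)) + e * (cmod (D - a))\<^sup>2"
    define Y where "Y = - 2 * Re b + e * (cmod b)\<^sup>2"
    have "cmod (z + e *\<^sub>R (D - a)) \<le> cmod z * cmod (1 - e *\<^sub>R b)"
      using Schwarz_Pick_origin[OF \<open>holomorphic_self_map h\<close> z]
      by (simp add: h_def D_def a_def b_def algebra_simps)
    then have "(cmod (z + e *\<^sub>R (D - a)))\<^sup>2 \<le> (cmod z)\<^sup>2 * (cmod (1 - e *\<^sub>R b))\<^sup>2"
      by (metis norm_ge_zero power_mono power_mult_distrib)
    moreover have "(cmod (1 - e *\<^sub>R b))\<^sup>2 = 1 + e * Y" using sq[of 1 "- b"] by (simp add: Y_def)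
    moreover have "(cmod (z + e *\<^sub>R (D - a)))\<^sup>2 = (cmod z)\<^sup>2 + e * X" unfolding X_def by (rule sq)
    ultimately have "e * X \<le> e * ((cmod z)\<^sup>2 * Y)" by (simp add: distrib_left mult.left_commute)
    then have "X \<le> (cmod z)\<^sup>2 * Y" using e by (simp only: mult_le_cancel_left_pos)
    then show ?thesis by (simp only: X_def Y_def b_def)
  qed
  have "((\<lambda>e. 2 * Re (cnj z * (D - a)) + e * (cmod (D - a))\<^sup>2) \<longlongrightarrow> 2 * Re (cnj z * (D - a)) + 0 * (cmod (D - a))\<^sup>2) (at_right 0)"
    by (intro tendsto_intros)
  moreover have "((\<lambda>e. (cmod z)\<^sup>2 * (- 2 * Re (cnj a * (z + e *\<^sub>R D)) + e * (cmod (cnj a * (z + e *\<^sub>R D)))\<^sup>2))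
     \<longlongrightarrow> (cmod z)\<^sup>2 * (- 2 * Re (cnj a * (z + 0 *\<^sub>R D)) + 0 * (cmod (cnj a * (z + 0 *\<^sub>R D)))\<^sup>2)) (at_right 0)"
    by (intro tendsto_intros)
  moreover have "eventually (\<lambda>e::real. 0 < e \<and> e < 1) (at_right 0)"
    by (intro eventually_conj eventually_at_right_less order_tendstoD(2)[OF tendsto_ident_at]) auto
  then have "eventually (\<lambda>e. 2 * Re (cnj z * (D - a)) + e * (cmod (D - a))\<^sup>2
     \<le> (cmod z)\<^sup>2 * (- 2 * Re (cnj a * (z + e *\<^sub>R D)) + e * (cmod (cnj a * (z + e *\<^sub>R D)))\<^sup>2)) (at_right 0)"
    by eventually_elim (use key in blast)
  ultimately have "2 * Re (cnj z * (D - a)) + 0 * (cmod (D - a))\<^sup>2 \<le>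
       (cmod z)\<^sup>2 * (- 2 * Re (cnj a * (z + 0 *\<^sub>R D)) + 0 * (cmod (cnj a * (z + 0 *\<^sub>R D)))\<^sup>2)"
    by (intro tendsto_le[of "at_right (0::real)"]) auto
  then have "Re (cnj z * D) - Re (cnj z * a) \<le> - (cmod z)\<^sup>2 * Re (cnj a * z)"
    by (simp add: algebra_simps)
  moreover have "Re (cnj z * a) = Re (cnj a * z)" by simp
  ultimately show "Re (cnj z * (f z - z)) \<le> Re (cnj (f 0 - 0) * z) * (1 - (cmod z)\<^sup>2)"
    unfolding D_def[symmetric] by (simp only: a_def[symmetric] diff_zero) (simp add: algebra_simps)
qed

text \<open>
  The Cayley transform of \<open>q\<close> based at \<open>q 0\<close> maps into the disc and fixes \<open>0\<close>, so the Schwarz lemma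
  gives \<open>|q z - q 0| \<le> |z| |q z + cnj (q 0)|\<close>, from which both estimates follow.
\<close>

lemma Harnack_two_sided:
  assumes hol: "q holomorphic_on unit_disc" and pos: "\<And>z. z \<in> unit_disc \<Longrightarrow> 0 \<le> Re (q z)"
    and z: "cmod z < 1"
  shows "cmod (q z) * (1 - cmod z) \<le> cmod (q 0) * (1 + cmod z)"
    "cmod (q 0) * (1 - cmod z) \<le> cmod (q z) * (1 + cmod z)"
proof -
  have main: "cmod (q z) * (1 - cmod z) \<le> cmod (q 0) * (1 + cmod z) + e \<and>
    cmod (q 0) * (1 - cmod z) \<le> cmod (q z) * (1 + cmod z) + e" if e: "e > 0" for e
  proof -
    \<comment> \<open>The shift makes the real part positive, so that the denominator of m cannot vanish.\<close>
    define p where "p = (\<lambda>z. q z + of_real (e/4))"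
    have ppos: "0 < Re (p w)" if "cmod w < 1" for w using pos[of w] e that unfolding p_def plus_complex.sel complex_of_real_def complex.sel by simp
    have hp: "p holomorphic_on ball 0 1" unfolding p_def by (intro holomorphic_intros hol)
    have nz: "p w + cnj (p 0) \<noteq> 0" if "cmod w < 1" for w
      using ppos[OF that] ppos[of 0] by (auto simp: complex_eq_iff)
    define m where "m = (\<lambda>w. (p w - p 0) / (p w + cnj (p 0)))"
    have "norm (m z) \<le> norm z"
    proof (rule Schwarz_Lemma(1))
      show "m holomorphic_on ball 0 1"
        unfolding m_def using nz by (intro holomorphic_intros hp) auto
      show "m 0 = 0" by (simp add: m_def)
      show "cmod (m w) < 1" if w: "cmod w < 1" for w
      proof -
        have "(cmod (p w + cnj (p 0)))\<^sup>2 - (cmod (p w - p 0))\<^sup>2 = 4 * (Re (p w) * Re (p 0))"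
          by (simp only: cmod_power2) (simp add: algebra_simps power2_eq_square)
        also have "\<dots> > 0" using ppos[OF w] ppos[of 0] by auto
        finally have "cmod (p w - p 0) < cmod (p w + cnj (p 0))"
          by (intro power2_less_imp_less[OF _ norm_ge_zero]) simp
        then show ?thesis using nz[OF w] by (simp add: m_def norm_divide divide_simps)
      qed
    qed (use z in auto)
    then have "cmod (p z - p 0) \<le> cmod z * cmod (p z + cnj (p 0))"
      using nz[OF z] by (simp add: m_def norm_divide divide_simps)
    also have "\<dots> \<le> cmod z * (cmod (p z) + cmod (p 0))"
      by (intro mult_left_mono) (auto intro: order_trans[OF norm_triangle_ineq])
    finally have 1: "cmod (p z - p 0) \<le> cmod (p z) * cmod z + cmod (p 0) * cmod z" by (simp add: algebra_simps)
    have 2: "cmod (p z) - cmod (p 0) \<le> cmod (p z - p 0)" "cmod (p 0) - cmod (p z) \<le> cmod (p z - p 0)"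
      using norm_triangle_ineq2[of "p z" "p 0"] norm_triangle_ineq2[of "p 0" "p z"] by (auto simp: norm_minus_commute)
    have near: "cmod (q w) \<le> cmod (p w) + e/4" "cmod (p w) \<le> cmod (q w) + e/4" for w
      using norm_triangle_ineq4[of "p w" "of_real (e/4)"] norm_triangle_ineq[of "q w" "of_real (e/4)"] e
      by (auto simp: p_def)
    have c: "cmod (q z) * (1 - cmod z) \<le> (cmod (p z) + e/4) * (1 - cmod z)"
      "cmod (q 0) * (1 - cmod z) \<le> (cmod (p 0) + e/4) * (1 - cmod z)"
      "cmod (p 0) * (1 + cmod z) \<le> (cmod (q 0) + e/4) * (1 + cmod z)"
      "cmod (p z) * (1 + cmod z) \<le> (cmod (q z) + e/4) * (1 + cmod z)"
      using near z by (auto intro!: mult_right_mono add_nonneg_nonneg)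
    have ez: "e * cmod z \<le> e" "0 \<le> e * cmod z" using e z by auto
    show ?thesis using 1 2 c ez e unfolding distrib_left distrib_right left_diff_distrib right_diff_distrib
        times_divide_eq_left
      by (intro conjI) linarith+
  qed
  show "cmod (q z) * (1 - cmod z) \<le> cmod (q 0) * (1 + cmod z)"
    by (rule field_le_epsilon) (use main in blast)
  show "cmod (q 0) * (1 - cmod z) \<le> cmod (q z) * (1 + cmod z)"
    by (rule field_le_epsilon) (use main in blast)
qed

text \<open>
  Writing \<open>F z = a - cnj a * z\<^sup>2 - z * q z\<close> turns the defining inequality into \<open>Re q \<ge> 0\<close>. Harnack's
  inequality, applied from \<open>1/2\<close> to \<open>0\<close> and from \<open>0\<close> to \<open>z\<close>, bounds \<open>q z\<close> by \<open>q (1/2)\<close>, which is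
  expressed by \<open>F 0\<close> and \<open>F (1/2)\<close>. A single point would not do: \<open>F z = - c * z\<close> with large
  \<open>c > 0\<close> vanishes at \<open>0\<close>.
\<close>

lemma disc_generator_bound:
  assumes F: "disc_generator F" and z: "cmod z \<le> r" and r: "r < 1"
  shows "cmod (F z) \<le> 20 / (1 - r) * (cmod (F 0) + cmod (F (1/2)))"
proof -
  have hol: "F holomorphic_on ball 0 1" using F by (simp add: disc_generator_def)
  define a where "a = F 0"
  define g where "g = (\<lambda>z. if z = 0 then deriv F 0 else (F z - F 0) / (z - 0))"
  define q where "q = (\<lambda>z. - cnj a * z - g z)"
  have hg: "g holomorphic_on ball 0 1"
    unfolding g_def using pole_lemma[OF hol, of 0] by simp
  have hq: "q holomorphic_on ball 0 1" unfolding q_def by (intro holomorphic_intros hg)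
  have Fq: "F w = a - cnj a * w^2 - w * q w" for w
    by (cases "w = 0") (simp_all add: q_def g_def a_def algebra_simps power2_eq_square diff_divide_distrib)
  have pos': "0 \<le> Re (q w)" if w: "cmod w < 1" "w \<noteq> 0" for w
  proof -
    have "Re (cnj w * F w) \<le> Re (cnj a * w) * (1 - (cmod w)\<^sup>2)"
      using F w(1) by (auto simp: disc_generator_def a_def)
    moreover have "Re (cnj w * F w) = Re (cnj a * w) * (1 - (cmod w)\<^sup>2) - (cmod w)\<^sup>2 * Re (q w)"
      unfolding Fq by (simp only: cmod_power2) (simp add: algebra_simps power2_eq_square)
    ultimately have "0 \<le> (cmod w)\<^sup>2 * Re (q w)" by simp
    then show ?thesis using w by (simp add: zero_le_mult_iff)
  qed
  have pos: "0 \<le> Re (q w)" if "w \<in> ball 0 1" for w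
  proof (cases "w = 0")
    case True
    have "isCont q 0"
      using holomorphic_on_imp_continuous_on[OF hq] by (simp add: continuous_on_eq_continuous_at)
    then have "((\<lambda>w. Re (q w)) \<longlongrightarrow> Re (q 0)) (at 0)" by (intro tendsto_intros) (simp add: isCont_def)
    moreover have "eventually (\<lambda>w. 0 \<le> Re (q w)) (at 0)"
      unfolding eventually_at using pos' by (auto intro!: exI[of _ 1] simp: dist_norm)
    ultimately have "0 \<le> Re (q 0)" by (intro tendsto_lowerbound) auto
    with True show ?thesis by simp
  qed (use pos' that in auto)
  have r0: "0 \<le> r" using z norm_ge_zero order_trans by blast
  have z1: "cmod z < 1" using z r by auto
  have "cmod (q 0) * (1 - cmod (1/2)) \<le> cmod (q (1/2)) * (1 + cmod (1/2))"
    by (rule Harnack_two_sided(2)[OF hq pos]) auto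
  then have q0: "cmod (q 0) \<le> 3 * cmod (q (1/2))" by simp
  have "q (1/2) = - cnj a / 2 - 2 * F (1/2) + 2 * a"
    by (simp add: q_def g_def a_def)
  then have "cmod (q (1/2)) \<le> cmod a / 2 + 2 * cmod (F (1/2)) + 2 * cmod a"
    using norm_triangle_ineq[of "- cnj a / 2 - 2 * F (1/2)" "2 * a"] norm_triangle_ineq4[of "- cnj a / 2" "2 * F (1/2)"]
    by (simp add: norm_divide norm_mult)
  then have q12: "cmod (q (1/2)) \<le> 3 * (cmod a + cmod (F (1/2)))"
    using norm_ge_zero[of a] norm_ge_zero[of "F (1/2)"] unfolding distrib_left by linarith
  define S where "S = cmod a + cmod (F (1/2))"
  have S0: "0 \<le> S" "cmod a \<le> S" by (auto simp: S_def)
  have "cmod (q z) * (1 - r) \<le> cmod (q z) * (1 - cmod z)" using z by (intro mult_left_mono) auto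
  also have "\<dots> \<le> cmod (q 0) * (1 + cmod z)" by (rule Harnack_two_sided(1)[OF hq pos z1])
  also have "\<dots> \<le> (9 * S) * 2" using q0 q12 z1 S0 unfolding S_def by (intro mult_mono) auto
  finally have qz: "cmod (q z) * (1 - r) \<le> 18 * S" by simp
  have "cmod (F z) \<le> cmod a + cmod (cnj a * z^2) + cmod (z * q z)"
    unfolding Fq[of z] using norm_triangle_ineq4[of "a - cnj a * z^2" "z * q z"] norm_triangle_ineq4[of a "cnj a * z^2"] by linarith
  also have "\<dots> \<le> cmod a + cmod a * 1 + 1 * cmod (q z)"
    unfolding norm_mult norm_power complex_mod_cnj using z1
    by (intro add_mono mult_mono order_refl power_le_one) auto
  finally have "cmod (F z) * (1 - r) \<le> (2 * cmod a + cmod (q z)) * (1 - r)" using r by (intro mult_right_mono) auto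
  also have "\<dots> \<le> 2 * S + 18 * S"
  proof -
    have "2 * cmod a * (1 - r) \<le> 2 * S * 1" using S0 r0 r by (intro mult_mono) auto
    with qz show ?thesis by (simp add: algebra_simps)
  qed
  finally have "cmod (F z) * (1 - r) \<le> 20 * S" by simp
  then show ?thesis using r unfolding S_def a_def by (simp add: divide_simps mult.commute)
qed

lemma Cauchy_Lipschitz_bound:
  assumes hol: "f holomorphic_on unit_disc" and r: "0 < r" "r < R" "R < 1"
    and bd: "\<And>z. z \<in> cball 0 R \<Longrightarrow> cmod (f z) \<le> M"
    and zw: "z \<in> cball 0 r" "w \<in> cball 0 r"
  shows "cmod (f z - f w) \<le> M / (R - r) * cmod (z - w)"
proof (rule field_differentiable_bound[of "cball 0 r" f "deriv f" "M / (R - r)" z w])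
  show "(f has_field_derivative deriv f x) (at x within cball 0 r)" if "x \<in> cball 0 r" for x
  proof -
    have "x \<in> unit_disc" using that r by auto
    then have "(f has_field_derivative deriv f x) (at x)" using holomorphic_derivI[OF hol open_ball] by blast
    then show ?thesis by (rule has_field_derivative_at_within)
  qed
  show "cmod (deriv f x) \<le> M / (R - r)" if x: "x \<in> cball 0 r" for x
  proof -
    have sub: "cball x (R - r) \<subseteq> cball 0 R" unfolding cball_subset_cball_iff using x by simp
    have sub': "cball x (R - r) \<subseteq> unit_disc" using sub r by force
    have "norm ((deriv ^^ 1) f x) \<le> fact 1 * M / (R - r) ^ 1"
    proof (rule Cauchy_inequality)
      show "f holomorphic_on ball x (R - r)" using hol sub' by (meson ball_subset_cball holomorphic_on_subset subset_trans)
      show "continuous_on (cball x (R - r)) f"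
        using hol sub' by (meson holomorphic_on_imp_continuous_on continuous_on_subset)
      show "0 < R - r" using r by simp
      show "cmod (f y) \<le> M" if "cmod (x - y) = R - r" for y
      proof (rule bd)
        have "y \<in> cball x (R - r)" using that by (simp add: dist_norm)
        with sub show "y \<in> cball 0 R" by blast
      qed
    qed
    then show ?thesis by simp
  qed
qed (use zw in auto)

text \<open>
  Derivatives from the right along the fixed sequence \<open>1/(n+1)\<close>; it links derivatives in time to pointwise
  limits of generators, and it makes one-sided derivatives unique.
\<close>

lemma right_difference_quotient_tendsto:
  fixes g :: "real \<Rightarrow> 'a::real_normed_vector"
  assumes d: "(g has_vector_derivative D) (at t within {s..})" and st: "s \<le> t"
  shows "(\<lambda>n. real (Suc n) *\<^sub>R (g (t + 1 / real (Suc n)) - g t)) \<longlonglongrightarrow> D"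
proof -
  have "((\<lambda>y. (g y - g t) /\<^sub>R (y - t)) \<longlongrightarrow> D) (at t within {s..})"
  proof -
    have "((\<lambda>y. norm ((g y - g t) /\<^sub>R (y - t) - D)) \<longlongrightarrow> 0) (at t within {s..})"
    proof (rule Lim_transform_eventually)
      show "((\<lambda>y. norm (g y - g t - (y - t) *\<^sub>R D) / norm (y - t)) \<longlongrightarrow> 0) (at t within {s..})"
        using d unfolding has_vector_derivative_def has_derivative_iff_norm by simp
      show "eventually (\<lambda>y. norm (g y - g t - (y - t) *\<^sub>R D) / norm (y - t) = norm ((g y - g t) /\<^sub>R (y - t) - D))
          (at t within {s..})"
        unfolding eventually_at_filter
      proof (intro always_eventually allI impI)
        fix y assume "y \<noteq> t"
        then have "(g y - g t) /\<^sub>R (y - t) - D = (g y - g t - (y - t) *\<^sub>R D) /\<^sub>R (y - t)"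
          by (simp add: scaleR_right_diff_distrib)
        then show "norm (g y - g t - (y - t) *\<^sub>R D) / norm (y - t) = norm ((g y - g t) /\<^sub>R (y - t) - D)"
          by (simp add: divide_inverse_commute)
      qed
    qed
    then show ?thesis by (simp add: tendsto_norm_zero_iff LIM_zero_iff)
  qed
  moreover have "filterlim (\<lambda>n. t + 1 / real (Suc n)) (at t within {s..}) sequentially"
    unfolding filterlim_at
  proof
    show "(\<lambda>n. t + 1 / real (Suc n)) \<longlonglongrightarrow> t"
      using tendsto_add[OF tendsto_const[of t] LIMSEQ_inverse_real_of_nat] by (simp add: inverse_eq_divide)
  qed (use st in \<open>auto intro!: always_eventually add_increasing2\<close>)
  ultimately have "(\<lambda>n. (g (t + 1 / real (Suc n)) - g t) /\<^sub>R (t + 1 / real (Suc n) - t)) \<longlonglongrightarrow> D"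
    by (rule filterlim_compose)
  then show ?thesis by simp
qed

text \<open>
  A generator is the limit of \<open>(\<phi>\<^bsub>h\<^esub> - id) / h\<close>, and each of these quotients satisfies the inequality
  because \<open>\<phi>\<^bsub>h\<^esub>\<close> is a self-map.
\<close>

lemma disc_generator_if_Gen_disc:
  assumes "F \<in> Gen_disc"
  shows "disc_generator F"
proof -
  obtain \<phi> where \<phi>: "disc_semigroup \<phi>" and F: "infinitesimal_generator \<phi> F"
    using assms by (auto simp: Gen_disc_def)
  show ?thesis
  proof (rule disc_generator_limit[where Fn = "\<lambda>n z. real (Suc n) *\<^sub>R (\<phi> (1 / real (Suc n)) z - z)"])
    show "F holomorphic_on unit_disc" using F by (simp add: infinitesimal_generator_def)
    show "disc_generator (\<lambda>z. real (Suc n) *\<^sub>R (\<phi> (1 / real (Suc n)) z - z))" for n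
      using \<phi> by (intro disc_generator_scaleR disc_generator_self_map_minus_id) (auto simp: disc_semigroup_def)
    fix z assume z: "z \<in> unit_disc"
    have "((\<lambda>t. \<phi> t z) has_vector_derivative F (\<phi> 0 z)) (at 0 within {0..})"
      using F z by (auto simp: infinitesimal_generator_def)
    moreover have "\<phi> 0 z = z" using \<phi> z by (auto simp: disc_semigroup_def)
    ultimately show "(\<lambda>n. real (Suc n) *\<^sub>R (\<phi> (1 / real (Suc n)) z - z)) \<longlonglongrightarrow> F z"
      using right_difference_quotient_tendsto[of "\<lambda>t. \<phi> t z" "F z" 0 0] by simp
  qed
qed

section \<open>Picard iteration for measurable time dependence\<close>

lemma integrable_lebesgue_on_iff:
  fixes f :: "'a::euclidean_space \<Rightarrow> 'b::euclidean_space"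
  assumes "S \<in> sets lebesgue"
  shows "integrable (lebesgue_on S) f \<longleftrightarrow> f absolutely_integrable_on S"
  using assms by (simp add: integrable_restrict_space set_integrable_def)

text \<open>
  For a simple function \<open>w\<close> the composition is pieced together from finitely many of the functions \<open>G z\<close>;
  the general case follows by continuity in the first variable.
\<close>

lemma measurable_Caratheodory_compose:
  fixes G :: "'b::{second_countable_topology, metric_space} \<Rightarrow> 'a \<Rightarrow> 'c::metric_space"
  assumes meas: "\<And>z. G z \<in> borel_measurable M" and cont: "\<And>t. t \<in> space M \<Longrightarrow> continuous_on UNIV (\<lambda>z. G z t)"
    and w: "w \<in> borel_measurable M"
  shows "(\<lambda>t. G (w t) t) \<in> borel_measurable M"
proof -
  obtain F where F: "\<And>i. simple_function M (F i)" "\<And>x. x \<in> space M \<Longrightarrow> (\<lambda>i. F i x) \<longlonglongrightarrow> w x"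
    using borel_measurable_implies_sequence_metric[OF w] by metis
  show ?thesis
  proof (rule borel_measurable_LIMSEQ_metric)
    fix i
    have fin: "finite (F i ` space M)" using F(1)[of i] by (simp add: simple_function_def)
    show "(\<lambda>t. G (F i t) t) \<in> borel_measurable M"
    proof (rule measurable_compose_countable'[OF meas])
      show "F i \<in> measurable M (count_space (F i ` space M))"
        using F(1)[of i] unfolding measurable_count_space_eq2[OF fin] simple_function_def by auto
      show "countable (F i ` space M)" using fin by (rule countable_finite)
    qed
  next
    fix t assume t: "t \<in> space M"
    have "isCont (\<lambda>z. G z t) (w t)" using cont[OF t] by (simp add: continuous_on_eq_continuous_at)
    then show "(\<lambda>i. G (F i t) t) \<longlonglongrightarrow> G (w t) t"
      using F(2)[OF t] by (rule isCont_tendsto_compose)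
  qed
qed

lemma ac_on_exp:
  fixes f :: "real \<Rightarrow> 'a::{real_normed_field, banach}"
  assumes f: "ac_on f a b"
  shows "ac_on (\<lambda>x. exp (f x)) a b"
proof -
  have "compact (f ` {a..b})"
    using ac_on_imp_continuous_on[OF f] by (intro compact_continuous_image) auto
  then obtain B where B: "\<And>x. x \<in> {a..b} \<Longrightarrow> norm (f x) \<le> B"
    using compact_imp_bounded bounded_iff by (metis imageI)
  have "norm (exp x - exp y) \<le> exp B * norm (x - y)" if "norm x \<le> B" "norm y \<le> B" for x y :: 'a
  proof (rule field_differentiable_bound[of "cball 0 B" exp exp])
    show "norm (exp z) \<le> exp B" if "z \<in> cball 0 B" for z :: 'a
      using norm_exp[of z] that by (auto intro: order_trans)
    show "(exp has_field_derivative exp z) (at z within cball 0 B)" for z :: 'a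
      by (rule DERIV_subset[OF DERIV_exp]) simp
  qed (use that in auto)
  then show ?thesis
    by (intro ac_on_lipschitz_compose[OF f, of "exp B"]) (use B in auto)
qed

text \<open>
  The weight \<open>exp (2 \<integral> L)\<close> makes the Picard operator of an equation with Lipschitz constant \<open>L t\<close> a
  contraction with factor \<open>1/2\<close>.
\<close>

lemma has_integral_exp_weight:
  fixes L :: "real \<Rightarrow> real"
  assumes L: "L absolutely_integrable_on {a..b}" and t: "t \<in> {a..b}"
  shows "((\<lambda>x. c * L x * exp (c * integral {a..x} L)) has_integral exp (c * integral {a..t} L) - 1) {a..t}"
proof -
  have Lt: "L absolutely_integrable_on {a..t}"
    using absolutely_integrable_on_subinterval[OF L, of a t] t by auto
  have at: "a \<le> t" using t by simp
  have ac: "ac_on (\<lambda>x. c * integral {a..x} L) a t"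
    by (rule ac_on_lipschitz_compose[OF ac_on_integral[OF Lt], of "\<bar>c\<bar>"]) (auto simp: abs_mult simp flip: right_diff_distrib)
  have "AE x in lebesgue. x \<in> {a..t} \<longrightarrow>
     ((\<lambda>x. exp (c * integral {a..x} L)) has_vector_derivative c * L x * exp (c * integral {a..x} L)) (at x within {a..t})"
  proof -
    have "L integrable_on {a..t}" using Lt by (simp add: absolutely_integrable_on_def)
    from AE_integral_has_vector_derivative[OF this] show ?thesis
      by eventually_elim
        (auto intro!: derivative_eq_intros simp flip: has_real_derivative_iff_has_vector_derivative)
  qed
  from ac_on_FTC(2)[OF ac_on_exp[OF ac] at this] show ?thesis by simp
qed

text \<open>
  Consecutive iterates differ by at most \<open>C * E t / 2 ^ n\<close> with the weight \<open>E t = exp (2 \<integral> L)\<close>: integrating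
  this bound against \<open>L\<close> gains the factor \<open>1/2\<close>. So the iterates converge uniformly, and dominated
  convergence with majorant \<open>m\<close> shows that the limit solves the integral equation.
\<close>

proposition Picard_Caratheodory:
  fixes G :: "complex \<Rightarrow> real \<Rightarrow> complex"
  assumes sT: "s \<le> T"
    and meas: "\<And>z. G z \<in> borel_measurable (lebesgue_on {s..T})"
    and L: "L absolutely_integrable_on {s..T}" "\<And>t. t \<in> {s..T} \<Longrightarrow> 0 \<le> L t"
    and lip: "\<And>t z w. t \<in> {s..T} \<Longrightarrow> cmod (G z t - G w t) \<le> L t * cmod (z - w)"
    and m: "m integrable_on {s..T}" and bd: "\<And>t z. t \<in> {s..T} \<Longrightarrow> cmod (G z t) \<le> m t"
  obtains w where "continuous_on {s..T} w" "(\<lambda>\<tau>. G (w \<tau>) \<tau>) absolutely_integrable_on {s..T}"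
    "\<And>t. t \<in> {s..T} \<Longrightarrow> ((\<lambda>\<tau>. G (w \<tau>) \<tau>) has_integral w t - z0) {s..t}"
proof -
  have m0: "0 \<le> m t" if "t \<in> {s..T}" for t using bd[OF that, of 0] norm_ge_zero order_trans by blast
  have absint: "(\<lambda>\<tau>. G (w \<tau>) \<tau>) absolutely_integrable_on {s..T}" if w: "continuous_on {s..T} w" for w
  proof (rule measurable_bounded_by_integrable_imp_absolutely_integrable[OF _ _ m])
    show "(\<lambda>\<tau>. G (w \<tau>) \<tau>) \<in> borel_measurable (lebesgue_on {s..T})"
    proof (rule measurable_Caratheodory_compose[OF meas])
      show "w \<in> borel_measurable (lebesgue_on {s..T})"
        using w by (intro continuous_imp_measurable_on_sets_lebesgue) auto
      fix t assume "t \<in> space (lebesgue_on {s..T})"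
      then have t: "t \<in> {s..T}" by simp
      have "(L t)-lipschitz_on UNIV (\<lambda>z. G z t)"
        using lip[OF t] L(2)[OF t] by (intro lipschitz_onI) (auto simp: dist_norm)
      then show "continuous_on UNIV (\<lambda>z. G z t)" by (rule lipschitz_on_continuous_on)
    qed
  qed (use bd in auto)
  have int: "(\<lambda>\<tau>. G (w \<tau>) \<tau>) integrable_on {s..t}" if w: "continuous_on {s..T} w" and "t \<in> {s..T}" for w t
  proof (rule integrable_subinterval_real)
    show "(\<lambda>\<tau>. G (w \<tau>) \<tau>) integrable_on {s..T}" using absint[OF w] by (simp add: absolutely_integrable_on_def)
  qed (use that in auto)
  define W where "W = rec_nat (\<lambda>t::real. z0) (\<lambda>n w t. z0 + integral {s..t} (\<lambda>\<tau>. G (w \<tau>) \<tau>))"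
  have W0: "W 0 = (\<lambda>t. z0)" and WS: "W (Suc n) = (\<lambda>t. z0 + integral {s..t} (\<lambda>\<tau>. G (W n \<tau>) \<tau>))" for n
    by (simp_all add: W_def)
  have contW: "continuous_on {s..T} (W n)" for n
  proof (induction n)
    case (Suc n)
    have "(\<lambda>\<tau>. G (W n \<tau>) \<tau>) integrable_on {s..T}" using absint[OF Suc] by (simp add: absolutely_integrable_on_def)
    then show ?case unfolding WS by (intro continuous_on_add continuous_on_const indefinite_integral_continuous_1)
  qed (simp add: W0)
  define E where "E = (\<lambda>t. exp (2 * integral {s..t} L))"
  have Lint: "L integrable_on {s..T}" using L by (simp add: absolutely_integrable_on_def)
  have Lint': "L integrable_on {s..t}" if "t \<in> {s..T}" for t
    using that by (intro integrable_subinterval_real[OF Lint]) auto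
  have E1: "1 \<le> E t" if "t \<in> {s..T}" for t
    unfolding E_def one_le_exp_iff using L(2) that by (intro mult_nonneg_nonneg integral_nonneg Lint') auto
  have ET: "E t \<le> E T" if "t \<in> {s..T}" for t
    unfolding E_def using integral_subset_le[OF _ Lint'[OF that] Lint] L(2) that by auto
  have Eint: "((\<lambda>x. L x * E x) has_integral (E t - 1) / 2) {s..t}" if "t \<in> {s..T}" for t
    using has_integral_mult_right[OF has_integral_exp_weight[OF L(1) that, of 2], of "1/2"] by (simp add: E_def)
  define C where "C = integral {s..T} m"
  have C0: "0 \<le> C" unfolding C_def using m m0 by (intro integral_nonneg) auto
  have step: "cmod (W (Suc n) t - W n t) \<le> C * E t / 2 ^ n" if "t \<in> {s..T}" for n t
    using that
  proof (induction n arbitrary: t)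
    case 0
    have "cmod (integral {s..t} (\<lambda>\<tau>. G z0 \<tau>)) \<le> integral {s..t} m"
    proof (rule integral_norm_bound_integral)
      show "(\<lambda>\<tau>. G z0 \<tau>) integrable_on {s..t}" using int[of "\<lambda>_. z0" t] 0 by simp
      show "m integrable_on {s..t}" using 0 by (intro integrable_subinterval_real[OF m]) auto
    qed (use bd 0 in auto)
    also have "\<dots> \<le> C" unfolding C_def using 0 m m0
      by (intro integral_subset_le) (auto intro: integrable_subinterval_real[OF m])
    also have "\<dots> \<le> C * E t" using E1[OF 0] C0 mult_left_mono by fastforce
    finally show ?case by (simp add: WS W0)
  next
    case (Suc n)
    have "cmod (W (Suc (Suc n)) t - W (Suc n) t)
        = cmod (integral {s..t} (\<lambda>\<tau>. G (W (Suc n) \<tau>) \<tau> - G (W n \<tau>) \<tau>))"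
      unfolding WS[of "Suc n"] fun_cong[OF WS[of n], of t]
        integral_diff[OF int[OF contW[of "Suc n"] Suc.prems] int[OF contW[of n] Suc.prems]] by simp
    also have "\<dots> \<le> integral {s..t} (\<lambda>\<tau>. (C / 2 ^ n) * (L \<tau> * E \<tau>))"
    proof (rule integral_norm_bound_integral)
      show "(\<lambda>\<tau>. G (W (Suc n) \<tau>) \<tau> - G (W n \<tau>) \<tau>) integrable_on {s..t}"
        using int contW Suc.prems by (intro integrable_diff) auto
      show "(\<lambda>\<tau>. (C / 2 ^ n) * (L \<tau> * E \<tau>)) integrable_on {s..t}"
        using Eint[OF Suc.prems] by (intro integrable_on_mult_right) (auto simp: integrable_on_def)
      fix \<tau> assume "\<tau> \<in> {s..t}"
      then have \<tau>: "\<tau> \<in> {s..T}" using Suc.prems by auto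
      have "cmod (G (W (Suc n) \<tau>) \<tau> - G (W n \<tau>) \<tau>) \<le> L \<tau> * cmod (W (Suc n) \<tau> - W n \<tau>)" by (rule lip[OF \<tau>])
      also have "\<dots> \<le> L \<tau> * (C * E \<tau> / 2 ^ n)" using L(2)[OF \<tau>] Suc.IH[OF \<tau>] by (intro mult_left_mono)
      finally show "cmod (G (W (Suc n) \<tau>) \<tau> - G (W n \<tau>) \<tau>) \<le> (C / 2 ^ n) * (L \<tau> * E \<tau>)"
        by (simp add: mult_ac)
    qed
    also have "\<dots> = (C / 2 ^ n) * ((E t - 1) / 2)"
      using has_integral_mult_right[OF Eint[OF Suc.prems], of "C / 2 ^ n"] by (rule integral_unique)
    also have "\<dots> \<le> (C / 2 ^ n) * (E t / 2)" using C0 by (intro mult_left_mono) auto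
    finally show ?case by simp
  qed
  define w where "w = (\<lambda>t. z0 + (\<Sum>i. W (Suc i) t - W i t))"
  have tel: "(\<Sum>i<n. W (Suc i) t - W i t) = W n t - z0" for n t
    using sum_lessThan_telescope[of "\<lambda>i. W i t" n] by (simp add: W0)
  have "uniform_limit {s..T} (\<lambda>n t. \<Sum>i<n. W (Suc i) t - W i t) (\<lambda>t. \<Sum>i. W (Suc i) t - W i t) sequentially"
  proof (rule Weierstrass_m_test)
    show "cmod (W (Suc n) t - W n t) \<le> C * E T * (1/2) ^ n" if "t \<in> {s..T}" for n t
    proof -
      have "C * E t / 2 ^ n \<le> C * E T / 2 ^ n" using ET[OF that] C0 by (intro divide_right_mono mult_left_mono) auto
      then show ?thesis using step[OF that, of n] by (simp add: power_divide)
    qed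
    show "summable (\<lambda>n. C * E T * (1/2) ^ n)" by (intro summable_mult summable_geometric) auto
  qed
  then have "uniform_limit {s..T} (\<lambda>n t. W n t - z0) (\<lambda>t. \<Sum>i. W (Suc i) t - W i t) sequentially"
    unfolding tel .
  then have "uniform_limit {s..T} (\<lambda>n t. z0 + (W n t - z0)) w sequentially"
    unfolding w_def by (intro uniform_limit_add uniform_limit_const)
  then have ul: "uniform_limit {s..T} W w sequentially" by simp
  have contw: "continuous_on {s..T} w"
    by (rule uniform_limit_theorem[OF _ ul]) (use contW in auto)
  have lim: "(\<lambda>n. W n t) \<longlonglongrightarrow> w t" if "t \<in> {s..T}" for t
    using tendsto_uniform_limitI[OF ul that] .
  have "((\<lambda>\<tau>. G (w \<tau>) \<tau>) has_integral w t - z0) {s..t}" if t: "t \<in> {s..T}" for t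
  proof -
    have "(\<lambda>n. integral {s..t} (\<lambda>\<tau>. G (W n \<tau>) \<tau>)) \<longlonglongrightarrow> integral {s..t} (\<lambda>\<tau>. G (w \<tau>) \<tau>)"
    proof (rule dominated_convergence(2))
      show "m integrable_on {s..t}" using t by (intro integrable_subinterval_real[OF m]) auto
      fix \<tau> assume "\<tau> \<in> {s..t}"
      then have \<tau>: "\<tau> \<in> {s..T}" using t by auto
      show "(\<lambda>n. G (W n \<tau>) \<tau>) \<longlonglongrightarrow> G (w \<tau>) \<tau>"
      proof (rule LIM_zero_cancel, rule Lim_null_comparison)
        show "eventually (\<lambda>n. norm (G (W n \<tau>) \<tau> - G (w \<tau>) \<tau>) \<le> L \<tau> * cmod (W n \<tau> - w \<tau>)) sequentially"
          using lip[OF \<tau>] by simp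
        show "(\<lambda>n. L \<tau> * cmod (W n \<tau> - w \<tau>)) \<longlonglongrightarrow> 0"
          using lim[OF \<tau>] by (intro tendsto_mult_right_zero tendsto_norm_zero LIM_zero)
      qed
      show "cmod (G (W n \<tau>) \<tau>) \<le> m \<tau>" for n using bd[OF \<tau>] .
    qed (use int contW t in auto)
    then have "(\<lambda>n. W (Suc n) t) \<longlonglongrightarrow> z0 + integral {s..t} (\<lambda>\<tau>. G (w \<tau>) \<tau>)"
      unfolding WS by (intro tendsto_intros)
    then have "w t = z0 + integral {s..t} (\<lambda>\<tau>. G (w \<tau>) \<tau>)"
      using LIMSEQ_Suc[OF lim[OF t]] LIMSEQ_unique by blast
    then show ?thesis using integrable_integral[OF int[OF contw t]] by simp
  qed
  then show thesis using that contw absint by blast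
qed

lemma Lp_interval_absolutely_integrable:
  assumes k: "Lp_interval d T k" and d: "1 \<le> d"
  shows "k absolutely_integrable_on {0..T}"
proof (cases "d = \<infinity>")
  case True
  have km: "k \<in> borel_measurable (lebesgue_on {0..T})" using k by (simp add: Lp_interval_def)
  obtain C where "AE t in lebesgue_on {0..T}. \<bar>k t\<bar> \<le> C" using k True by (auto simp: Lp_interval_def)
  then have "integrable (lebesgue_on {0..T}) k"
    using km by (intro Bochner_Integration.integrable_bound[of _ "\<lambda>_. C" k])
      (auto intro!: finite_measure.integrable_const finite_measure_lebesgue_on elim!: eventually_mono)
  then show ?thesis by (simp add: integrable_lebesgue_on_iff)
next
  case False
  have km: "k \<in> borel_measurable (lebesgue_on {0..T})" using k by (simp add: Lp_interval_def)
  define p where "p = enn2real d"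
  have p: "1 \<le> p" using d False unfolding p_def by (cases d) auto
  have i: "integrable (lebesgue_on {0..T}) (\<lambda>t. \<bar>k t\<bar> powr p)"
    using k False by (auto simp: Lp_interval_def p_def)
  have "integrable (lebesgue_on {0..T}) (\<lambda>t. 1 + \<bar>k t\<bar> powr p)"
    by (intro Bochner_Integration.integrable_add i finite_measure.integrable_const finite_measure_lebesgue_on) (simp add: lmeasurable_interval)
  moreover have "\<bar>x\<bar> \<le> 1 + \<bar>x\<bar> powr p" for x :: real
  proof (cases "\<bar>x\<bar> \<le> 1")
    case False
    then have "\<bar>x\<bar> powr 1 \<le> \<bar>x\<bar> powr p" using p by (intro powr_mono) auto
    then show ?thesis using False by auto
  qed (auto intro: add_increasing2)
  ultimately have "integrable (lebesgue_on {0..T}) k"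
    using km by (intro Bochner_Integration.integrable_bound[of _ "\<lambda>t. 1 + \<bar>k t\<bar> powr p" k]) auto
  then show ?thesis by (simp add: integrable_lebesgue_on_iff)
qed

text \<open>
  For finite \<open>d\<close> the sum is compared with twice the larger of the two summands, which avoids
  Minkowski's inequality.
\<close>

lemma Lp_interval_mult_add:
  assumes k: "Lp_interval d T k" and l: "Lp_interval d T l" and d: "1 \<le> d" and c: "0 \<le> c"
  shows "Lp_interval d T (\<lambda>t. c * (k t + l t))"
proof -
  have km: "k \<in> borel_measurable (lebesgue_on {0..T})" "l \<in> borel_measurable (lebesgue_on {0..T})"
    using k l by (simp_all add: Lp_interval_def)
  have m: "(\<lambda>t. c * (k t + l t)) \<in> borel_measurable (lebesgue_on {0..T})" using km by measurable
  show ?thesis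
  proof (cases "d = \<infinity>")
    case True
    then obtain C D where "AE t in lebesgue_on {0..T}. \<bar>k t\<bar> \<le> C" "AE t in lebesgue_on {0..T}. \<bar>l t\<bar> \<le> D"
      using k l by (auto simp: Lp_interval_def)
    then have "AE t in lebesgue_on {0..T}. \<bar>c * (k t + l t)\<bar> \<le> c * (C + D)"
      by eventually_elim (use c in \<open>auto simp: abs_mult intro!: mult_left_mono\<close>)
    then show ?thesis using m True unfolding Lp_interval_def by auto
  next
    case False
    define p where "p = enn2real d"
    have p: "1 \<le> p" using d False unfolding p_def by (cases d) auto
    have i: "integrable (lebesgue_on {0..T}) (\<lambda>t. \<bar>k t\<bar> powr p)" "integrable (lebesgue_on {0..T}) (\<lambda>t. \<bar>l t\<bar> powr p)"
      using k l False by (auto simp: Lp_interval_def p_def)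
    have "integrable (lebesgue_on {0..T}) (\<lambda>t. (2 * c) powr p * (\<bar>k t\<bar> powr p + \<bar>l t\<bar> powr p))"
      by (intro Bochner_Integration.integrable_add Bochner_Integration.integrable_mult_right i)
    note dom = this
    have le: "\<bar>c * (x + y)\<bar> powr p \<le> (2 * c) powr p * (\<bar>x\<bar> powr p + \<bar>y\<bar> powr p)" for x y :: real
    proof -
      have "\<bar>c * (x + y)\<bar> \<le> 2 * c * max \<bar>x\<bar> \<bar>y\<bar>"
      proof -
        have "\<bar>c * (x + y)\<bar> = c * \<bar>x + y\<bar>" using c by (simp add: abs_mult)
        also have "\<dots> \<le> c * (2 * max \<bar>x\<bar> \<bar>y\<bar>)" using c by (intro mult_left_mono) auto
        finally show ?thesis by simp
      qed
      then have "\<bar>c * (x + y)\<bar> powr p \<le> (2 * c * max \<bar>x\<bar> \<bar>y\<bar>) powr p"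
        using p by (intro powr_mono2) auto
      also have "\<dots> = (2 * c) powr p * (max \<bar>x\<bar> \<bar>y\<bar> powr p)" by (rule powr_mult)
      also have "\<dots> \<le> (2 * c) powr p * (\<bar>x\<bar> powr p + \<bar>y\<bar> powr p)"
        by (intro mult_left_mono) (auto simp: max_def)
      finally show ?thesis .
    qed
    have "integrable (lebesgue_on {0..T}) (\<lambda>t. \<bar>c * (k t + l t)\<bar> powr p)"
    proof (rule Bochner_Integration.integrable_bound[OF dom])
      show "(\<lambda>t. \<bar>c * (k t + l t)\<bar> powr p) \<in> borel_measurable (lebesgue_on {0..T})" using m by measurable
      have "norm (\<bar>c * (k t + l t)\<bar> powr p) \<le> norm ((2 * c) powr p * (\<bar>k t\<bar> powr p + \<bar>l t\<bar> powr p))" for t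
        using le[of "k t" "l t"] by simp
      then show "AE t in lebesgue_on {0..T}. norm (\<bar>c * (k t + l t)\<bar> powr p)
          \<le> norm ((2 * c) powr p * (\<bar>k t\<bar> powr p + \<bar>l t\<bar> powr p))" by simp
    qed
    then show ?thesis using m False unfolding Lp_interval_def p_def by auto
  qed
qed

section \<open>Gronwall's lemma and bounds almost everywhere\<close>

lemma ac_on_mult:
  fixes f g :: "real \<Rightarrow> 'a::real_normed_algebra"
  assumes f: "ac_on f a b" and g: "ac_on g a b"
  shows "ac_on (\<lambda>x. f x * g x) a b"
proof -
  have "compact (f ` {a..b})" "compact (g ` {a..b})"
    using ac_on_imp_continuous_on[OF f] ac_on_imp_continuous_on[OF g] by (auto intro!: compact_continuous_image)
  then obtain B C where B: "\<And>x. x \<in> {a..b} \<Longrightarrow> norm (f x) \<le> B" and C: "\<And>x. x \<in> {a..b} \<Longrightarrow> norm (g x) \<le> C"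
    using compact_imp_bounded bounded_iff by (metis imageI)
  show ?thesis
  proof (rule ac_on_compare[OF f g, of "\<bar>C\<bar>" "\<bar>B\<bar>"])
    fix u t assume ut: "u \<in> {a..b}" "t \<in> {a..b}"
    have "f t * g t - f u * g u = (f t - f u) * g t + f u * (g t - g u)" by (simp add: algebra_simps)
    then have "norm (f t * g t - f u * g u) \<le> norm ((f t - f u) * g t) + norm (f u * (g t - g u))"
      by (metis norm_triangle_ineq)
    also have "\<dots> \<le> norm (f t - f u) * norm (g t) + norm (f u) * norm (g t - g u)"
      by (intro add_mono norm_mult_ineq)
    also have "\<dots> \<le> norm (f t - f u) * \<bar>C\<bar> + \<bar>B\<bar> * norm (g t - g u)"
      using B[OF ut(1)] C[OF ut(2)] by (intro add_mono mult_mono) auto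
    finally show "norm (f t * g t - f u * g u) \<le> \<bar>C\<bar> * norm (f t - f u) + \<bar>B\<bar> * norm (g t - g u)"
      by (simp add: mult.commute)
  qed auto
qed

lemma ac_on_mult_left:
  fixes f :: "real \<Rightarrow> 'a::real_normed_field"
  assumes f: "ac_on f a b"
  shows "ac_on (\<lambda>x. c * f x) a b"
proof (rule ac_on_lipschitz_compose[OF f, of "norm c"])
  fix u t
  have "c * f t - c * f u = c * (f t - f u)" by (simp only: right_diff_distrib)
  then show "norm (c * f t - c * f u) \<le> norm c * norm (f t - f u)" by (simp only: norm_mult)
qed simp

lemma ac_on_diff:
  assumes f: "ac_on f a b" and g: "ac_on g a b"
  shows "ac_on (\<lambda>x. f x - g x) a b"
proof (rule ac_on_compare[OF f g, of 1 1])
  fix u t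
  have "f t - g t - (f u - g u) = (f t - f u) - (g t - g u)" by simp
  then show "norm (f t - g t - (f u - g u)) \<le> 1 * norm (f t - f u) + 1 * norm (g t - g u)"
    using norm_triangle_ineq4[of "f t - f u" "g t - g u"] by (simp only: mult_1)
qed auto

lemma ac_on_norm_power2:
  fixes f :: "real \<Rightarrow> 'a::real_normed_vector"
  assumes f: "ac_on f a b"
  shows "ac_on (\<lambda>x. (norm (f x))\<^sup>2) a b"
proof -
  have "ac_on (\<lambda>x. norm (f x)) a b"
    by (rule ac_on_lipschitz_compose[OF f, of 1]) (auto simp: norm_triangle_ineq3)
  from ac_on_mult[OF this this] show ?thesis by (simp add: power2_eq_square)
qed

lemma ac_on_cong:
  assumes "ac_on f a b" "\<And>x. x \<in> {a..b} \<Longrightarrow> f x = g x"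
  shows "ac_on g a b"
  by (rule ac_on_lipschitz_compose[OF assms(1), of 1]) (use assms(2) in auto)

text \<open>
  The product of \<open>y\<close> and \<open>exp (- c \<integral> m)\<close> has a nonpositive derivative almost everywhere. The lemma
  is applied below to a negative \<open>y\<close> with negative \<open>c\<close> as well.
\<close>

lemma ac_on_Gronwall:
  fixes y m :: "real \<Rightarrow> real"
  assumes y: "ac_on y a b" and ab: "a \<le> b" and m: "m absolutely_integrable_on {a..b}"
    and d: "AE x in lebesgue. x \<in> {a..b} \<longrightarrow>
      (\<exists>D. (y has_vector_derivative D) (at x within {a..b}) \<and> D \<le> c * m x * y x)"
  shows "y b \<le> y a * exp (c * integral {a..b} m)"
proof -
  define e where "e = (\<lambda>x. exp (- c * integral {a..x} m))"
  have "ac_on e a b" unfolding e_def by (intro ac_on_exp ac_on_mult_left ac_on_integral m)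
  then have ac: "ac_on (\<lambda>x. y x * e x) a b" by (rule ac_on_mult[OF y])
  have "m integrable_on {a..b}" using m by (simp add: absolutely_integrable_on_def)
  from AE_integral_has_vector_derivative[OF this]
  have "AE x in lebesgue. x \<in> {a..b} \<longrightarrow> (\<exists>D\<le>0. ((\<lambda>x. y x * e x) has_vector_derivative D) (at x within {a..b}))"
    using d
  proof eventually_elim
    case (elim x)
    show ?case
    proof
      assume x: "x \<in> {a..b}"
      then obtain D where D: "(y has_vector_derivative D) (at x within {a..b})" "D \<le> c * m x * y x"
        using elim by blast
      have "(e has_vector_derivative - c * m x * e x) (at x within {a..b})"
        using elim(1) x unfolding e_def
        by (auto intro!: derivative_eq_intros simp flip: has_real_derivative_iff_has_vector_derivative)
      then have "((\<lambda>x. y x * e x) has_vector_derivative y x * (- c * m x * e x) + D * e x) (at x within {a..b})"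
        by (rule has_vector_derivative_mult[OF D(1)])
      moreover have "D * e x \<le> c * m x * y x * e x" using D(2) by (intro mult_right_mono) (auto simp: e_def)
      then have "y x * (- c * m x * e x) + D * e x \<le> 0" by (simp add: algebra_simps)
      ultimately show "\<exists>D\<le>0. ((\<lambda>x. y x * e x) has_vector_derivative D) (at x within {a..b})" by blast
    qed
  qed
  from ac_on_antimono[OF ac ab this] have "y b * e b \<le> y a" by (simp add: e_def)
  then have "y b * e b * exp (c * integral {a..b} m) \<le> y a * exp (c * integral {a..b} m)"
    by (rule mult_right_mono) simp
  moreover have "e b * exp (c * integral {a..b} m) = 1" by (simp add: e_def flip: exp_add)
  ultimately show ?thesis by (simp add: mult.assoc)
qed

lemma has_vector_derivative_norm_power2:
  fixes f :: "real \<Rightarrow> 'a::real_inner"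
  assumes "(f has_vector_derivative D) (at t within S)"
  shows "((\<lambda>t. (norm (f t))\<^sup>2) has_vector_derivative 2 * (f t \<bullet> D)) (at t within S)"
  using bounded_bilinear.has_vector_derivative[OF bounded_bilinear_inner assms assms]
  by (simp add: power2_norm_eq_inner inner_commute)

text \<open>
  A mean value inequality in which both the derivative and its bound are given almost everywhere.
\<close>

lemma ac_on_norm_increment_le:
  fixes g :: "real \<Rightarrow> 'a::euclidean_space"
  assumes g: "ac_on g a b" and ab: "a \<le> b" and k: "k integrable_on {a..b}"
    and d: "AE x in lebesgue. x \<in> {a..b} \<longrightarrow> (g has_vector_derivative g' x) (at x within {a..b})"
    and le: "AE x in lebesgue. x \<in> {a..b} \<longrightarrow> norm (g' x) \<le> k x"
  shows "norm (g b - g a) \<le> integral {a..b} k"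
proof -
  define N where "N = {x \<in> {a..b}. \<not> norm (g' x) \<le> k x}"
  have N: "negligible N" using le unfolding AE_lebesgue_iff_negligible N_def by (simp add: conj_commute)
  have i: "(g' has_integral g b - g a) {a..b}" by (rule ac_on_FTC(2)[OF g ab d])
  have 1: "((\<lambda>x. if x \<in> N then 0 else g' x) has_integral g b - g a) {a..b}"
    by (rule has_integral_spike[OF N _ i]) auto
  have 2: "((\<lambda>x. if x \<in> N then 0 else k x) has_integral integral {a..b} k) {a..b}"
    by (rule has_integral_spike[OF N _ integrable_integral[OF k]]) auto
  have "norm (integral {a..b} (\<lambda>x. if x \<in> N then 0 else g' x)) \<le> integral {a..b} (\<lambda>x. if x \<in> N then 0 else k x)"
    using 1 2 by (intro integral_norm_bound_integral) (auto simp: integrable_on_def N_def)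
  then show ?thesis using integral_unique[OF 1] integral_unique[OF 2] by simp
qed

lemma measurable_AE_bounded_imp_absolutely_integrable:
  fixes f :: "'a::euclidean_space \<Rightarrow> 'b::euclidean_space"
  assumes f: "f \<in> borel_measurable (lebesgue_on S)" and S: "S \<in> sets lebesgue"
    and g: "g absolutely_integrable_on S" and le: "AE x in lebesgue. x \<in> S \<longrightarrow> norm (f x) \<le> (g x :: real)"
  shows "f absolutely_integrable_on S"
proof -
  have "integrable (lebesgue_on S) g" using g S by (simp add: integrable_lebesgue_on_iff)
  moreover have "AE x in lebesgue_on S. norm (f x) \<le> norm (g x)"
    using le S by (subst AE_restrict_space_iff) (auto elim: eventually_mono)
  ultimately have "integrable (lebesgue_on S) f" by (rule Bochner_Integration.integrable_bound[OF _ f])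
  then show ?thesis using S by (simp add: integrable_lebesgue_on_iff)
qed

lemma borel_measurable_lebesgue_on_subset:
  assumes "f \<in> borel_measurable (lebesgue_on S)" "T \<subseteq> S"
  shows "f \<in> borel_measurable (lebesgue_on T)"
  using measurable_restrict_mono[OF assms] .

section \<open>Trajectories of a field of generators\<close>

abbreviation AE_majorant :: "(complex \<Rightarrow> real \<Rightarrow> complex) \<Rightarrow> (real \<Rightarrow> real) \<Rightarrow> real \<Rightarrow> real \<Rightarrow> bool" where
  "AE_majorant G k r T \<equiv> AE t in lebesgue. t \<in> {0..T} \<longrightarrow> (\<forall>z\<in>cball 0 r. cmod (G z t) \<le> k t)"

abbreviation AE_Lipschitz :: "(complex \<Rightarrow> real \<Rightarrow> complex) \<Rightarrow> (real \<Rightarrow> real) \<Rightarrow> real \<Rightarrow> real \<Rightarrow> bool" where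
  "AE_Lipschitz G L r T \<equiv> AE t in lebesgue. t \<in> {0..T} \<longrightarrow>
      (\<forall>z\<in>cball 0 r. \<forall>w\<in>cball 0 r. cmod (G z t - G w t) \<le> L t * cmod (z - w))"

text \<open>
  These are the properties of a Herglotz vector field that matter for solving the equation, with \<open>L\<^sup>1\<close>
  majorants in place of \<open>L\<^sup>d\<close> ones and the inequality in place of membership in \<open>Gen_disc\<close>. The second
  change is essential: the equation is solved for constant fields in order to prove that the inequality
  implies membership.
\<close>

locale generator_field =
  fixes G :: "complex \<Rightarrow> real \<Rightarrow> complex"
  assumes meas: "\<And>z. z \<in> unit_disc \<Longrightarrow> G z \<in> borel_measurable (lebesgue_on {0..})"
    and hol: "\<And>t. 0 \<le> t \<Longrightarrow> (\<lambda>z. G z t) holomorphic_on unit_disc"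
    and bound: "\<And>r T. 0 < r \<Longrightarrow> r < 1 \<Longrightarrow> 0 < T \<Longrightarrow>
       \<exists>k. k absolutely_integrable_on {0..T} \<and> (\<forall>t\<in>{0..T}. 0 \<le> k t) \<and>
           AE_majorant G k r T"
    and gen: "AE t in lebesgue. 0 \<le> t \<longrightarrow> disc_generator (\<lambda>z. G z t)"
begin

definition trajectory :: "real \<Rightarrow> real \<Rightarrow> complex \<Rightarrow> (real \<Rightarrow> complex) \<Rightarrow> bool" where
  "trajectory s T z w \<longleftrightarrow> w s = z \<and> (\<forall>t\<in>{s..T}. w t \<in> unit_disc) \<and> ac_on w s T \<and>
     (AE t in lebesgue. t \<in> {s..T} \<longrightarrow> (w has_vector_derivative G (w t) t) (at t within {s..T}))"

lemma trajectory_subinterval: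
  assumes w: "trajectory s T z w" and "s \<le> u" "u \<le> v" "v \<le> T"
  shows "trajectory u v (w u) w"
  unfolding trajectory_def
proof (intro conjI)
  show "w u = w u" by simp
  show "\<forall>t\<in>{u..v}. w t \<in> unit_disc" using assms by (auto simp: trajectory_def)
  show "ac_on w u v" using assms ac_on_subinterval unfolding trajectory_def by blast
  have "AE t in lebesgue. t \<in> {s..T} \<longrightarrow> (w has_vector_derivative G (w t) t) (at t within {s..T})"
    using w by (simp add: trajectory_def)
  then show "AE t in lebesgue. t \<in> {u..v} \<longrightarrow> (w has_vector_derivative G (w t) t) (at t within {u..v})"
    by eventually_elim (use assms in \<open>auto intro: has_vector_derivative_within_subset\<close>)
qed

lemma trajectory_cong:
  assumes w: "trajectory s T z w" and eq: "\<And>t. t \<in> {s..T} \<Longrightarrow> w t = v t" and "s \<le> T"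
  shows "trajectory s T z v"
  unfolding trajectory_def
proof (intro conjI)
  show "v s = z" using w eq[of s] \<open>s \<le> T\<close> by (simp add: trajectory_def)
  show "\<forall>t\<in>{s..T}. v t \<in> unit_disc" using w eq by (auto simp: trajectory_def)
  show "ac_on v s T" using w eq ac_on_cong unfolding trajectory_def by blast
  have "AE t in lebesgue. t \<in> {s..T} \<longrightarrow> (w has_vector_derivative G (w t) t) (at t within {s..T})"
    using w by (simp add: trajectory_def)
  then show "AE t in lebesgue. t \<in> {s..T} \<longrightarrow> (v has_vector_derivative G (v t) t) (at t within {s..T})"
    by eventually_elim (use eq in \<open>auto intro: has_vector_derivative_transform[rotated 2]\<close>)
qed

text \<open>
  The factor by which \<open>1 - |w|\<^sup>2\<close> can at most shrink along a trajectory inside \<open>{0..T}\<close>.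
\<close>

definition escape_rate :: "real \<Rightarrow> real" where
  "escape_rate T = exp (- 2 * integral {0..T} (\<lambda>t. cmod (G 0 t)))"

lemma cmod_G0_integrable: "(\<lambda>t. cmod (G 0 t)) absolutely_integrable_on {0..T}"
proof -
  have "0 < \<bar>T\<bar> + 1" by simp
  from bound[of "1/2", OF _ _ this]
  obtain k where k: "k absolutely_integrable_on {0..\<bar>T\<bar> + 1}"
    "AE_majorant G k (1/2) (\<bar>T\<bar> + 1)" by auto
  have "(\<lambda>t. cmod (G 0 t)) absolutely_integrable_on {0..\<bar>T\<bar> + 1}"
  proof (rule measurable_AE_bounded_imp_absolutely_integrable[OF _ _ k(1)])
    have "G 0 \<in> borel_measurable (lebesgue_on {0..\<bar>T\<bar> + 1})"
      by (rule borel_measurable_lebesgue_on_subset[OF meas]) auto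
    then show "(\<lambda>t. cmod (G 0 t)) \<in> borel_measurable (lebesgue_on {0..\<bar>T\<bar> + 1})" by measurable
    show "AE t in lebesgue. t \<in> {0..\<bar>T\<bar> + 1} \<longrightarrow> norm (cmod (G 0 t)) \<le> k t"
      using k(2) by eventually_elim auto
  qed simp
  then show ?thesis by (rule absolutely_integrable_on_subinterval) auto
qed

text \<open>
  For \<open>y = |w|\<^sup>2 - 1\<close> the inequality for generators gives \<open>y' \<le> - 2 |G(0, t)| y\<close>, so Gronwall's
  lemma applies.
\<close>

lemma trajectory_escape:
  assumes w: "trajectory s T z w" and s: "0 \<le> s" and t: "t \<in> {s..T}"
  shows "(1 - (cmod z)\<^sup>2) * escape_rate T \<le> 1 - (cmod (w t))\<^sup>2"
proof -
  define m where "m = (\<lambda>t. cmod (G 0 t))"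
  have st: "s \<le> t" using t by simp
  have wt: "trajectory s t z w" using trajectory_subinterval[OF w, of s t] t w by (simp add: trajectory_def)
  have m: "m absolutely_integrable_on {s..t}"
    unfolding m_def by (rule absolutely_integrable_on_subinterval[OF cmod_G0_integrable[of T]]) (use s t in auto)
  have acw: "ac_on w s t" using wt by (simp add: trajectory_def)
  have acy: "ac_on (\<lambda>x. (cmod (w x))\<^sup>2 - 1) s t"
    by (rule ac_on_lipschitz_compose[OF ac_on_norm_power2[OF acw], of 1]) auto
  have "AE x in lebesgue. x \<in> {s..t} \<longrightarrow> (\<exists>D. ((\<lambda>x. (cmod (w x))\<^sup>2 - 1) has_vector_derivative D) (at x within {s..t}) \<and>
      D \<le> - 2 * m x * ((cmod (w x))\<^sup>2 - 1))"
    using gen wt[unfolded trajectory_def, THEN conjunct2, THEN conjunct2, THEN conjunct2]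
  proof eventually_elim
    case (elim x)
    show ?case
    proof
      assume x: "x \<in> {s..t}"
      have wx: "w x \<in> unit_disc" using wt x by (simp add: trajectory_def)
      have dw: "((\<lambda>x. (cmod (w x))\<^sup>2 - 1) has_vector_derivative 2 * (w x \<bullet> G (w x) x)) (at x within {s..t})"
        using has_vector_derivative_norm_power2[of w "G (w x) x" x "{s..t}"] elim(2) x
        by (auto intro!: derivative_eq_intros)
      have "w x \<bullet> G (w x) x = Re (cnj (w x) * G (w x) x)" by (simp add: inner_complex_def)
      also have "\<dots> \<le> Re (cnj (G 0 x) * w x) * (1 - (cmod (w x))\<^sup>2)"
        using elim(1) x s wx by (auto simp: disc_generator_def)
      also have "\<dots> \<le> m x * (1 - (cmod (w x))\<^sup>2)"
      proof (rule mult_right_mono)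
        have "Re (cnj (G 0 x) * w x) \<le> cmod (G 0 x) * cmod (w x)"
          using complex_Re_le_cmod[of "cnj (G 0 x) * w x"] by (simp add: norm_mult)
        also have "\<dots> \<le> m x * 1" using wx unfolding m_def by (intro mult_left_mono) auto
        finally show "Re (cnj (G 0 x) * w x) \<le> m x" by simp
        show "0 \<le> 1 - (cmod (w x))\<^sup>2" using wx by (simp add: power_le_one)
      qed
      finally have "2 * (w x \<bullet> G (w x) x) \<le> - 2 * m x * ((cmod (w x))\<^sup>2 - 1)" by (simp add: algebra_simps)
      with dw show "\<exists>D. ((\<lambda>x. (cmod (w x))\<^sup>2 - 1) has_vector_derivative D) (at x within {s..t}) \<and>
        D \<le> - 2 * m x * ((cmod (w x))\<^sup>2 - 1)" by blast
    qed
  qed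
  from ac_on_Gronwall[OF acy st m this]
  have 1: "(1 - (cmod z)\<^sup>2) * exp (- 2 * integral {s..t} m) \<le> 1 - (cmod (w t))\<^sup>2"
    using wt by (simp add: trajectory_def algebra_simps)
  have z1: "0 \<le> 1 - (cmod z)\<^sup>2" using w t by (force simp: trajectory_def intro: power_le_one less_imp_le)
  have "integral {s..t} m \<le> integral {0..T} m"
  proof (rule integral_subset_le)
    show "m integrable_on {0..T}" using cmod_G0_integrable[of T] by (simp add: m_def absolutely_integrable_on_def)
    show "m integrable_on {s..t}" using m by (simp add: absolutely_integrable_on_def)
  qed (use s t in \<open>auto simp: m_def\<close>)
  then have "(1 - (cmod z)\<^sup>2) * escape_rate T \<le> (1 - (cmod z)\<^sup>2) * exp (- 2 * integral {s..t} m)"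
    using z1 by (intro mult_left_mono) (auto simp: escape_rate_def m_def)
  with 1 show ?thesis by linarith
qed

text \<open>
  The radius depends neither on the starting time nor on the starting point in the disc of radius \<open>\<rho>\<close>.
  This uniformity gives majorants for the flow that serve for all starting times, and the uniform convergence of
  a semigroup to the identity on compact sets.
\<close>

lemma trajectories_in_cball:
  assumes "\<rho> < 1"
  obtains r where "0 < r" "r < 1" "\<rho> \<le> r"
    "\<And>s T' z w t. 0 \<le> s \<Longrightarrow> T' \<le> T \<Longrightarrow> cmod z \<le> \<rho> \<Longrightarrow> trajectory s T' z w \<Longrightarrow> t \<in> {s..T'} \<Longrightarrow> cmod (w t) \<le> r"
proof -
  define q where "q = max 0 \<rho>"
  have q: "0 \<le> q" "q < 1" "\<rho> \<le> q" using assms by (auto simp: q_def)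
  define c where "c = (1 - q\<^sup>2) * escape_rate T"
  have er: "0 < escape_rate T" "escape_rate T \<le> 1"
    by (auto simp: escape_rate_def intro!: integral_nonneg absolutely_integrable_on_def[THEN iffD1, THEN conjunct1] cmod_G0_integrable)
  have q1: "0 < 1 - q\<^sup>2" using q by (simp add: power_less_one_iff abs_square_less_1)
  have c: "0 < c" "c \<le> 1 - q\<^sup>2" using er q1 by (auto simp: c_def mult_le_cancel_left1)
  \<comment> \<open>Halving c keeps the radius positive also when c = 1.\<close>
  define r where "r = sqrt (1 - c / 2)"
  have c2: "q\<^sup>2 \<le> 1 - c / 2" "0 < 1 - c / 2" using c q by (auto simp: field_simps) (smt (verit) zero_le_power2)+
  have "0 < r" "r < 1" using c c2 by (auto simp: r_def)
  moreover have "q \<le> r" using real_le_rsqrt[OF c2(1)] by (simp add: r_def)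
  moreover have "cmod (w t) \<le> r"
    if h: "0 \<le> s" "T' \<le> T" "cmod z \<le> \<rho>" "trajectory s T' z w" "t \<in> {s..T'}" for s T' z w t
  proof -
    have "escape_rate T \<le> escape_rate T'"
      unfolding escape_rate_def using h
      by (auto intro!: integral_subset_le absolutely_integrable_on_def[THEN iffD1, THEN conjunct1] cmod_G0_integrable)
    moreover have "(cmod z)\<^sup>2 \<le> q\<^sup>2" using h q by (intro power_mono) auto
    ultimately have "c \<le> (1 - (cmod z)\<^sup>2) * escape_rate T'" using er q1 unfolding c_def by (intro mult_mono) auto
    also have "\<dots> \<le> 1 - (cmod (w t))\<^sup>2" using trajectory_escape h by blast
    finally have "(cmod (w t))\<^sup>2 \<le> 1 - c / 2" using c by auto
    then show ?thesis unfolding r_def by (rule real_le_rsqrt)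
  qed
  ultimately show thesis using that[of r] q by auto
qed

lemma Lipschitz_majorant:
  assumes r: "0 < r" "r < 1" and T: "0 < T"
  obtains L where "L absolutely_integrable_on {0..T}" "\<And>t. t \<in> {0..T} \<Longrightarrow> 0 \<le> L t"
    "AE_Lipschitz G L r T"
proof -
  define R where "R = (1 + r) / 2"
  have R: "0 < R" "r < R" "R < 1" using r by (auto simp: R_def)
  obtain k where k: "k absolutely_integrable_on {0..T}" "\<forall>t\<in>{0..T}. 0 \<le> k t"
    "AE_majorant G k R T" using bound[OF R(1,3) T] by blast
  show thesis
  proof (rule that[of "\<lambda>t. k t / (R - r)"])
    show "(\<lambda>t. k t / (R - r)) absolutely_integrable_on {0..T}" using k(1) by (rule set_integrable_divide)
    show "0 \<le> k t / (R - r)" if "t \<in> {0..T}" for t using k(2) that R by auto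
    show "AE t in lebesgue. t \<in> {0..T} \<longrightarrow>
        (\<forall>z\<in>cball 0 r. \<forall>w\<in>cball 0 r. cmod (G z t - G w t) \<le> k t / (R - r) * cmod (z - w))"
      using k(3)
    proof eventually_elim
      case (elim t)
      then show ?case using Cauchy_Lipschitz_bound[OF hol r(1) R(2,3)] by auto
    qed
  qed
qed

text \<open>
  Gronwall's lemma for \<open>|w - v|\<^sup>2\<close>, whose derivative is at most \<open>2 L |w - v|\<^sup>2\<close>.
\<close>

lemma trajectory_distance:
  assumes w: "trajectory s T z1 w" "trajectory s T z2 v" and s: "0 \<le> s"
    and in_r: "\<And>t. t \<in> {s..T} \<Longrightarrow> w t \<in> cball 0 r" "\<And>t. t \<in> {s..T} \<Longrightarrow> v t \<in> cball 0 r"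
    and L: "L absolutely_integrable_on {0..T}"
      "AE_Lipschitz G L r T"
    and t: "t \<in> {s..T}"
  shows "cmod (w t - v t) \<le> cmod (z1 - z2) * exp (integral {s..t} L)"
proof -
  have st: "s \<le> t" using t by simp
  have wt: "trajectory s t z1 w" "trajectory s t z2 v"
    using trajectory_subinterval[OF w(1), of s t] trajectory_subinterval[OF w(2), of s t] t w by (simp_all add: trajectory_def)
  have Li: "L absolutely_integrable_on {s..t}"
    by (rule absolutely_integrable_on_subinterval[OF L(1)]) (use s t in auto)
  define D where "D = (\<lambda>x. w x - v x)"
  have acD: "ac_on D s t" unfolding D_def using wt by (intro ac_on_diff) (auto simp: trajectory_def)
  have "AE x in lebesgue. x \<in> {s..t} \<longrightarrow> (\<exists>d. ((\<lambda>x. (cmod (D x))\<^sup>2) has_vector_derivative d) (at x within {s..t}) \<and>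
      d \<le> 2 * L x * (cmod (D x))\<^sup>2)"
    using L(2) wt[unfolded trajectory_def, THEN conjunct2, THEN conjunct2, THEN conjunct2]
  proof eventually_elim
    case (elim x)
    show ?case
    proof
      assume x: "x \<in> {s..t}"
      define H where "H = G (w x) x - G (v x) x"
      have "(D has_vector_derivative H) (at x within {s..t})"
        unfolding D_def H_def using elim(2,3) x by (auto intro!: derivative_eq_intros)
      then have dD: "((\<lambda>x. (cmod (D x))\<^sup>2) has_vector_derivative 2 * (D x \<bullet> H)) (at x within {s..t})"
        by (rule has_vector_derivative_norm_power2)
      have "cmod H \<le> L x * cmod (D x)"
        unfolding H_def D_def using elim(1) in_r x s t by auto
      then have "D x \<bullet> H \<le> cmod (D x) * (L x * cmod (D x))"
        by (intro order_trans[OF norm_cauchy_schwarz] mult_left_mono) auto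
      then have "2 * (D x \<bullet> H) \<le> 2 * L x * (cmod (D x))\<^sup>2" by (simp add: power2_eq_square mult_ac)
      with dD show "\<exists>d. ((\<lambda>x. (cmod (D x))\<^sup>2) has_vector_derivative d) (at x within {s..t}) \<and>
        d \<le> 2 * L x * (cmod (D x))\<^sup>2" by blast
    qed
  qed
  from ac_on_Gronwall[OF ac_on_norm_power2[OF acD] st Li this]
  have "(cmod (w t - v t))\<^sup>2 \<le> (cmod (z1 - z2))\<^sup>2 * exp (2 * integral {s..t} L)"
    using wt by (simp add: D_def trajectory_def)
  also have "\<dots> = (cmod (z1 - z2) * exp (integral {s..t} L))\<^sup>2"
    by (simp add: power_mult_distrib exp_double)
  finally show ?thesis by (rule power2_le_imp_le) simp
qed

lemma trajectory_unique:
  assumes w: "trajectory s T z w" "trajectory s T z v" and s: "0 \<le> s" and t: "t \<in> {s..T}"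
  shows "w t = v t"
proof -
  have z: "cmod z < 1" using w t by (auto simp: trajectory_def)
  \<comment> \<open>Majorants are available on intervals of positive length only, which T + 1 ensures also for T = 0.\<close>
  have T: "0 < T + 1" "0 \<le> T" using s t by auto
  obtain r where r: "0 < r" "r < 1" "cmod z \<le> r"
    "\<And>s T' z' w t. 0 \<le> s \<Longrightarrow> T' \<le> T \<Longrightarrow> cmod z' \<le> cmod z \<Longrightarrow> trajectory s T' z' w \<Longrightarrow> t \<in> {s..T'} \<Longrightarrow> cmod (w t) \<le> r"
    by (rule trajectories_in_cball[OF z, of T]) (rule that; blast)
  obtain L where L: "L absolutely_integrable_on {0..T+1}"
    "AE_Lipschitz G L r (T+1)"
    using Lipschitz_majorant[OF r(1,2) T(1)] by blast
  have L1: "L absolutely_integrable_on {0..T}" by (rule absolutely_integrable_on_subinterval[OF L(1)]) auto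
  have L2: "AE_Lipschitz G L r T"
    using L(2) by eventually_elim auto
  have "cmod (w t - v t) \<le> cmod (z - z) * exp (integral {s..t} L)"
    by (rule trajectory_distance[OF w s _ _ L1 L2 t]) (use r(4)[OF s order_refl order_refl] w in auto)
  then show ?thesis by simp
qed

end

lemma ac_on_indefinite_integral:
  fixes f :: "real \<Rightarrow> 'a::euclidean_space"
  assumes f: "f absolutely_integrable_on {s..T}" and w: "\<And>t. t \<in> {s..T} \<Longrightarrow> (f has_integral w t - z) {s..t}"
  shows "ac_on w s T"
    "AE t in lebesgue. t \<in> {s..T} \<longrightarrow> (w has_vector_derivative f t) (at t within {s..T})"
proof -
  have eq: "z + integral {s..t} f = w t" if "t \<in> {s..T}" for t
    using integral_unique[OF w[OF that]] by simp
  have "ac_on (\<lambda>t. z + integral {s..t} f) s T"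
    by (rule ac_on_lipschitz_compose[OF ac_on_integral[OF f], of 1]) auto
  then show "ac_on w s T" by (rule ac_on_cong) (rule eq)
  have "f integrable_on {s..T}" using f by (simp add: absolutely_integrable_on_def)
  from AE_integral_has_vector_derivative[OF this]
  show "AE t in lebesgue. t \<in> {s..T} \<longrightarrow> (w has_vector_derivative f t) (at t within {s..T})"
  proof eventually_elim
    case (elim t)
    show ?case
    proof
      assume t: "t \<in> {s..T}"
      have "((\<lambda>t. z + integral {s..t} f) has_vector_derivative f t) (at t within {s..T})"
        using elim t by (auto intro!: derivative_eq_intros)
      then show "(w has_vector_derivative f t) (at t within {s..T})"
        by (rule has_vector_derivative_transform[OF t eq[symmetric], rotated])
    qed
  qed
qed

lemma norm_first_hitting:
  fixes w :: "real \<Rightarrow> 'a::real_normed_vector"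
  assumes c: "continuous_on {s..T} w" and s: "norm (w s) < r" and t: "t \<in> {s..T}" "r \<le> norm (w t)"
  obtains u where "u \<in> {s..T}" "norm (w u) = r" "\<And>x. x \<in> {s..u} \<Longrightarrow> norm (w x) \<le> r"
proof -
  have cn: "continuous_on {s..T} (\<lambda>x. norm (w x))" by (intro continuous_intros c)
  have ivt: "\<exists>y\<in>{s..x}. norm (w y) = r" if "x \<in> {s..T}" "r \<le> norm (w x)" for x
  proof -
    have "continuous_on {s..x} (\<lambda>x. norm (w x))" using that by (intro continuous_on_subset[OF cn]) auto
    then show ?thesis using IVT'[of "\<lambda>x. norm (w x)" s r x] s that by auto
  qed
  define S where "S = {x\<in>{s..T}. norm (w x) = r}"
  have "closed S" unfolding S_def by (rule continuous_closed_preimage_constant[OF cn]) simp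
  then have "compact S" by (rule compact_eq_bounded_closed[THEN iffD2, OF conjI, rotated])
    (auto simp: S_def intro: bounded_subset[of "{s..T}"])
  moreover obtain y where "y \<in> {s..t}" "norm (w y) = r" using ivt[OF t] by blast
  then have "y \<in> S" using t by (auto simp: S_def)
  then have "S \<noteq> {}" by blast
  ultimately obtain u where u: "u \<in> S" "\<And>x. x \<in> S \<Longrightarrow> u \<le> x" using compact_attains_inf by metis
  have "norm (w x) \<le> r" if x: "x \<in> {s..u}" for x
  proof (rule ccontr)
    assume "\<not> norm (w x) \<le> r"
    moreover have "x \<in> {s..T}" using x u(1) by (auto simp: S_def)
    ultimately obtain y where y: "y \<in> {s..x}" "norm (w y) = r" using ivt[of x] by auto
    then have "u \<le> y" using u(2)[of y] \<open>x \<in> {s..T}\<close> by (auto simp: S_def)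
    then have "y = x" using y x by auto
    with y \<open>\<not> norm (w x) \<le> r\<close> show False by simp
  qed
  then show thesis using that u(1) by (auto simp: S_def)
qed

lemma AE_within_atLeast_if_Icc:
  assumes "\<And>n. AE t in lebesgue. t \<in> {s..s + real n} \<longrightarrow> P t (at t within {s..s + real n})"
  shows "AE t in lebesgue. t \<in> {s..} \<longrightarrow> P t (at t within {s..})"
proof -
  have "AE t in lebesgue. \<forall>n. t \<in> {s..s + real n} \<longrightarrow> P t (at t within {s..s + real n})"
    using assms by (subst AE_all_countable) blast
  then show ?thesis
  proof eventually_elim
    case (elim t)
    show ?case
    proof
      assume t: "t \<in> {s..}"
      obtain n where n: "t - s < real n" using reals_Archimedean2 by blast
      have "at t within {s..s + real n} = at t within {s..}"
        by (rule at_within_nhd[of t "{..<s + real n}"]) (use n t in auto)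
      then show "P t (at t within {s..})" using elim[rule_format, of n] t n by auto
    qed
  qed
qed

context generator_field
begin

text \<open>
  All trajectories from \<open>z\<close> stay in the disc of radius \<open>r0\<close>. The equation is truncated outside a
  slightly larger disc of radius \<open>r\<close> by composing \<open>G\<close> with the nearest-point projection, which is
  \<open>1\<close>-Lipschitz. A solution of the truncated equation is a trajectory as long as it stays in the disc
  of radius \<open>r\<close>, so at the first time at which it reached the boundary of that disc it would
  contradict the bound \<open>r0\<close>.
\<close>

lemma trajectory_exists:
  assumes s: "0 \<le> s" "s \<le> T" and z: "z \<in> unit_disc"
  shows "\<exists>w. trajectory s T z w"
proof -
  have z1: "cmod z < 1" using z by simp
  obtain r0 where r0: "0 < r0" "r0 < 1" "cmod z \<le> r0"
    "\<And>s T' z' w t. 0 \<le> s \<Longrightarrow> T' \<le> T \<Longrightarrow> cmod z' \<le> cmod z \<Longrightarrow> trajectory s T' z' w \<Longrightarrow> t \<in> {s..T'} \<Longrightarrow> cmod (w t) \<le> r0"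
    by (rule trajectories_in_cball[OF z1, of T]) (rule that; blast)
  define r where "r = (1 + r0) / 2"
  have r: "0 < r" "r0 < r" "r < 1" using r0 by (auto simp: r_def)
  have U: "0 < T + 1" using s by simp
  obtain k where k: "k absolutely_integrable_on {0..T+1}" "\<forall>t\<in>{0..T+1}. 0 \<le> k t"
    "AE_majorant G k r (T+1)" using bound[OF r(1,3) U] by blast
  obtain L where L: "L absolutely_integrable_on {0..T+1}" "\<And>t. t \<in> {0..T+1} \<Longrightarrow> 0 \<le> L t"
    "AE_Lipschitz G L r (T+1)"
    using Lipschitz_majorant[OF r(1,3) U] by blast
  define P where "P = (\<lambda>t. t \<in> {0..T+1} \<longrightarrow> (\<forall>z\<in>cball 0 r. cmod (G z t) \<le> k t) \<and>
    (\<forall>z\<in>cball 0 r. \<forall>w\<in>cball 0 r. cmod (G z t - G w t) \<le> L t * cmod (z - w)))"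
  \<comment> \<open>On the null set of bad times the field is replaced by 0, so that the bounds hold at every time.\<close>
  define B where "B = {t. \<not> P t}"
  have AEP: "AE t in lebesgue. P t" unfolding P_def using k(3) L(3) by eventually_elim blast
  then have B: "negligible B" unfolding B_def AE_lebesgue_iff_negligible .
  define p where "p = closest_point (cball (0::complex) r)"
  have pc: "p y \<in> cball 0 r" for y unfolding p_def using r by (intro closest_point_in_set) auto
  have pl: "cmod (p y - p x) \<le> cmod (y - x)" for x y
    using closest_point_lipschitz[of "cball (0::complex) r" y x] r by (simp add: p_def dist_norm)
  have pid: "p y = y" if "y \<in> cball 0 r" for y unfolding p_def using that by (rule closest_point_self)
  define H where "H = (\<lambda>y t. if t \<in> B then 0 else G (p y) t)"
  obtain w where w: "continuous_on {s..T} w" "(\<lambda>\<tau>. H (w \<tau>) \<tau>) absolutely_integrable_on {s..T}"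
    "\<And>t. t \<in> {s..T} \<Longrightarrow> ((\<lambda>\<tau>. H (w \<tau>) \<tau>) has_integral w t - z) {s..t}"
  proof (rule Picard_Caratheodory[of s T H L k z])
    fix y
    have "p y \<in> unit_disc" using pc[of y] r by auto
    then have "G (p y) \<in> borel_measurable (lebesgue_on {s..T})"
      by (rule borel_measurable_lebesgue_on_subset[OF meas]) (use s in auto)
    moreover have "{x \<in> space (lebesgue_on {s..T}). x \<in> B} \<in> sets (lebesgue_on {s..T})"
      using negligible_imp_sets[OF B] by (auto simp: sets_restrict_space space_restrict_space)
    ultimately show "H y \<in> borel_measurable (lebesgue_on {s..T})"
      unfolding H_def by (intro measurable_If) auto
  next
    show "L absolutely_integrable_on {s..T}" by (rule absolutely_integrable_on_subinterval[OF L(1)]) (use s in auto)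
    have "k integrable_on {0..T+1}" using k(1) by (simp add: absolutely_integrable_on_def)
    then show "k integrable_on {s..T}" by (rule integrable_subinterval_real) (use s in auto)
    show "cmod (H y t - H x t) \<le> L t * cmod (y - x)" if t: "t \<in> {s..T}" for t x y
    proof (cases "t \<in> B")
      case False
      have t0: "t \<in> {0..T+1}" using t s by auto
      have "cmod (H y t - H x t) \<le> L t * cmod (p y - p x)"
        using False t0 pc unfolding H_def B_def P_def by auto
      also have "\<dots> \<le> L t * cmod (y - x)" using L(2)[OF t0] pl by (intro mult_left_mono)
      finally show ?thesis .
    qed (use L(2)[of t] t s in \<open>auto simp: H_def\<close>)
    show "cmod (H y t) \<le> k t" if t: "t \<in> {s..T}" for t y
      using k(2) pc[of y] t s unfolding H_def B_def P_def by auto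
  qed (use s L(2) in auto)
  have acw: "ac_on w s T"
    "AE t in lebesgue. t \<in> {s..T} \<longrightarrow> (w has_vector_derivative H (w t) t) (at t within {s..T})"
    using ac_on_indefinite_integral[OF w(2), of w z] w(3) by blast+
  have ws: "w s = z" using integral_unique[OF w(3)[of s]] s by simp
  have traj: "trajectory s u z w" if u: "u \<in> {s..T}" and in_r: "\<And>x. x \<in> {s..u} \<Longrightarrow> cmod (w x) \<le> r" for u
    unfolding trajectory_def
  proof (intro conjI ws)
    show "\<forall>t\<in>{s..u}. w t \<in> unit_disc" using in_r r by force
    show "ac_on w s u" by (rule ac_on_subinterval[OF acw(1)]) (use u in auto)
    show "AE t in lebesgue. t \<in> {s..u} \<longrightarrow> (w has_vector_derivative G (w t) t) (at t within {s..u})"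
      using acw(2) AEP
    proof eventually_elim
      case (elim t)
      show ?case
      proof
        assume t: "t \<in> {s..u}"
        have "H (w t) t = G (w t) t" using elim(2) in_r[OF t] pid[of "w t"] by (simp add: H_def B_def)
        moreover have "(w has_vector_derivative H (w t) t) (at t within {s..u})"
          by (rule has_vector_derivative_within_subset) (use elim(1) t u in auto)
        ultimately show "(w has_vector_derivative G (w t) t) (at t within {s..u})" by simp
      qed
    qed
  qed
  have "cmod (w t) \<le> r" if t: "t \<in> {s..T}" for t
  proof (rule ccontr)
    assume "\<not> cmod (w t) \<le> r"
    then obtain u where u: "u \<in> {s..T}" "cmod (w u) = r" "\<And>x. x \<in> {s..u} \<Longrightarrow> cmod (w x) \<le> r"
      using norm_first_hitting[OF w(1) _ t, of r] ws r0(3) r(2) by auto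
    have "cmod (w u) \<le> r0"
      by (rule r0(4)[OF s(1) _ order_refl traj[OF u(1,3)]]) (use u in auto)
    with u(2) r(2) show False by simp
  qed
  then have "trajectory s T z w" using s by (intro traj) auto
  then show ?thesis by blast
qed

end

section \<open>The flow of a field of generators\<close>

context generator_field
begin

definition flow :: "real \<Rightarrow> real \<Rightarrow> complex \<Rightarrow> complex" where
  "flow s t z = (SOME w. trajectory s t z w) t"

text \<open>
  By uniqueness it does not matter that \<open>flow\<close> chooses a trajectory for each final time separately.
\<close>

lemma flow_eq_trajectory:
  assumes "0 \<le> s" "trajectory s T z w" "t \<in> {s..T}"
  shows "flow s t z = w t"
proof -
  have w: "trajectory s t z w"
    using trajectory_subinterval[OF assms(2), of s t] assms by (simp add: trajectory_def)
  then have "trajectory s t z (SOME w. trajectory s t z w)" using someI[of "trajectory s t z" w] by simp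
  from trajectory_unique[OF this w assms(1), of t] show ?thesis using assms by (simp add: flow_def)
qed

lemma trajectory_flow:
  assumes "0 \<le> s" "s \<le> T" "z \<in> unit_disc"
  shows "trajectory s T z (\<lambda>t. flow s t z)"
proof -
  obtain w where "trajectory s T z w" using trajectory_exists[OF assms] by blast
  then show ?thesis by (rule trajectory_cong) (use flow_eq_trajectory assms \<open>trajectory s T z w\<close> in auto)
qed

lemma flow_in_disc: "0 \<le> s \<Longrightarrow> s \<le> t \<Longrightarrow> z \<in> unit_disc \<Longrightarrow> flow s t z \<in> unit_disc"
  using trajectory_flow[of s t z] unfolding trajectory_def by simp

lemma flow_self: "0 \<le> s \<Longrightarrow> z \<in> unit_disc \<Longrightarrow> flow s s z = z"
  using trajectory_flow[of s s z] unfolding trajectory_def by simp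

lemma flow_compose:
  assumes "0 \<le> s" "s \<le> u" "u \<le> t" "z \<in> unit_disc"
  shows "flow s t z = flow u t (flow s u z)"
proof -
  have "trajectory u t (flow s u z) (\<lambda>t. flow s t z)"
    by (rule trajectory_subinterval[OF trajectory_flow[of s t z]]) (use assms in auto)
  then have "flow u t (flow s u z) = flow s t z"
    by (rule flow_eq_trajectory[rotated]) (use assms in auto)
  then show ?thesis by simp
qed

text \<open>
  The radius is found before the majorant \<open>k\<close>, so that \<open>k\<close> may later be chosen in \<open>L\<^sup>d\<close>.
\<close>

lemma flow_increment_le:
  assumes \<rho>: "\<rho> < 1"
  obtains r where "0 < r" "r < 1" "\<And>k s u t z. k absolutely_integrable_on {0..T} \<Longrightarrow>
      AE_majorant G k r T \<Longrightarrow> cmod z \<le> \<rho> \<Longrightarrow>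
      0 \<le> s \<Longrightarrow> s \<le> u \<Longrightarrow> u \<le> t \<Longrightarrow> t \<le> T \<Longrightarrow> cmod (flow s t z - flow s u z) \<le> integral {u..t} k"
proof -
  obtain r where r: "0 < r" "r < 1" "\<rho> \<le> r"
    "\<And>s T' z' w t. 0 \<le> s \<Longrightarrow> T' \<le> T \<Longrightarrow> cmod z' \<le> \<rho> \<Longrightarrow> trajectory s T' z' w \<Longrightarrow> t \<in> {s..T'} \<Longrightarrow> cmod (w t) \<le> r"
    by (rule trajectories_in_cball[OF \<rho>, of T]) (rule that; blast)
  show thesis
  proof (rule that[OF r(1,2)])
    fix k s u t and z :: complex
    assume k: "k absolutely_integrable_on {0..T}" "AE_majorant G k r T"
      and z: "cmod z \<le> \<rho>" and h: "0 \<le> s" "s \<le> u" "u \<le> t" "t \<le> T"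
    have zd: "z \<in> unit_disc" using z \<rho> by simp
    have tr: "trajectory u t (flow s u z) (\<lambda>t. flow s t z)"
      by (rule trajectory_subinterval[OF trajectory_flow[of s t z]]) (use h zd in auto)
    have in_r: "cmod (flow s x z) \<le> r" if "x \<in> {u..t}" for x
      by (rule r(4)[OF h(1,4) z trajectory_flow]) (use h zd that in auto)
    show "cmod (flow s t z - flow s u z) \<le> integral {u..t} k"
    proof (rule ac_on_norm_increment_le)
      have "k integrable_on {0..T}" using k(1) by (simp add: absolutely_integrable_on_def)
      then show "k integrable_on {u..t}" by (rule integrable_subinterval_real) (use h in auto)
      show "AE x in lebesgue. x \<in> {u..t} \<longrightarrow> cmod (G (flow s x z) x) \<le> k x"
        using k(2) by eventually_elim (use h in_r in auto)
    qed (use h tr in \<open>auto simp: trajectory_def\<close>)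
  qed
qed

lemma flow_has_vector_derivative_AE:
  assumes s: "0 \<le> s" and z: "z \<in> unit_disc"
  shows "AE t in lebesgue. t \<in> {s..} \<longrightarrow> ((\<lambda>t. flow s t z) has_vector_derivative G (flow s t z) t) (at t within {s..})"
proof (rule AE_within_atLeast_if_Icc)
  show "AE t in lebesgue. t \<in> {s..s + real n} \<longrightarrow>
     ((\<lambda>t. flow s t z) has_vector_derivative G (flow s t z) t) (at t within {s..s + real n})" for n
    using trajectory_flow[OF s _ z, of "s + real n"] by (simp add: trajectory_def)
qed

text \<open>
  The difference \<open>D = w - v\<close> satisfies \<open>D' = A D\<close> with the divided difference \<open>A\<close> of \<open>G\<close>; where
  \<open>D = 0\<close>, the value \<open>A = 0\<close> given by division by zero is correct because \<open>D' = 0\<close> there. In particular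
  different trajectories never meet.
\<close>

lemma trajectory_difference_eq:
  assumes w: "trajectory s T z1 w" "trajectory s T z2 v" and s: "0 \<le> s"
    and in_r: "\<And>t. t \<in> {s..T} \<Longrightarrow> w t \<in> cball 0 r" "\<And>t. t \<in> {s..T} \<Longrightarrow> v t \<in> cball 0 r"
    and L: "L absolutely_integrable_on {0..T}"
      "AE_Lipschitz G L r T"
      "\<And>t. t \<in> {0..T} \<Longrightarrow> 0 \<le> L t"
  defines "A \<equiv> \<lambda>t. (G (w t) t - G (v t) t) / (w t - v t)"
  shows "A absolutely_integrable_on {s..T}" "AE t in lebesgue. t \<in> {s..T} \<longrightarrow> cmod (A t) \<le> L t"
    "\<And>t. t \<in> {s..T} \<Longrightarrow> w t - v t = (z1 - z2) * exp (integral {s..t} A)"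
proof -
  define D where "D = (\<lambda>x. w x - v x)"
  define H where "H = (\<lambda>t. G (w t) t - G (v t) t)"
  have acD: "ac_on D s T" unfolding D_def using w by (intro ac_on_diff) (auto simp: trajectory_def)
  have dD: "AE t in lebesgue. t \<in> {s..T} \<longrightarrow> (D has_vector_derivative H t) (at t within {s..T})"
    using w[unfolded trajectory_def, THEN conjunct2, THEN conjunct2, THEN conjunct2]
    by eventually_elim (auto simp: D_def H_def intro!: derivative_eq_intros)
  show bd: "AE t in lebesgue. t \<in> {s..T} \<longrightarrow> cmod (A t) \<le> L t"
    using L(2)
  proof eventually_elim
    case (elim t)
    show ?case
    proof
      assume t: "t \<in> {s..T}"
      then have "cmod (G (w t) t - G (v t) t) \<le> L t * cmod (w t - v t)" using elim in_r s by auto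
      then show "cmod (A t) \<le> L t"
        using L(3)[of t] t s by (cases "w t = v t") (auto simp: A_def norm_divide divide_simps)
    qed
  qed
  show A: "A absolutely_integrable_on {s..T}"
  proof (cases "s \<le> T")
    case True
    show ?thesis
    proof (rule measurable_AE_bounded_imp_absolutely_integrable[OF _ _ _ bd])
      have "H absolutely_integrable_on {s..T}" by (rule ac_on_FTC(1)[OF acD True dD])
      then have "H \<in> borel_measurable (lebesgue_on {s..T})" by (simp add: absolutely_integrable_measurable)
      moreover have "D \<in> borel_measurable (lebesgue_on {s..T})"
        using ac_on_imp_continuous_on[OF acD] by (intro continuous_imp_measurable_on_sets_lebesgue) auto
      ultimately show "A \<in> borel_measurable (lebesgue_on {s..T})"
        unfolding A_def D_def H_def by measurable
      show "L absolutely_integrable_on {s..T}" by (rule absolutely_integrable_on_subinterval[OF L(1)]) (use s in auto)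
    qed simp
  qed (simp add: absolutely_integrable_on_def)
  fix t assume t: "t \<in> {s..T}"
  have st: "s \<le> t" using t by simp
  have At: "A absolutely_integrable_on {s..t}" by (rule absolutely_integrable_on_subinterval[OF A]) (use t in auto)
  define e where "e = (\<lambda>x. exp ((- 1) * integral {s..x} A))"
  have ace: "ac_on e s t" unfolding e_def by (intro ac_on_exp ac_on_mult_left ac_on_integral At)
  have acg: "ac_on (\<lambda>x. D x * e x) s t"
    by (intro ac_on_mult ace ac_on_subinterval[OF acD]) (use t in auto)
  have "A integrable_on {s..t}" using At by (simp add: absolutely_integrable_on_def)
  from AE_integral_has_vector_derivative[OF this]
  have "AE x in lebesgue. x \<in> {s..t} \<longrightarrow> ((\<lambda>x. D x * e x) has_vector_derivative 0) (at x within {s..t})"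
    using dD
  proof eventually_elim
    case (elim x)
    show ?case
    proof
      assume x: "x \<in> {s..t}"
      have "(e has_vector_derivative - A x * e x) (at x within {s..t})"
      proof -
        have "((\<lambda>x. (- 1) * integral {s..x} A) has_vector_derivative - A x) (at x within {s..t})"
          using elim(1) x by (auto intro!: derivative_eq_intros)
        from field_vector_diff_chain_within[OF this, of exp "exp ((- 1) * integral {s..x} A)"]
        show ?thesis unfolding e_def o_def by (auto intro: DERIV_subset[OF DERIV_exp])
      qed
      moreover have "(D has_vector_derivative H x) (at x within {s..t})"
        by (rule has_vector_derivative_within_subset) (use elim(2) x t in auto)
      ultimately have d: "((\<lambda>x. D x * e x) has_vector_derivative (D x * (- A x * e x) + H x * e x)) (at x within {s..t})"
        by (intro has_vector_derivative_mult)
      have "D x * A x = H x" by (auto simp: D_def A_def H_def)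
      moreover have "D x * (- A x * e x) + H x * e x = (H x - D x * A x) * e x" by (simp add: algebra_simps)
      ultimately have "D x * (- A x * e x) + H x * e x = 0" by simp
      with d show "((\<lambda>x. D x * e x) has_vector_derivative 0) (at x within {s..t})" by (simp only:)
    qed
  qed
  from ac_on_constant[OF acg st this] have "D t * e t = z1 - z2"
    using w by (simp add: D_def e_def trajectory_def)
  then have "D t * e t * exp (integral {s..t} A) = (z1 - z2) * exp (integral {s..t} A)" by simp
  moreover have "e t * exp (integral {s..t} A) = 1" by (simp add: e_def flip: exp_add)
  ultimately show "w t - v t = (z1 - z2) * exp (integral {s..t} A)" by (simp add: D_def mult.assoc)
qed

end

context generator_field
begin

text \<open>
  The difference quotient in the initial value is \<open>exp (\<integral> A)\<close> with the divided difference \<open>A\<close> of the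
  field along two trajectories. As the second trajectory tends to the first, without ever meeting it, \<open>A\<close>
  tends to the complex derivative of the field, dominated by the Lipschitz constant.
\<close>

lemma flow_holomorphic:
  assumes s: "0 \<le> s" and st: "s \<le> t"
  shows "flow s t holomorphic_on unit_disc"
proof -
  have "\<exists>D. (flow s t has_field_derivative D) (at z0)" if z0: "z0 \<in> unit_disc" for z0
  proof -
    define \<rho> where "\<rho> = (1 + cmod z0) / 2"
    have \<rho>: "\<rho> < 1" "cmod z0 < \<rho>" using z0 by (auto simp: \<rho>_def)
    obtain r where r: "0 < r" "r < 1" "\<rho> \<le> r"
      "\<And>s T' z' w t'. 0 \<le> s \<Longrightarrow> T' \<le> t \<Longrightarrow> cmod z' \<le> \<rho> \<Longrightarrow> trajectory s T' z' w \<Longrightarrow> t' \<in> {s..T'} \<Longrightarrow> cmod (w t') \<le> r"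
      by (rule trajectories_in_cball[OF \<rho>(1), of t]) (rule that; blast)
    have t1: "0 < t + 1" using s st by simp
    obtain L where L': "L absolutely_integrable_on {0..t+1}" "\<And>\<tau>. \<tau> \<in> {0..t+1} \<Longrightarrow> 0 \<le> L \<tau>"
      "AE_Lipschitz G L r (t+1)"
      using Lipschitz_majorant[OF r(1,2) t1] by blast
    have L: "L absolutely_integrable_on {0..t}" "\<And>\<tau>. \<tau> \<in> {0..t} \<Longrightarrow> 0 \<le> L \<tau>"
      "AE_Lipschitz G L r t"
    proof -
      show "L absolutely_integrable_on {0..t}" by (rule absolutely_integrable_on_subinterval[OF L'(1)]) auto
      show "AE_Lipschitz G L r t"
        using L'(3) by eventually_elim auto
    qed (use L'(2) in auto)
    have disc: "z \<in> unit_disc" if "cmod z \<le> \<rho>" for z using that \<rho> by simp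
    have tr: "trajectory s t z (\<lambda>\<tau>. flow s \<tau> z)" if "cmod z \<le> \<rho>" for z
      using trajectory_flow[OF s st disc[OF that]] .
    have in_r: "flow s \<tau> z \<in> cball 0 r" if "cmod z \<le> \<rho>" "\<tau> \<in> {s..t}" for z \<tau>
      using r(4)[OF s order_refl that(1) tr[OF that(1)] that(2)] by simp
    have z0\<rho>: "cmod z0 \<le> \<rho>" using \<rho> by simp
    define A where "A = (\<lambda>z \<tau>. (G (flow s \<tau> z) \<tau> - G (flow s \<tau> z0) \<tau>) / (flow s \<tau> z - flow s \<tau> z0))"
    have diff: "A z absolutely_integrable_on {s..t}" "AE \<tau> in lebesgue. \<tau> \<in> {s..t} \<longrightarrow> cmod (A z \<tau>) \<le> L \<tau>"
      "\<And>\<tau>. \<tau> \<in> {s..t} \<Longrightarrow> flow s \<tau> z - flow s \<tau> z0 = (z - z0) * exp (integral {s..\<tau>} (A z))" if z: "cmod z \<le> \<rho>" for z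
      unfolding A_def
      by (rule trajectory_difference_eq[OF tr[OF z] tr[OF z0\<rho>] s in_r[OF z] in_r[OF z0\<rho>] L(1,3,2)]; assumption)+
    define a where "a = (\<lambda>\<tau>. deriv (\<lambda>z. G z \<tau>) (flow s \<tau> z0))"
    have lim: "((\<lambda>z. (flow s t z - flow s t z0) / (z - z0)) \<longlongrightarrow> exp (integral {s..t} a)) (at z0 within cball 0 \<rho>)"
      unfolding tendsto_at_iff_sequentially o_def
    proof (intro allI impI)
      fix X :: "nat \<Rightarrow> complex"
      assume X: "\<forall>i. X i \<in> cball 0 \<rho> - {z0}" "X \<longlonglongrightarrow> z0"
      then have X\<rho>: "cmod (X i) \<le> \<rho>" "X i \<noteq> z0" for i by auto
      note dX = diff[OF X\<rho>(1)]
      have conv: "(\<lambda>i. A (X i) \<tau>) \<longlonglongrightarrow> a \<tau>" if \<tau>: "\<tau> \<in> {s..t}" for \<tau>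
      proof -
        have \<tau>0: "0 \<le> \<tau>" using \<tau> s by simp
        have fd: "flow s \<tau> z0 \<in> unit_disc" using flow_in_disc[OF s _ z0] \<tau> by simp
        have "((\<lambda>z. G z \<tau>) has_field_derivative a \<tau>) (at (flow s \<tau> z0))"
          unfolding a_def by (rule holomorphic_derivI[OF hol[OF \<tau>0] open_ball fd])
        then have "((\<lambda>y. (G y \<tau> - G (flow s \<tau> z0) \<tau>) / (y - flow s \<tau> z0)) \<longlongrightarrow> a \<tau>) (at (flow s \<tau> z0))"
          by (simp add: has_field_derivative_iff)
        moreover have "filterlim (\<lambda>i. flow s \<tau> (X i)) (at (flow s \<tau> z0)) sequentially"
          unfolding filterlim_at
        proof
          have "cmod (flow s \<tau> (X i) - flow s \<tau> z0) \<le> cmod (X i - z0) * exp (integral {s..\<tau>} L)" for i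
            by (rule trajectory_distance[OF tr[OF X\<rho>(1)] tr[OF z0\<rho>] s in_r[OF X\<rho>(1)] in_r[OF z0\<rho>] L(1,3) \<tau>])
          moreover have "(\<lambda>i. cmod (X i - z0) * exp (integral {s..\<tau>} L)) \<longlonglongrightarrow> 0"
            using X(2) by (intro tendsto_mult_left_zero tendsto_norm_zero LIM_zero)
          ultimately have "(\<lambda>i. flow s \<tau> (X i) - flow s \<tau> z0) \<longlonglongrightarrow> 0"
            by (rule Lim_null_comparison[OF always_eventually, OF allI])
          then show "(\<lambda>i. flow s \<tau> (X i)) \<longlonglongrightarrow> flow s \<tau> z0" by (rule LIM_zero_cancel)
          have "flow s \<tau> (X i) - flow s \<tau> z0 \<noteq> 0" for i
            unfolding dX(3)[OF \<tau>] using X\<rho>(2) by simp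
          then show "eventually (\<lambda>i. flow s \<tau> (X i) \<in> UNIV \<and> flow s \<tau> (X i) \<noteq> flow s \<tau> z0) sequentially" by simp
        qed
        ultimately show ?thesis unfolding A_def by (rule filterlim_compose)
      qed
      have "AE \<tau> in lebesgue. \<forall>i. \<tau> \<in> {s..t} \<longrightarrow> cmod (A (X i) \<tau>) \<le> L \<tau>"
        using dX(2) by (subst AE_all_countable) blast
      then have N: "negligible {\<tau>. \<not> (\<forall>i. \<tau> \<in> {s..t} \<longrightarrow> cmod (A (X i) \<tau>) \<le> L \<tau>)}" (is "negligible ?N")
        by (simp only: AE_lebesgue_iff_negligible)
      \<comment> \<open>Domination holds almost everywhere only, so A and its limit a are set to 0 on the null set ?N.\<close>
      define A' where "A' = (\<lambda>i \<tau>. if \<tau> \<in> ?N then 0 else A (X i) \<tau>)"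
      define a' where "a' = (\<lambda>\<tau>. if \<tau> \<in> ?N then 0 else a \<tau>)"
      have Ai: "A (X i) integrable_on {s..t}" for i using dX(1)[of i] by (simp add: absolutely_integrable_on_def)
      have A'i: "A' i integrable_on {s..t}" for i
        by (rule integrable_spike[OF Ai[of i] N]) (auto simp: A'_def)
      have Li: "L integrable_on {s..t}"
        by (rule integrable_subinterval_real[of L 0 t]) (use L(1) s in \<open>auto simp: absolutely_integrable_on_def\<close>)
      have "(\<lambda>i. integral {s..t} (A' i)) \<longlonglongrightarrow> integral {s..t} a'"
      proof (rule dominated_convergence(2)[OF A'i Li])
        show "cmod (A' i \<tau>) \<le> L \<tau>" if "\<tau> \<in> {s..t}" for i \<tau>
          using that L(2)[of \<tau>] s by (auto simp: A'_def)
        show "(\<lambda>i. A' i \<tau>) \<longlonglongrightarrow> a' \<tau>" if "\<tau> \<in> {s..t}" for \<tau>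
          using conv[OF that] by (auto simp: A'_def a'_def)
      qed
      moreover have "integral {s..t} (A' i) = integral {s..t} (A (X i))" for i
        by (rule integral_spike[OF N]) (auto simp: A'_def)
      moreover have "integral {s..t} a' = integral {s..t} a"
        by (rule integral_spike[OF N]) (auto simp: a'_def)
      ultimately have "(\<lambda>i. exp (integral {s..t} (A (X i)))) \<longlonglongrightarrow> exp (integral {s..t} a)"
        by (intro tendsto_exp) simp
      moreover have "exp (integral {s..t} (A (X i))) = (flow s t (X i) - flow s t z0) / (X i - z0)" for i
        using dX(3)[of t i] st X\<rho>(2)[of i] by (simp add: divide_simps)
      ultimately show "(\<lambda>i. (flow s t (X i) - flow s t z0) / (X i - z0)) \<longlonglongrightarrow> exp (integral {s..t} a)" by simp
    qed
    moreover have "at z0 within cball 0 \<rho> = at z0"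
      using \<rho> by (intro at_within_interior) simp
    ultimately have "(flow s t has_field_derivative exp (integral {s..t} a)) (at z0)"
      by (simp add: has_field_derivative_iff)
    then show ?thesis by blast
  qed
  then show ?thesis by (auto simp: holomorphic_on_open)
qed

lemma flow_self_map: "0 \<le> s \<Longrightarrow> s \<le> t \<Longrightarrow> holomorphic_self_map (flow s t)"
  unfolding holomorphic_self_map_def using flow_holomorphic flow_in_disc by blast

lemma evolution_family_flow:
  assumes d: "1 \<le> d"
    and bd: "\<And>r T. 0 < r \<Longrightarrow> r < 1 \<Longrightarrow> 0 < T \<Longrightarrow> \<exists>k. Lp_interval d T k \<and> (\<forall>t\<in>{0..T}. 0 \<le> k t) \<and>
           AE_majorant G k r T"
  shows "evolution_family d flow"
  unfolding evolution_family_def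
proof (intro conjI allI impI ballI)
  fix z T assume z: "z \<in> unit_disc" and T: "(0::real) < T"
  then have "cmod z < 1" by simp
  then obtain r where r: "0 < r" "r < 1" "\<And>k s u t z'. k absolutely_integrable_on {0..T} \<Longrightarrow>
      AE_majorant G k r T \<Longrightarrow> cmod z' \<le> cmod z \<Longrightarrow>
      0 \<le> s \<Longrightarrow> s \<le> u \<Longrightarrow> u \<le> t \<Longrightarrow> t \<le> T \<Longrightarrow> cmod (flow s t z' - flow s u z') \<le> integral {u..t} k"
    by (rule flow_increment_le[of "cmod z" T]) (rule that; blast)
  obtain k where k: "Lp_interval d T k" "\<forall>t\<in>{0..T}. 0 \<le> k t"
    "AE_majorant G k r T" using bd[OF r(1,2) T] by blast
  have ki: "k absolutely_integrable_on {0..T}" using Lp_interval_absolutely_integrable[OF k(1) d] .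
  show "\<exists>k. Lp_interval d T k \<and> (\<forall>\<xi>\<in>{0..T}. 0 \<le> k \<xi>) \<and>
        (\<forall>s u t. 0 \<le> s \<and> s \<le> u \<and> u \<le> t \<and> t \<le> T \<longrightarrow>
           cmod (flow s u z - flow s t z) \<le> (LINT \<xi>:{u..t}|lebesgue. k \<xi>))"
  proof (intro exI[of _ k] conjI k(1,2) allI impI)
    fix s u t :: real assume h: "0 \<le> s \<and> s \<le> u \<and> u \<le> t \<and> t \<le> T"
    have "k absolutely_integrable_on {u..t}"
      by (rule absolutely_integrable_on_subinterval[OF ki]) (use h in auto)
    then have "(LINT \<xi>:{u..t}|lebesgue. k \<xi>) = integral {u..t} k" by (rule set_lebesgue_integral_eq_integral(2))
    then show "cmod (flow s u z - flow s t z) \<le> (LINT \<xi>:{u..t}|lebesgue. k \<xi>)"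
      using r(3)[OF ki k(3) order_refl, of s u t] h by (simp add: norm_minus_commute)
  qed
qed (use flow_self_map flow_self flow_compose in auto)

lemma solves_evolution_equation_flow: "solves_evolution_equation flow G"
  unfolding solves_evolution_equation_def
proof (intro ballI allI impI)
  fix z s assume "z \<in> unit_disc" "(0::real) \<le> s"
  then show "AE t in lebesgue_on {s..}. ((\<lambda>t. flow s t z) has_vector_derivative G (flow s t z) t) (at t within {s..})"
    using flow_has_vector_derivative_AE by (simp add: AE_lebesgue_on_iff)
qed

end

section \<open>Herglotz vector fields generate evolution families\<close>

lemma set_lebesgue_integral_Lp_interval:
  assumes k: "Lp_interval d T k" and d: "1 \<le> d" and h: "0 \<le> u" "t \<le> T"
  shows "k integrable_on {u..t}" "(LINT \<xi>:{u..t}|lebesgue. k \<xi>) = integral {u..t} k"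
proof -
  have "k absolutely_integrable_on {u..t}"
    by (rule absolutely_integrable_on_subinterval[OF Lp_interval_absolutely_integrable[OF k d]]) (use h in auto)
  then show "k integrable_on {u..t}" "(LINT \<xi>:{u..t}|lebesgue. k \<xi>) = integral {u..t} k"
    using set_lebesgue_integral_eq_integral by auto
qed

lemma evolution_family_ac_on:
  assumes \<phi>: "evolution_family d \<phi>" and d: "1 \<le> d" and s: "0 \<le> s" and z: "z \<in> unit_disc"
  shows "ac_on (\<lambda>t. \<phi> s t z) s T"
proof -
  have T: "0 < \<bar>T\<bar> + 1" by simp
  then obtain k where k: "Lp_interval d (\<bar>T\<bar> + 1) k" "\<forall>\<xi>\<in>{0..\<bar>T\<bar> + 1}. 0 \<le> k \<xi>"
    "\<And>s u t. 0 \<le> s \<and> s \<le> u \<and> u \<le> t \<and> t \<le> \<bar>T\<bar> + 1 \<Longrightarrow>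
           cmod (\<phi> s u z - \<phi> s t z) \<le> (LINT \<xi>:{u..t}|lebesgue. k \<xi>)"
    using \<phi> z unfolding evolution_family_def by meson
  show ?thesis
  proof (rule ac_onI[of k])
    show "k integrable_on {s..T}" by (rule set_lebesgue_integral_Lp_interval[OF k(1) d]) (use s in auto)
    show "0 \<le> k x" if "x \<in> {s..T}" for x using k(2) that s by auto
    show "cmod (\<phi> s t z - \<phi> s u z) \<le> integral {u..t} k" if "s \<le> u" "u \<le> t" "t \<le> T" for u t
      using k(3)[of s u t] set_lebesgue_integral_Lp_interval(2)[OF k(1) d, of u t] that s
      by (auto simp: norm_minus_commute)
  qed
qed

text \<open>
  The majorants in the definition of an evolution family make its orbits absolutely continuous, so the
  orbits are trajectories.
\<close>

lemma (in generator_field) evolution_family_eq_flow: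
  assumes \<psi>: "evolution_family d \<psi>" and d: "1 \<le> d" and sol: "solves_evolution_equation \<psi> G"
    and s: "0 \<le> s" "s \<le> t" and z: "z \<in> unit_disc"
  shows "\<psi> s t z = flow s t z"
proof -
  have "trajectory s t z (\<lambda>t. \<psi> s t z)"
    unfolding trajectory_def
  proof (intro conjI ballI)
    show "\<psi> s s z = z" using \<psi> s z by (simp add: evolution_family_def)
    show "\<psi> s \<tau> z \<in> unit_disc" if "\<tau> \<in> {s..t}" for \<tau>
      using \<psi> s z that by (fastforce simp: evolution_family_def holomorphic_self_map_def)
    show "ac_on (\<lambda>t. \<psi> s t z) s t" by (rule evolution_family_ac_on[OF \<psi> d s(1) z])
    have "AE \<tau> in lebesgue_on {s..}. ((\<lambda>t. \<psi> s t z) has_vector_derivative G (\<psi> s \<tau> z) \<tau>) (at \<tau> within {s..})"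
      using sol z s(1) by (simp add: solves_evolution_equation_def)
    then have "AE \<tau> in lebesgue. \<tau> \<in> {s..} \<longrightarrow> ((\<lambda>t. \<psi> s t z) has_vector_derivative G (\<psi> s \<tau> z) \<tau>) (at \<tau> within {s..})"
      by (simp add: AE_lebesgue_on_iff)
    then show "AE \<tau> in lebesgue. \<tau> \<in> {s..t} \<longrightarrow> ((\<lambda>t. \<psi> s t z) has_vector_derivative G (\<psi> s \<tau> z) \<tau>) (at \<tau> within {s..t})"
      by eventually_elim (auto intro: has_vector_derivative_within_subset)
  qed
  from flow_eq_trajectory[OF s(1) this, of t] show ?thesis using s by simp
qed

text \<open>
  In the definition of a weak vector field the exceptional null set may depend on the point. A countable dense
  set of points and continuity in \<open>z\<close> make it independent of the point.
\<close>

lemma herglotz_vector_field_uniform_bound: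
  assumes G: "weak_holomorphic_vector_field d G" and r: "r < 1" and T: "0 < T"
  shows "\<exists>k. Lp_interval d T k \<and> (\<forall>t\<in>{0..T}. 0 \<le> k t) \<and>
           AE_majorant G k r T"
proof -
  have sub: "cball 0 r \<subseteq> unit_disc" using r by auto
  then have "compact (cball (0::complex) r) \<and> cball 0 r \<subseteq> unit_disc \<and> 0 < T" using T by simp
  from G[unfolded weak_holomorphic_vector_field_def, THEN conjunct2, THEN conjunct2, rule_format, OF this]
  obtain k where k: "Lp_interval d T k" "\<forall>t\<in>{0..T}. 0 \<le> k t"
    "\<And>z. z \<in> cball 0 r \<Longrightarrow> AE t in lebesgue_on {0..T}. cmod (G z t) \<le> k t"
    by blast
  obtain D where D: "countable D" "D \<subseteq> cball (0::complex) r" "cball 0 r \<subseteq> closure D"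
    using separable by blast
  have "AE t in lebesgue. t \<in> {0..T} \<longrightarrow> cmod (G z t) \<le> k t" if "z \<in> D" for z
    using k(3)[of z] that D by (auto simp: AE_lebesgue_on_iff)
  then have "AE t in lebesgue. \<forall>z\<in>D. t \<in> {0..T} \<longrightarrow> cmod (G z t) \<le> k t"
    by (subst AE_ball_countable[OF D(1)]) blast
  then have "AE_majorant G k r T"
  proof eventually_elim
    case (elim t)
    show ?case
    proof (intro impI ballI)
      fix z assume t: "t \<in> {0..T}" and z: "z \<in> cball (0::complex) r"
      have "closure D \<subseteq> unit_disc" using D(2) sub closure_minimal closed_cball by blast
      moreover have "(\<lambda>z. G z t) holomorphic_on unit_disc"
        using G t by (simp add: weak_holomorphic_vector_field_def)
      ultimately have "continuous_on (closure D) (\<lambda>z. G z t)"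
        by (meson holomorphic_on_imp_continuous_on continuous_on_subset)
      then show "cmod (G z t) \<le> k t"
        by (rule continuous_on_closure_norm_le) (use elim t z D in auto)
    qed
  qed
  with k show ?thesis by blast
qed

lemma generator_field_if_herglotz:
  assumes G: "herglotz_vector_field d G" and d: "1 \<le> d"
  shows "generator_field G"
proof
  have w: "weak_holomorphic_vector_field d G" using G by (simp add: herglotz_vector_field_def)
  show "G z \<in> borel_measurable (lebesgue_on {0..})" if "z \<in> unit_disc" for z
    using w that by (auto simp: weak_holomorphic_vector_field_def)
  show "(\<lambda>z. G z t) holomorphic_on unit_disc" if "0 \<le> t" for t
    using w that by (auto simp: weak_holomorphic_vector_field_def)
  show "\<exists>k. k absolutely_integrable_on {0..T} \<and> (\<forall>t\<in>{0..T}. 0 \<le> k t) \<and>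
           AE_majorant G k r T"
    if "0 < r" "r < 1" "0 < T" for r T
    using herglotz_vector_field_uniform_bound[OF w that(2,3)] Lp_interval_absolutely_integrable[OF _ d] by blast
  have "AE t in lebesgue_on {0..}. (\<lambda>z. G z t) \<in> Gen_disc" using G by (simp add: herglotz_vector_field_def)
  then have "AE t in lebesgue. t \<in> {0..} \<longrightarrow> (\<lambda>z. G z t) \<in> Gen_disc" by (simp add: AE_lebesgue_on_iff)
  then show "AE t in lebesgue. 0 \<le> t \<longrightarrow> disc_generator (\<lambda>z. G z t)"
    by eventually_elim (auto intro: disc_generator_if_Gen_disc)
qed

proposition herglotz_generates_unique_evolution_family:
  assumes d: "1 \<le> d" and G: "herglotz_vector_field d G"
  shows "\<exists>\<phi>. evolution_family d \<phi> \<and> solves_evolution_equation \<phi> G \<and>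
           (\<forall>\<psi>. evolution_family d \<psi> \<and> solves_evolution_equation \<psi> G \<longrightarrow>
                (\<forall>s t. 0 \<le> s \<and> s \<le> t \<longrightarrow> (\<forall>z\<in>unit_disc. \<psi> s t z = \<phi> s t z)))"
proof -
  interpret generator_field G using generator_field_if_herglotz[OF G d] .
  have w: "weak_holomorphic_vector_field d G" using G by (simp add: herglotz_vector_field_def)
  have "evolution_family d flow"
    using herglotz_vector_field_uniform_bound[OF w] by (intro evolution_family_flow[OF d]) blast
  then show ?thesis using solves_evolution_equation_flow evolution_family_eq_flow d by blast
qed

section \<open>The inequality suffices for being a generator\<close>

text \<open>
  The flow of the constant field \<open>F\<close> is the semigroup. As the integrand is continuous now, orbits are
  differentiable at every time, and a shifted orbit is again a trajectory.
\<close>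

lemma Gen_disc_if_disc_generator:
  assumes F: "disc_generator F"
  shows "F \<in> Gen_disc"
proof -
  have hF: "F holomorphic_on unit_disc" using F by (simp add: disc_generator_def)
  have contF: "continuous_on unit_disc F" using hF by (rule holomorphic_on_imp_continuous_on)
  have bounded: "\<exists>M\<ge>0. \<forall>z\<in>cball 0 r. cmod (F z) \<le> M" if "r < 1" for r
  proof -
    have "continuous_on (cball 0 r) F" by (rule continuous_on_subset[OF contF]) (use that in auto)
    then have "compact (F ` cball 0 r)" by (intro compact_continuous_image) auto
    then obtain M where "\<And>y. y \<in> F ` cball 0 r \<Longrightarrow> cmod y \<le> M" using compact_imp_bounded bounded_iff by metis
    then show ?thesis by (intro exI[of _ "\<bar>M\<bar>"]) force
  qed
  define G where "G = (\<lambda>z (t::real). F z)"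
  interpret generator_field G
  proof
    fix r T :: real assume "0 < r" "r < 1" "0 < T"
    then obtain M where M: "M \<ge> 0" "\<forall>z\<in>cball 0 r. cmod (F z) \<le> M" using bounded by blast
    have "(\<lambda>t. M) absolutely_integrable_on {0..T}"
      by (intro absolutely_integrable_continuous_real continuous_intros)
    then show "\<exists>k. k absolutely_integrable_on {0..T} \<and> (\<forall>t\<in>{0..T}. 0 \<le> k t) \<and>
           AE_majorant G k r T"
      using M by (intro exI[of _ "\<lambda>_. M"]) (auto simp: G_def)
  qed (use F hF in \<open>auto simp: G_def\<close>)
  have Lip: "\<exists>M\<ge>0. \<forall>z u t. cmod z \<le> \<rho> \<longrightarrow> 0 \<le> u \<longrightarrow> u \<le> t \<longrightarrow> t \<le> T \<longrightarrow>
      cmod (flow 0 t z - flow 0 u z) \<le> M * (t - u)" if \<rho>: "\<rho> < 1" for \<rho> T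
  proof -
    obtain r where r: "0 < r" "r < 1" "\<And>k s u t z. k absolutely_integrable_on {0..T} \<Longrightarrow>
      AE_majorant G k r T \<Longrightarrow> cmod z \<le> \<rho> \<Longrightarrow>
      0 \<le> s \<Longrightarrow> s \<le> u \<Longrightarrow> u \<le> t \<Longrightarrow> t \<le> T \<Longrightarrow> cmod (flow s t z - flow s u z) \<le> integral {u..t} k"
      by (rule flow_increment_le[OF \<rho>, of T]) (rule that; blast)
    obtain M where M: "M \<ge> 0" "\<forall>z\<in>cball 0 r. cmod (F z) \<le> M" using bounded r by blast
    have "(\<lambda>t. M) absolutely_integrable_on {0..T}"
      by (intro absolutely_integrable_continuous_real continuous_intros)
    from r(3)[OF this] M have "cmod (flow 0 t z - flow 0 u z) \<le> M * (t - u)"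
      if "cmod z \<le> \<rho>" "0 \<le> u" "u \<le> t" "t \<le> T" for z u t
      using that by (auto simp: G_def mult.commute)
    with M(1) show ?thesis by blast
  qed
  have deriv: "((\<lambda>t. flow 0 t z) has_vector_derivative F (flow 0 t z)) (at t within {0..})"
    if t: "0 \<le> t" and z: "z \<in> unit_disc" for t z
  proof -
    have tr: "trajectory 0 x z (\<lambda>t. flow 0 t z)" if "0 \<le> x" for x using trajectory_flow[OF _ that z] by simp
    have cont: "continuous_on {0..t+1} (\<lambda>x. F (flow 0 x z))"
      by (rule continuous_on_compose2[OF contF ac_on_imp_continuous_on])
        (use tr[of "t+1"] t in \<open>auto simp: trajectory_def\<close>)
    have eq: "flow 0 x z = z + integral {0..x} (\<lambda>x. F (flow 0 x z))" if "x \<in> {0..t+1}" for x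
    proof -
      have x: "0 \<le> x" using that by simp
      have "((\<lambda>x. F (flow 0 x z)) has_integral flow 0 x z - flow 0 0 z) {0..x}"
        by (rule ac_on_FTC(2)) (use tr[OF x, unfolded trajectory_def] x in \<open>simp_all add: G_def\<close>)
      from integral_unique[OF this] show ?thesis using flow_self[of 0 z] z by simp
    qed
    have "((\<lambda>x. z + integral {0..x} (\<lambda>x. F (flow 0 x z))) has_vector_derivative F (flow 0 t z)) (at t within {0..t+1})"
      using integral_has_vector_derivative[OF cont, of t] t by (auto intro!: derivative_eq_intros)
    then have "((\<lambda>t. flow 0 t z) has_vector_derivative F (flow 0 t z)) (at t within {0..t+1})"
      by (rule has_vector_derivative_transform[rotated 2]) (use eq t in auto)
    moreover have "at t within {0..t+1} = at t within {0..}"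
      by (rule at_within_nhd[of t "{..<t+1}"]) (use t in auto)
    ultimately show ?thesis by simp
  qed
  have "disc_semigroup (flow 0)"
    unfolding disc_semigroup_def
  proof (intro conjI allI impI ballI)
    show "flow 0 (t + s) z = flow 0 t (flow 0 s z)" if s: "0 \<le> s" and t: "0 \<le> t" and z: "z \<in> unit_disc" for s t z
    proof -
      have "trajectory 0 t (flow 0 s z) (\<lambda>\<tau>. flow 0 (\<tau> + s) z)"
        unfolding trajectory_def
      proof (intro conjI ballI)
        show "flow 0 (0 + s) z = flow 0 s z" by simp
        show "flow 0 (\<tau> + s) z \<in> unit_disc" if "\<tau> \<in> {0..t}" for \<tau> using flow_in_disc[of 0 "\<tau> + s" z] that s z by auto
        have "cmod z < 1" using z by simp
        then obtain M where M: "M \<ge> 0" "\<And>u v. 0 \<le> u \<Longrightarrow> u \<le> v \<Longrightarrow> v \<le> t + s \<Longrightarrow> cmod (flow 0 v z - flow 0 u z) \<le> M * (v - u)"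
          using Lip[of "cmod z" "t + s"] by blast
        show "ac_on (\<lambda>\<tau>. flow 0 (\<tau> + s) z) 0 t"
          by (rule ac_onI[of "\<lambda>_. M"]) (use M(1) M(2)[of "u + s" "v + s" for u v] s in \<open>auto simp: mult.commute\<close>)
        have "((\<lambda>\<tau>. flow 0 (\<tau> + s) z) has_vector_derivative F (flow 0 (\<tau> + s) z)) (at \<tau> within {0..t})" if \<tau>: "\<tau> \<in> {0..t}" for \<tau>
        proof -
          have "((\<lambda>\<tau>. \<tau> + s) has_vector_derivative 1) (at \<tau> within {0..t})" by (auto intro!: derivative_eq_intros)
          moreover have "((\<lambda>t. flow 0 t z) has_vector_derivative F (flow 0 (\<tau> + s) z)) (at (\<tau> + s) within (\<lambda>\<tau>. \<tau> + s) ` {0..t})"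
            by (rule has_vector_derivative_within_subset[OF deriv]) (use \<tau> s z in auto)
          ultimately show ?thesis using vector_diff_chain_within by (fastforce simp: o_def)
        qed
        then show "AE \<tau> in lebesgue. \<tau> \<in> {0..t} \<longrightarrow>
            ((\<lambda>\<tau>. flow 0 (\<tau> + s) z) has_vector_derivative G (flow 0 (\<tau> + s) z) \<tau>) (at \<tau> within {0..t})"
          by (simp add: G_def)
      qed
      from flow_eq_trajectory[OF _ this, of t] show ?thesis using t by simp
    qed
    fix K :: "complex set" assume K: "compact K \<and> K \<subseteq> unit_disc"
    then obtain \<rho> where \<rho>: "\<rho> < 1" "\<And>z. z \<in> K \<Longrightarrow> cmod z \<le> \<rho>"
      using compact_in_unit_disc_radius[of K] by auto
    obtain M where M: "M \<ge> 0" "\<And>z u t. cmod z \<le> \<rho> \<Longrightarrow> 0 \<le> u \<Longrightarrow> u \<le> t \<Longrightarrow> t \<le> 1 \<Longrightarrow>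
      cmod (flow 0 t z - flow 0 u z) \<le> M * (t - u)" using Lip[OF \<rho>(1), of 1] by blast
    show "uniform_limit K (flow 0) (\<lambda>z. z) (at_right 0)"
    proof (rule uniform_limitI)
      fix e :: real assume e: "0 < e"
      have "((\<lambda>t. M * t) \<longlongrightarrow> M * 0) (at_right 0)" by (intro tendsto_intros)
      then have "eventually (\<lambda>t. M * t < e) (at_right 0)" by (rule order_tendstoD) (use e in simp)
      moreover have "eventually (\<lambda>t::real. t < 1) (at_right 0)"
        by (intro order_tendstoD(2)[OF tendsto_ident_at]) auto
      moreover have "eventually (\<lambda>t::real. 0 < t) (at_right 0)" by (rule eventually_at_right_less)
      ultimately show "eventually (\<lambda>t. \<forall>z\<in>K. dist (flow 0 t z) z < e) (at_right 0)"
      proof eventually_elim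
        case (elim t)
        show ?case
        proof
          fix z assume z: "z \<in> K"
          have "cmod (flow 0 t z - flow 0 0 z) \<le> M * (t - 0)" using M(2)[OF \<rho>(2)[OF z], of 0 t] elim by auto
          moreover have "flow 0 0 z = z" using flow_self[of 0 z] z K by auto
          ultimately show "dist (flow 0 t z) z < e" using elim by (simp add: dist_norm)
        qed
      qed
    qed
  qed (use flow_self_map flow_self in auto)
  moreover have "infinitesimal_generator (flow 0) F"
    unfolding infinitesimal_generator_def using hF deriv by blast
  ultimately show ?thesis unfolding Gen_disc_def by blast
qed

section \<open>Difference quotients of an evolution family\<close>

text \<open>
  Near \<open>z\<close> this is Cauchy's estimate for a function bounded by \<open>1\<close>; far from \<open>z\<close> the right-hand side
  exceeds the diameter \<open>2\<close> of the disc.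
\<close>

lemma self_map_Lipschitz_at:
  assumes f: "holomorphic_self_map f" and z: "z \<in> unit_disc" and w: "w \<in> unit_disc"
  shows "cmod (f w - f z) \<le> 4 / (1 - cmod z) * cmod (w - z)"
proof -
  have hol: "f holomorphic_on unit_disc" and im: "\<And>z. z \<in> unit_disc \<Longrightarrow> cmod (f z) < 1"
    using f unfolding holomorphic_self_map_def by (auto simp: image_subset_iff)
  have z1: "cmod z < 1" using z by simp
  show ?thesis
  proof (cases "cmod (w - z) \<le> (1 - cmod z) / 2")
    case True
    define r R where "r = (1 + cmod z) / 2" and "R = (3 + cmod z) / 4"
    have rR: "0 < r" "r < R" "R < 1" "R - r = (1 - cmod z) / 4"
      using z1 norm_ge_zero[of z] by (auto simp: r_def R_def field_simps add_pos_nonneg)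
    have "cmod w \<le> r" using True norm_triangle_ineq[of z "w - z"] by (simp add: r_def field_simps)
    then have "cmod (f w - f z) \<le> 1 / (R - r) * cmod (w - z)"
      using z1 by (intro Cauchy_Lipschitz_bound[OF hol rR(1-3)]) (use rR(3) im in \<open>auto simp: r_def intro: less_imp_le\<close>)
    then show ?thesis by (simp add: rR(4))
  next
    case False
    have "cmod (f w - f z) \<le> 2" using norm_triangle_ineq4[of "f w" "f z"] im[OF z] im[OF w] by simp
    also have "\<dots> \<le> 4 / (1 - cmod z) * cmod (w - z)" using False z1 by (simp add: field_simps)
    finally show ?thesis .
  qed
qed

text \<open>
  The bound from the two points \<open>0\<close> and \<open>1/2\<close> makes the sequence locally bounded, hence locally
  equi-Lipschitz, so it is a Cauchy sequence at every point of the disc. Montel's theorem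
  makes the limit holomorphic.
\<close>

lemma disc_generator_sequence_converges:
  fixes F :: "nat \<Rightarrow> complex \<Rightarrow> complex"
  assumes gen: "\<And>n. disc_generator (F n)"
    and bd: "eventually (\<lambda>n. cmod (F n 0) + cmod (F n (1/2)) \<le> B) sequentially"
    and P: "P \<subseteq> unit_disc" "unit_disc \<subseteq> closure P"
    and conv: "\<And>p. p \<in> P \<Longrightarrow> convergent (\<lambda>n. F n p)"
  shows "\<exists>g. disc_generator g \<and> (\<forall>z\<in>unit_disc. (\<lambda>n. F n z) \<longlonglongrightarrow> g z)"
proof -
  obtain N where N: "\<And>n. N \<le> n \<Longrightarrow> cmod (F n 0) + cmod (F n (1/2)) \<le> B"
    using bd by (auto simp: eventually_sequentially)
  \<comment> \<open>Finitely many terms are dropped so that the bound B holds for all indices.\<close>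
  define E where "E = (\<lambda>n. F (n + N))"
  have genE: "disc_generator (E n)" for n by (simp add: E_def gen)
  then have holE: "E n holomorphic_on unit_disc" for n by (simp add: disc_generator_def)
  have bdE: "cmod (E n z) \<le> 20 / (1 - r) * B" if "cmod z \<le> r" "r < 1" for n z r
  proof -
    have "cmod (E n z) \<le> 20 / (1 - r) * (cmod (E n 0) + cmod (E n (1/2)))" by (rule disc_generator_bound[OF genE that])
    also have "\<dots> \<le> 20 / (1 - r) * B" using N[of "n + N"] that by (intro mult_left_mono) (auto simp: E_def)
    finally show ?thesis .
  qed
  have B0: "0 \<le> B" using N[of N] norm_ge_zero[of "F N 0"] norm_ge_zero[of "F N (1/2)"] by linarith
  obtain g \<sigma> where g: "g holomorphic_on unit_disc" "strict_mono (\<sigma> :: nat \<Rightarrow> nat)"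
     "\<And>x. x \<in> unit_disc \<Longrightarrow> (\<lambda>n. E (\<sigma> n) x) \<longlonglongrightarrow> g x"
  proof (rule Montel[of unit_disc "range E" E])
    fix K :: "complex set" assume K: "compact K" "K \<subseteq> unit_disc"
    then obtain \<rho> where "\<rho> < 1" "\<forall>z\<in>K. cmod z \<le> \<rho>"
      using compact_in_unit_disc_radius[of K] by auto
    then show "\<exists>B. \<forall>h\<in>range E. \<forall>z\<in>K. cmod (h z) \<le> B" using bdE by blast
  qed (use holE in auto)
  have "(\<lambda>n. E n z) \<longlonglongrightarrow> g z" if z: "z \<in> unit_disc" for z
  proof -
    have "Cauchy (\<lambda>n. E n z)"
    proof (rule metric_CauchyI)
      fix e :: real assume e: "0 < e"
      have z1: "cmod z < 1" using z by simp
      define r R where "r = (1 + cmod z) / 2" and "R = (3 + cmod z) / 4"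
      have rR: "0 < r" "r < R" "R < 1" "cmod z < r"
        using z1 norm_ge_zero[of z] by (auto simp: r_def R_def field_simps add_pos_nonneg)
      define C where "C = 20 / (1 - R) * B / (R - r)"
      have C0: "0 \<le> C" using rR B0 by (simp add: C_def)
      have lip: "cmod (E n p - E n z) \<le> C * cmod (p - z)" if "cmod p \<le> r" for p n
        unfolding C_def by (rule Cauchy_Lipschitz_bound[OF holE rR(1-3)]) (use that rR bdE[OF _ rR(3)] in auto)
      define \<delta> where "\<delta> = min (r - cmod z) (e / (3 * (C + 1)))"
      have \<delta>: "0 < \<delta>" using e C0 rR by (auto simp: \<delta>_def)
      obtain p where p: "p \<in> P" "dist p z < \<delta>"
        using P(2) z \<delta> closure_approachable by blast
      have pr: "cmod p \<le> r" using p(2) norm_triangle_ineq[of z "p - z"] by (simp add: \<delta>_def dist_norm)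
      have "C * cmod (p - z) \<le> (C + 1) * (e / (3 * (C + 1)))"
        using p(2) C0 by (intro mult_mono) (auto simp: \<delta>_def dist_norm)
      also have "\<dots> = e / 3" using C0 by (simp add: field_simps)
      finally have small: "cmod (E n p - E n z) \<le> e / 3" for n using lip[OF pr, of n] by linarith
      have "convergent (\<lambda>n. E n p)" unfolding E_def using conv[OF p(1)]
        by (rule convergent_ignore_initial_segment[THEN iffD2])
      then have "Cauchy (\<lambda>n. E n p)" by (rule convergent_Cauchy)
      then obtain M where M: "\<And>m n. M \<le> m \<Longrightarrow> M \<le> n \<Longrightarrow> dist (E m p) (E n p) < e / 3"
        using metric_CauchyD[of "\<lambda>n. E n p" "e / 3"] e by auto
      show "\<exists>M. \<forall>m\<ge>M. \<forall>n\<ge>M. dist (E m z) (E n z) < e"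
      proof (intro exI[of _ M] allI impI)
        fix m n assume mn: "M \<le> m" "M \<le> n"
        have "dist (E m z) (E n z) \<le> dist (E m z) (E m p) + dist (E m p) (E n p) + dist (E n p) (E n z)"
          using dist_triangle[of "E m z" "E n z" "E m p"] dist_triangle[of "E m p" "E n z" "E n p"] by linarith
        also have "\<dots> < e / 3 + e / 3 + e / 3"
          using M[OF mn] small[of m] small[of n] by (simp add: dist_norm norm_minus_commute)
        finally show "dist (E m z) (E n z) < e" by simp
      qed
    qed
    then obtain l where l: "(\<lambda>n. E n z) \<longlonglongrightarrow> l" using Cauchy_convergent convergent_def by blast
    then have "(\<lambda>n. E (\<sigma> n) z) \<longlonglongrightarrow> l" using LIMSEQ_subseq_LIMSEQ[OF l g(2)] by (simp add: o_def)
    with g(3)[OF z] have "l = g z" by (rule LIMSEQ_unique[symmetric])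
    with l show ?thesis by simp
  qed
  moreover from this have "disc_generator g" by (rule disc_generator_limit[OF g(1) genE])
  moreover have "(\<lambda>n. F n z) \<longlonglongrightarrow> g z" if "(\<lambda>n. E n z) \<longlonglongrightarrow> g z" for z
    using that unfolding E_def by (rule LIMSEQ_offset[where f = "\<lambda>n. F n z"])
  ultimately show ?thesis by blast
qed

definition difference_quotient ::
    "(real \<Rightarrow> real \<Rightarrow> complex \<Rightarrow> complex) \<Rightarrow> nat \<Rightarrow> real \<Rightarrow> complex \<Rightarrow> complex" where
  "difference_quotient \<phi> n t z = real (Suc n) *\<^sub>R (\<phi> t (t + 1 / real (Suc n)) z - z)"

context
  fixes d :: ennreal and \<phi> :: "real \<Rightarrow> real \<Rightarrow> complex \<Rightarrow> complex"
  assumes \<phi>: "evolution_family d \<phi>" and d: "1 \<le> d"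
begin

lemma evolution_self_map: "0 \<le> s \<Longrightarrow> s \<le> t \<Longrightarrow> holomorphic_self_map (\<phi> s t)"
  and evolution_start: "0 \<le> s \<Longrightarrow> z \<in> unit_disc \<Longrightarrow> \<phi> s s z = z"
  and evolution_compose: "0 \<le> s \<Longrightarrow> s \<le> u \<Longrightarrow> u \<le> t \<Longrightarrow> z \<in> unit_disc \<Longrightarrow> \<phi> s t z = \<phi> u t (\<phi> s u z)"
  using \<phi>[unfolded evolution_family_def, THEN conjunct1]
    \<phi>[unfolded evolution_family_def, THEN conjunct2, THEN conjunct1]
    \<phi>[unfolded evolution_family_def, THEN conjunct2, THEN conjunct2, THEN conjunct1] by simp_all

lemma evolution_in_disc: "0 \<le> s \<Longrightarrow> s \<le> t \<Longrightarrow> z \<in> unit_disc \<Longrightarrow> \<phi> s t z \<in> unit_disc"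
  using evolution_self_map unfolding holomorphic_self_map_def by blast

text \<open>
  The majorant condition of an evolution family in terms of the indefinite integral of the majorant, which
  is continuous and almost everywhere differentiable.
\<close>

lemma evolution_majorant:
  assumes z: "z \<in> unit_disc" and T: "0 < T"
  obtains k where "Lp_interval d T k" "k integrable_on {0..T}" "\<And>\<xi>. \<xi> \<in> {0..T} \<Longrightarrow> 0 \<le> k \<xi>"
    "\<And>s u t. 0 \<le> s \<Longrightarrow> s \<le> u \<Longrightarrow> u \<le> t \<Longrightarrow> t \<le> T \<Longrightarrow>
       cmod (\<phi> s u z - \<phi> s t z) \<le> integral {0..t} k - integral {0..u} k"
proof -
  obtain k where k: "Lp_interval d T k" "\<forall>\<xi>\<in>{0..T}. 0 \<le> k \<xi>"
    "\<And>s u t. 0 \<le> s \<and> s \<le> u \<and> u \<le> t \<and> t \<le> T \<Longrightarrow>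
           cmod (\<phi> s u z - \<phi> s t z) \<le> (LINT \<xi>:{u..t}|lebesgue. k \<xi>)"
    using \<phi>[unfolded evolution_family_def, THEN conjunct2, THEN conjunct2, THEN conjunct2] z T by blast
  have ki: "k integrable_on {0..T}" using Lp_interval_absolutely_integrable[OF k(1) d] by (simp add: absolutely_integrable_on_def)
  have "cmod (\<phi> s u z - \<phi> s t z) \<le> integral {0..t} k - integral {0..u} k"
    if "0 \<le> s" "s \<le> u" "u \<le> t" "t \<le> T" for s u t
    using k(3)[of s u t] set_lebesgue_integral_Lp_interval(2)[OF k(1) d, of u t] integral_diff_eq_integral[OF ki, of u t] that
    by auto
  with k(1,2) ki that show thesis by blast
qed

text \<open>
  For fixed \<open>y\<close> the point \<open>\<phi>\<^bsub>s,t\<^esub>(y)\<close> tends to \<open>y\<close> as \<open>s\<close> increases to \<open>t\<close>.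
\<close>

lemma evolution_backward_dense:
  assumes t: "0 < t"
    and Z: "Z \<subseteq> unit_disc" "unit_disc \<subseteq> closure Z"
  shows "unit_disc \<subseteq> closure {\<phi> s t z |s z. s \<in> \<rat> \<and> 0 \<le> s \<and> s < t \<and> z \<in> Z}"
proof
  fix z assume z: "z \<in> unit_disc"
  show "z \<in> closure {\<phi> s t z |s z. s \<in> \<rat> \<and> 0 \<le> s \<and> s < t \<and> z \<in> Z}"
    unfolding closure_approachable
  proof (intro allI impI)
    fix e :: real assume e: "0 < e"
    obtain y where y: "y \<in> Z" "dist y z < e / 2"
      using Z(2) z e closure_approachable[of z Z] by (meson half_gt_zero subsetD)
    have yd: "y \<in> unit_disc" using y Z by blast
    obtain k where k: "k integrable_on {0..t}"
      "\<And>s u t'. 0 \<le> s \<Longrightarrow> s \<le> u \<Longrightarrow> u \<le> t' \<Longrightarrow> t' \<le> t \<Longrightarrow>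
         cmod (\<phi> s u y - \<phi> s t' y) \<le> integral {0..t'} k - integral {0..u} k"
      using evolution_majorant[OF yd t] by metis
    have "continuous_on {0..t} (\<lambda>x. integral {0..x} k)" by (rule indefinite_integral_continuous_1[OF k(1)])
    then have "\<exists>\<delta>>0. \<forall>x\<in>{0..t}. dist x t < \<delta> \<longrightarrow> dist (integral {0..x} k) (integral {0..t} k) < e / 2"
      using t e unfolding continuous_on_iff by (metis atLeastAtMost_iff half_gt_zero less_eq_real_def order_refl)
    then obtain \<delta> where \<delta>: "\<delta> > 0" "\<And>x. x \<in> {0..t} \<Longrightarrow> dist x t < \<delta> \<Longrightarrow> dist (integral {0..x} k) (integral {0..t} k) < e / 2"
      by blast
    obtain s where s: "s \<in> \<rat>" "max 0 (t - \<delta>) < s" "s < t"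
      using Rats_dense_in_real[of "max 0 (t - \<delta>)" t] t \<delta> by auto
    have "dist (integral {0..s} k) (integral {0..t} k) < e / 2" using s by (intro \<delta>(2)) (auto simp: dist_real_def)
    then have "integral {0..t} k - integral {0..s} k < e / 2" unfolding dist_real_def by linarith
    then have "cmod (y - \<phi> s t y) < e / 2"
      using k(2)[of s s t] s evolution_start[OF _ yd, of s] by auto
    then have "dist (\<phi> s t y) z < e"
      using y(2) dist_triangle[of "\<phi> s t y" z y] by (simp add: dist_norm norm_minus_commute)
    moreover have "0 \<le> s" using s by simp
    ultimately show "\<exists>x\<in>{\<phi> s t z |s z. s \<in> \<rat> \<and> 0 \<le> s \<and> s < t \<and> z \<in> Z}. dist x z < e"
      using s y(1) by blast
  qed
qed

lemma difference_quotient_generator: "0 \<le> t \<Longrightarrow> disc_generator (difference_quotient \<phi> n t)"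
  unfolding difference_quotient_def
  by (intro disc_generator_scaleR disc_generator_self_map_minus_id evolution_self_map) auto

text \<open>
  At a point of an orbit the difference quotient of \<open>\<phi>\<^bsub>t,t+h\<^esub>\<close> is a difference quotient of the orbit
  itself.
\<close>

lemma difference_quotient_along_orbit:
  assumes "0 \<le> s" "s \<le> t" "z \<in> unit_disc"
  shows "difference_quotient \<phi> n t (\<phi> s t z) = real (Suc n) *\<^sub>R (\<phi> s (t + 1 / real (Suc n)) z - \<phi> s t z)"
  using evolution_compose[of s t "t + 1 / real (Suc n)" z] assms by (simp add: difference_quotient_def)

text \<open>
  This provides measurability in time of the difference quotients. For \<open>a \<le> b\<close> the values at \<open>a\<close> and \<open>b\<close> are
  compared through \<open>\<phi>\<^bsub>a,b+h\<^esub>(z) = \<phi>\<^bsub>b,b+h\<^esub>(\<phi>\<^bsub>a,b\<^esub>(z))\<close>, using that self-maps are Lipschitz at \<open>z\<close> with a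
  constant that depends on \<open>z\<close> only.
\<close>

lemma evolution_continuous_along_diagonal:
  assumes z: "z \<in> unit_disc" and h: "0 \<le> h"
  shows "continuous_on {0..} (\<lambda>t. \<phi> t (t + h) z)"
  unfolding continuous_on_def
proof
  fix x :: real assume "x \<in> {0..}"
  then have x: "0 \<le> x" by simp
  define T where "T = x + 1"
  have T: "0 < T + h" using x h by (simp add: T_def)
  obtain k where k: "k integrable_on {0..T+h}" "\<And>\<xi>. \<xi> \<in> {0..T+h} \<Longrightarrow> 0 \<le> k \<xi>"
    "\<And>s u t. 0 \<le> s \<Longrightarrow> s \<le> u \<Longrightarrow> u \<le> t \<Longrightarrow> t \<le> T + h \<Longrightarrow>
       cmod (\<phi> s u z - \<phi> s t z) \<le> integral {0..t} k - integral {0..u} k"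
    using evolution_majorant[OF z T] by metis
  define K where "K = (\<lambda>x. integral {0..x} k)"
  have contK: "continuous_on {0..T+h} K" unfolding K_def by (rule indefinite_integral_continuous_1[OF k(1)])
  define C where "C = 4 / (1 - cmod z)"
  have C0: "0 \<le> C" using z by (simp add: C_def)
  have le: "cmod (\<phi> a (a + h) z - \<phi> b (b + h) z) \<le> \<bar>K (b + h) - K (a + h)\<bar> + C * \<bar>K b - K a\<bar>"
    if ab: "0 \<le> a" "a \<le> b" "b \<le> T" for a b
  proof -
    have 1: "cmod (\<phi> a (a + h) z - \<phi> a (b + h) z) \<le> K (b + h) - K (a + h)"
      unfolding K_def using ab h by (intro k(3)) auto
    have "\<phi> a (b + h) z = \<phi> b (b + h) (\<phi> a b z)" using ab h z by (intro evolution_compose) auto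
    then have "cmod (\<phi> a (b + h) z - \<phi> b (b + h) z) \<le> C * cmod (\<phi> a b z - z)"
      unfolding C_def using ab h z by (simp only:) (intro self_map_Lipschitz_at evolution_self_map evolution_in_disc; simp)
    also have "\<dots> \<le> C * (K b - K a)"
      using k(3)[of a a b] evolution_start[OF ab(1) z] ab h C0 by (intro mult_left_mono) (auto simp: K_def norm_minus_commute)
    finally have 2: "cmod (\<phi> a (b + h) z - \<phi> b (b + h) z) \<le> C * (K b - K a)" .
    have "cmod (\<phi> a (a + h) z - \<phi> b (b + h) z) \<le> (K (b + h) - K (a + h)) + C * (K b - K a)"
      using norm_triangle_ineq[of "\<phi> a (a + h) z - \<phi> a (b + h) z" "\<phi> a (b + h) z - \<phi> b (b + h) z"] 1 2 by simp
    also have "\<dots> \<le> \<bar>K (b + h) - K (a + h)\<bar> + C * \<bar>K b - K a\<bar>"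
      using C0 by (intro add_mono mult_left_mono) auto
    finally show ?thesis .
  qed
  have le': "cmod (\<phi> y (y + h) z - \<phi> x (x + h) z) \<le> \<bar>K (y + h) - K (x + h)\<bar> + C * \<bar>K y - K x\<bar>"
    if "y \<in> {0..T}" for y
  proof (cases "y \<le> x")
    case True
    then show ?thesis using le[of y x] that by (simp add: T_def abs_minus_commute)
  next
    case False
    then show ?thesis using le[of x y] that x by (simp add: norm_minus_commute)
  qed
  have K1: "(K \<longlongrightarrow> K x) (at x within {0..T})"
    using continuous_on_subset[OF contK, of "{0..T}"] h x by (auto simp: continuous_on_def T_def)
  have "continuous_on {0..T} (\<lambda>y. K (y + h))"
    by (rule continuous_on_compose2[OF contK]) (use h in \<open>auto intro!: continuous_intros\<close>)
  then have K2: "((\<lambda>y. K (y + h)) \<longlongrightarrow> K (x + h)) (at x within {0..T})"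
    using x by (auto simp: continuous_on_def T_def)
  have "((\<lambda>y. \<bar>K (y + h) - K (x + h)\<bar> + C * \<bar>K y - K x\<bar>) \<longlongrightarrow> \<bar>K (x + h) - K (x + h)\<bar> + C * \<bar>K x - K x\<bar>) (at x within {0..T})"
    by (intro tendsto_intros K1 K2)
  then have K0: "((\<lambda>y. \<bar>K (y + h) - K (x + h)\<bar> + C * \<bar>K y - K x\<bar>) \<longlongrightarrow> 0) (at x within {0..T})" by simp
  have "((\<lambda>y. \<phi> y (y + h) z - \<phi> x (x + h) z) \<longlongrightarrow> 0) (at x within {0..T})"
    by (rule Lim_null_comparison[OF _ K0]) (simp add: eventually_at_filter le'[unfolded atLeastAtMost_iff])
  then have "((\<lambda>y. \<phi> y (y + h) z) \<longlongrightarrow> \<phi> x (x + h) z) (at x within {0..T})" by (rule LIM_zero_cancel)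
  moreover have "at x within {0..T} = at x within {0..}"
    by (rule at_within_nhd[of x "{..<T}"]) (use x in \<open>auto simp: T_def\<close>)
  ultimately show "((\<lambda>y. \<phi> y (y + h) z) \<longlongrightarrow> \<phi> x (x + h) z) (at x within {0..})" by simp
qed

lemma evolution_differentiable_AE:
  assumes s: "0 \<le> s" and z: "z \<in> unit_disc"
  shows "AE t in lebesgue. t \<in> {s..} \<longrightarrow> (\<exists>D. ((\<lambda>t. \<phi> s t z) has_vector_derivative D) (at t within {s..}))"
proof (rule AE_within_atLeast_if_Icc)
  fix n
  obtain f where "AE t in lebesgue. t \<in> {s..s + real n} \<longrightarrow>
      ((\<lambda>t. \<phi> s t z) has_vector_derivative f t) (at t within {s..s + real n})"
    by (rule ac_on_has_derivative_AE[OF evolution_family_ac_on[OF \<phi> d s z], of "s + real n"]) auto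
  then show "AE t in lebesgue. t \<in> {s..s + real n} \<longrightarrow>
     (\<exists>D. ((\<lambda>t. \<phi> s t z) has_vector_derivative D) (at t within {s..s + real n}))"
    by eventually_elim blast
qed

text \<open>
  \<open>X\<close> consists of the difference quotients of the indefinite integral of the majorant, so that its limit is
  almost everywhere the majorant itself. This is how the order \<open>d\<close> is passed on to the limit field.
\<close>

lemma difference_quotient_bound_AE:
  assumes z: "z \<in> unit_disc" and T: "0 < T"
  obtains k where "Lp_interval d T k" "\<And>\<xi>. \<xi> \<in> {0..T} \<Longrightarrow> 0 \<le> k \<xi>"
    "AE t in lebesgue. t \<in> {0..<T} \<longrightarrow>
       (\<exists>X. X \<longlonglongrightarrow> k t \<and> eventually (\<lambda>n. cmod (difference_quotient \<phi> n t z) \<le> X n) sequentially)"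
proof -
  obtain k where k: "Lp_interval d T k" "k integrable_on {0..T}" "\<And>\<xi>. \<xi> \<in> {0..T} \<Longrightarrow> 0 \<le> k \<xi>"
    "\<And>s u t. 0 \<le> s \<Longrightarrow> s \<le> u \<Longrightarrow> u \<le> t \<Longrightarrow> t \<le> T \<Longrightarrow>
       cmod (\<phi> s u z - \<phi> s t z) \<le> integral {0..t} k - integral {0..u} k"
    using evolution_majorant[OF z T] by metis
  have "AE t in lebesgue. t \<in> {0..<T} \<longrightarrow>
       (\<exists>X. X \<longlonglongrightarrow> k t \<and> eventually (\<lambda>n. cmod (difference_quotient \<phi> n t z) \<le> X n) sequentially)"
    using AE_integral_has_vector_derivative[OF k(2)]
  proof eventually_elim
    case (elim t)
    show ?case
    proof
      assume t: "t \<in> {0..<T}"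
      define X where "X = (\<lambda>n. real (Suc n) *\<^sub>R (integral {0..t + 1 / real (Suc n)} k - integral {0..t} k))"
      have "at t within {0..T} = at t within {0..}"
        by (rule at_within_nhd[of t "{..<T}"]) (use t in auto)
      then have "X \<longlonglongrightarrow> k t"
        unfolding X_def using elim t by (intro right_difference_quotient_tendsto[of _ _ t 0]) auto
      moreover have "eventually (\<lambda>n. cmod (difference_quotient \<phi> n t z) \<le> X n) sequentially"
      proof -
        have "(\<lambda>n. t + inverse (real (Suc n))) \<longlonglongrightarrow> t + 0"
          by (intro tendsto_intros LIMSEQ_inverse_real_of_nat)
        then have "eventually (\<lambda>n. t + inverse (real (Suc n)) < T) sequentially"
          by (rule order_tendstoD) (use t in simp)
        then show ?thesis
        proof eventually_elim
          case (elim n)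
          have "cmod (\<phi> t t z - \<phi> t (t + 1 / real (Suc n)) z) \<le> integral {0..t + 1 / real (Suc n)} k - integral {0..t} k"
            using t elim by (intro k(4)) (auto simp: inverse_eq_divide)
          then have "cmod (\<phi> t (t + 1 / real (Suc n)) z - z) \<le> integral {0..t + 1 / real (Suc n)} k - integral {0..t} k"
            using evolution_start[OF _ z, of t] t by (simp add: norm_minus_commute)
          then show ?case
            unfolding difference_quotient_def X_def norm_scaleR real_scaleR_def by (intro mult_mono) auto
        qed
      qed
      ultimately show "\<exists>X. X \<longlonglongrightarrow> k t \<and> eventually (\<lambda>n. cmod (difference_quotient \<phi> n t z) \<le> X n) sequentially"
        by blast
    qed
  qed
  with k(1,3) show thesis using that by blast
qed

text \<open>
  Convergence is known along the countably many orbits that start at rational times in a countable dense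
  set. At time \<open>t\<close> these orbits are dense in the disc, and this suffices by equicontinuity.
\<close>

lemma difference_quotients_converge_AE:
  "AE t in lebesgue. 0 < t \<longrightarrow>
     (\<exists>g. disc_generator g \<and> (\<forall>z\<in>unit_disc. (\<lambda>n. difference_quotient \<phi> n t z) \<longlonglongrightarrow> g z))"
proof -
  obtain Z where Z: "countable Z" "Z \<subseteq> unit_disc" "unit_disc \<subseteq> closure Z" using separable by blast
  have "AE t in lebesgue. t \<in> {0..<real (Suc m)} \<longrightarrow>
      (\<exists>X a. X \<longlonglongrightarrow> a \<and> eventually (\<lambda>n. cmod (difference_quotient \<phi> n t z) \<le> X n) sequentially)"
    if z: "z \<in> unit_disc" for z and m :: nat
  proof -
    obtain k where "AE t in lebesgue. t \<in> {0..<real (Suc m)} \<longrightarrow>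
       (\<exists>X. X \<longlonglongrightarrow> k t \<and> eventually (\<lambda>n. cmod (difference_quotient \<phi> n t z) \<le> X n) sequentially)"
      by (rule difference_quotient_bound_AE[OF z, of "real (Suc m)"]) auto
    then show ?thesis by eventually_elim blast
  qed
  then have bd: "AE t in lebesgue. \<forall>m. t \<in> {0..<real (Suc m)} \<longrightarrow>
      (\<exists>X a. X \<longlonglongrightarrow> a \<and> eventually (\<lambda>n. cmod (difference_quotient \<phi> n t z) \<le> X n) sequentially)"
    if "z \<in> unit_disc" for z using that by (subst AE_all_countable) blast
  have "AE t in lebesgue. \<forall>p\<in>(\<rat> \<inter> {0..}) \<times> Z. t \<in> {fst p..} \<longrightarrow>
      (\<exists>D. ((\<lambda>t. \<phi> (fst p) t (snd p)) has_vector_derivative D) (at t within {fst p..}))"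
  proof (subst AE_ball_countable)
    show "countable ((\<rat> \<inter> {0..}) \<times> Z)" using Z(1) countable_rat by (intro countable_SIGMA) auto
    show "\<forall>p\<in>(\<rat> \<inter> {0..}) \<times> Z. AE t in lebesgue. t \<in> {fst p..} \<longrightarrow>
      (\<exists>D. ((\<lambda>t. \<phi> (fst p) t (snd p)) has_vector_derivative D) (at t within {fst p..}))"
      using evolution_differentiable_AE Z(2) by auto
  qed
  moreover have "(0::complex) \<in> unit_disc" "(1/2::complex) \<in> unit_disc" by auto
  note bd[OF this(1)] bd[OF this(2)]
  ultimately show ?thesis
  proof eventually_elim
    case (elim t)
    show ?case
    proof
      assume t: "0 < t"
      obtain m where m: "t < real m" using reals_Archimedean2 by blast
      then have tm: "t \<in> {0..<real (Suc m)}" using t by auto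
      obtain X a where X: "X \<longlonglongrightarrow> a" "eventually (\<lambda>n. cmod (difference_quotient \<phi> n t 0) \<le> X n) sequentially"
        using elim(2) tm by blast
      obtain Y b where Y: "Y \<longlonglongrightarrow> b" "eventually (\<lambda>n. cmod (difference_quotient \<phi> n t (1/2)) \<le> Y n) sequentially"
        using elim(3) tm by blast
      have "eventually (\<lambda>n. X n < a + 1) sequentially" "eventually (\<lambda>n. Y n < b + 1) sequentially"
        using order_tendstoD(2)[OF X(1), of "a + 1"] order_tendstoD(2)[OF Y(1), of "b + 1"] by simp_all
      then have bound: "eventually (\<lambda>n. cmod (difference_quotient \<phi> n t 0) + cmod (difference_quotient \<phi> n t (1/2)) \<le> a + b + 2) sequentially"
        using X(2) Y(2) by eventually_elim auto
      define P where "P = {\<phi> s t z |s z. s \<in> \<rat> \<and> 0 \<le> s \<and> s < t \<and> z \<in> Z}"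
      show "\<exists>g. disc_generator g \<and> (\<forall>z\<in>unit_disc. (\<lambda>n. difference_quotient \<phi> n t z) \<longlonglongrightarrow> g z)"
      proof (rule disc_generator_sequence_converges[OF _ bound])
        show "disc_generator (difference_quotient \<phi> n t)" for n using difference_quotient_generator t by simp
        show "P \<subseteq> unit_disc" unfolding P_def using evolution_in_disc Z(2) by fastforce
        show "unit_disc \<subseteq> closure P" unfolding P_def by (rule evolution_backward_dense[OF t Z(2,3)])
        fix p assume "p \<in> P"
        then obtain s z where p: "p = \<phi> s t z" "s \<in> \<rat>" "0 \<le> s" "s < t" "z \<in> Z" by (auto simp: P_def)
        then have "z \<in> unit_disc" using Z(2) by blast
        have "(s, z) \<in> (\<rat> \<inter> {0..}) \<times> Z" using p by simp
        with elim(1) obtain D where "((\<lambda>t. \<phi> s t z) has_vector_derivative D) (at t within {s..})" using p by fastforce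
        then have "(\<lambda>n. real (Suc n) *\<^sub>R (\<phi> s (t + 1 / real (Suc n)) z - \<phi> s t z)) \<longlonglongrightarrow> D"
          using p by (intro right_difference_quotient_tendsto[of "\<lambda>t. \<phi> s t z"]) auto
        then have "(\<lambda>n. difference_quotient \<phi> n t p) \<longlonglongrightarrow> D"
          unfolding p(1) using difference_quotient_along_orbit[OF p(3) _ \<open>z \<in> unit_disc\<close>] p(4) by simp
        then show "convergent (\<lambda>n. difference_quotient \<phi> n t p)" by (rule convergentI)
      qed
    qed
  qed
qed

end

section \<open>Evolution families and Herglotz vector fields\<close>

lemma disc_generator_cong:
  assumes "disc_generator g" "\<And>z. z \<in> unit_disc \<Longrightarrow> f z = g z"
  shows "disc_generator f"
  using assms holomorphic_cong[of unit_disc unit_disc f g] unfolding disc_generator_def by auto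

text \<open>
  The field is the limit of the difference quotients. It inherits the inequality for generators, and its
  majorant of order \<open>d\<close> on a compact set is a multiple of the sum of the majorants at \<open>0\<close> and
  \<open>1/2\<close>.
\<close>

proposition evolution_family_satisfies_herglotz_equation:
  assumes \<phi>: "evolution_family d \<phi>" and d: "1 \<le> d"
  shows "\<exists>G. herglotz_vector_field d G \<and> solves_evolution_equation \<phi> G"
proof -
  define good where "good = (\<lambda>t. 0 < t \<and>
     (\<exists>g. disc_generator g \<and> (\<forall>z\<in>unit_disc. (\<lambda>n. difference_quotient \<phi> n t z) \<longlonglongrightarrow> g z)))"
  \<comment> \<open>At the null set of bad times the value 0 keeps the field holomorphic at every time.\<close>
  define G where "G = (\<lambda>z t. if good t then lim (\<lambda>n. difference_quotient \<phi> n t z) else 0)"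
  have AEgood: "AE t in lebesgue. 0 \<le> t \<longrightarrow> good t"
  proof -
    have "AE t::real in lebesgue. t \<noteq> 0" unfolding AE_lebesgue_iff_negligible by simp
    with difference_quotients_converge_AE[OF \<phi> d] show ?thesis
      by eventually_elim (auto simp: good_def)
  qed
  have Glim: "(\<lambda>n. difference_quotient \<phi> n t z) \<longlonglongrightarrow> G z t" if "good t" "z \<in> unit_disc" for t z
  proof -
    have "convergent (\<lambda>n. difference_quotient \<phi> n t z)" using that by (auto simp: good_def convergent_def)
    then show ?thesis using that by (simp add: G_def convergent_LIMSEQ_iff)
  qed
  have Ggen: "disc_generator (\<lambda>z. G z t)" if t: "good t" for t
  proof -
    obtain g where g: "disc_generator g" "\<And>z. z \<in> unit_disc \<Longrightarrow> (\<lambda>n. difference_quotient \<phi> n t z) \<longlonglongrightarrow> g z"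
      using t by (auto simp: good_def)
    show ?thesis using g(1) by (rule disc_generator_cong) (use LIMSEQ_unique[OF Glim[OF t] g(2)] in blast)
  qed
  have weak: "weak_holomorphic_vector_field d G"
    unfolding weak_holomorphic_vector_field_def
  proof (intro conjI ballI allI impI)
    fix z assume z: "z \<in> unit_disc"
    have "(\<lambda>t. difference_quotient \<phi> n t z) \<in> borel_measurable (lebesgue_on {0..})" for n
    proof (rule continuous_imp_measurable_on_sets_lebesgue)
      show "continuous_on {0..} (\<lambda>t. difference_quotient \<phi> n t z)"
        unfolding difference_quotient_def
        by (intro continuous_intros evolution_continuous_along_diagonal[OF \<phi> d z]) auto
    qed simp
    then have lm: "(\<lambda>t. lim (\<lambda>n. difference_quotient \<phi> n t z)) \<in> borel_measurable (lebesgue_on {0..})"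
      by (rule borel_measurable_lim_metric)
    have "negligible {t. \<not> (0 \<le> t \<longrightarrow> good t)}" using AEgood by (simp only: AE_lebesgue_iff_negligible)
    then have "{t. \<not> (0 \<le> t \<longrightarrow> good t)} \<in> sets lebesgue" by (rule negligible_imp_sets)
    then have "{0..} - {t. \<not> (0 \<le> t \<longrightarrow> good t)} \<in> sets lebesgue" by (intro sets.Diff) auto
    moreover have "{t \<in> space (lebesgue_on {0..}). good t} = {0..} - {t. \<not> (0 \<le> t \<longrightarrow> good t)}" by auto
    ultimately have "{t \<in> space (lebesgue_on {0..}). good t} \<in> sets (lebesgue_on {0..})"
      by (auto simp: sets_restrict_space_iff)
    then show "(\<lambda>t. G z t) \<in> borel_measurable (lebesgue_on {0..})"
      unfolding G_def using lm by (intro measurable_If) auto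
  next
    fix t :: real assume "0 \<le> t"
    show "(\<lambda>z. G z t) holomorphic_on unit_disc"
    proof (cases "good t")
      case True
      then show ?thesis using Ggen[OF True] by (simp add: disc_generator_def)
    qed (simp add: G_def)
  next
    fix K :: "complex set" and T :: real assume KT: "compact K \<and> K \<subseteq> unit_disc \<and> 0 < T"
    then obtain r where r: "r < 1" "\<And>z. z \<in> K \<Longrightarrow> cmod z \<le> r"
      using compact_in_unit_disc_radius[of K] by auto
    have T: "0 < T" using KT by simp
    have "(0::complex) \<in> unit_disc" by simp
    from difference_quotient_bound_AE[OF \<phi> d this T]
    obtain k where k: "Lp_interval d T k" "\<And>\<xi>. \<xi> \<in> {0..T} \<Longrightarrow> 0 \<le> k \<xi>"
      "AE t in lebesgue. t \<in> {0..<T} \<longrightarrow>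
         (\<exists>X. X \<longlonglongrightarrow> k t \<and> eventually (\<lambda>n. cmod (difference_quotient \<phi> n t 0) \<le> X n) sequentially)" by blast
    have "(1/2::complex) \<in> unit_disc" by simp
    from difference_quotient_bound_AE[OF \<phi> d this T]
    obtain l where l: "Lp_interval d T l" "\<And>\<xi>. \<xi> \<in> {0..T} \<Longrightarrow> 0 \<le> l \<xi>"
      "AE t in lebesgue. t \<in> {0..<T} \<longrightarrow>
         (\<exists>X. X \<longlonglongrightarrow> l t \<and> eventually (\<lambda>n. cmod (difference_quotient \<phi> n t (1/2)) \<le> X n) sequentially)" by blast
    define C where "C = 20 / (1 - r)"
    have C: "0 \<le> C" using r by (simp add: C_def)
    have "AE t::real in lebesgue. t \<noteq> T" unfolding AE_lebesgue_iff_negligible by simp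
    with AEgood k(3) l(3) have bd: "AE t in lebesgue. t \<in> {0..T} \<longrightarrow> (\<forall>z\<in>K. cmod (G z t) \<le> C * (k t + l t))"
    proof eventually_elim
      case (elim t)
      show ?case
      proof (intro impI ballI)
        fix z assume t: "t \<in> {0..T}" and z: "z \<in> K"
        have t': "t \<in> {0..<T}" "good t" "0 \<le> t" using t elim(1,4) by auto
        obtain X where X: "X \<longlonglongrightarrow> k t" "eventually (\<lambda>n. cmod (difference_quotient \<phi> n t 0) \<le> X n) sequentially"
          using elim(2) t' by blast
        obtain Y where Y: "Y \<longlonglongrightarrow> l t" "eventually (\<lambda>n. cmod (difference_quotient \<phi> n t (1/2)) \<le> Y n) sequentially"
          using elim(3) t' by blast
        have "eventually (\<lambda>n. cmod (difference_quotient \<phi> n t z) \<le> C * (X n + Y n)) sequentially"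
          using X(2) Y(2)
        proof eventually_elim
          case (elim n)
          have "cmod (difference_quotient \<phi> n t z)
              \<le> C * (cmod (difference_quotient \<phi> n t 0) + cmod (difference_quotient \<phi> n t (1/2)))"
            unfolding C_def
            by (rule disc_generator_bound[OF difference_quotient_generator[OF \<phi> d t'(3)] r(2)[OF z] r(1)])
          also have "\<dots> \<le> C * (X n + Y n)" using C elim by (intro mult_left_mono add_mono)
          finally show ?case .
        qed
        moreover have "(\<lambda>n. C * (X n + Y n)) \<longlonglongrightarrow> C * (k t + l t)" by (intro tendsto_intros X Y)
        moreover have "(\<lambda>n. cmod (difference_quotient \<phi> n t z)) \<longlonglongrightarrow> cmod (G z t)"
          using Glim[OF t'(2), of z] z KT by (intro tendsto_norm) auto
        ultimately show "cmod (G z t) \<le> C * (k t + l t)" by (intro tendsto_le[OF sequentially_bot])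
      qed
    qed
    show "\<exists>k. Lp_interval d T k \<and> (\<forall>t\<in>{0..T}. 0 \<le> k t) \<and>
           (\<forall>z\<in>K. AE t in lebesgue_on {0..T}. cmod (G z t) \<le> k t)"
    proof (intro exI[of _ "\<lambda>t. C * (k t + l t)"] conjI ballI)
      show "Lp_interval d T (\<lambda>t. C * (k t + l t))" by (rule Lp_interval_mult_add[OF k(1) l(1) d C])
      show "0 \<le> C * (k t + l t)" if "t \<in> {0..T}" for t using C k(2)[OF that] l(2)[OF that] by simp
      show "AE t in lebesgue_on {0..T}. cmod (G z t) \<le> C * (k t + l t)" if "z \<in> K" for z
      proof -
        have "AE t in lebesgue. t \<in> {0..T} \<longrightarrow> cmod (G z t) \<le> C * (k t + l t)"
          using bd by eventually_elim (use that in blast)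
        then show ?thesis by (simp add: AE_lebesgue_on_iff)
      qed
    qed
  qed
  have "AE t in lebesgue. t \<in> {0..} \<longrightarrow> (\<lambda>z. G z t) \<in> Gen_disc"
    using AEgood by eventually_elim (auto intro: Gen_disc_if_disc_generator Ggen)
  then have "AE t in lebesgue_on {0..}. (\<lambda>z. G z t) \<in> Gen_disc" by (simp add: AE_lebesgue_on_iff)
  with weak have "herglotz_vector_field d G" by (simp add: herglotz_vector_field_def)
  moreover have "solves_evolution_equation \<phi> G"
    unfolding solves_evolution_equation_def
  proof (intro ballI allI impI)
    fix z s assume z: "z \<in> unit_disc" and s: "(0::real) \<le> s"
    have "AE t in lebesgue. t \<in> {s..} \<longrightarrow> ((\<lambda>t. \<phi> s t z) has_vector_derivative G (\<phi> s t z) t) (at t within {s..})"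
      using AEgood evolution_differentiable_AE[OF \<phi> d s z]
    proof eventually_elim
      case (elim t)
      show ?case
      proof
        assume t: "t \<in> {s..}"
        then obtain D where D: "((\<lambda>t. \<phi> s t z) has_vector_derivative D) (at t within {s..})" using elim by blast
        have "good t" "s \<le> t" using elim t s by auto
        have "(\<lambda>n. real (Suc n) *\<^sub>R (\<phi> s (t + 1 / real (Suc n)) z - \<phi> s t z)) \<longlonglongrightarrow> D"
          by (rule right_difference_quotient_tendsto[OF D \<open>s \<le> t\<close>])
        then have "(\<lambda>n. difference_quotient \<phi> n t (\<phi> s t z)) \<longlonglongrightarrow> D"
          by (simp only: difference_quotient_along_orbit[OF \<phi> d s \<open>s \<le> t\<close> z])
        moreover have "(\<lambda>n. difference_quotient \<phi> n t (\<phi> s t z)) \<longlonglongrightarrow> G (\<phi> s t z) t"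
          by (rule Glim[OF \<open>good t\<close> evolution_in_disc[OF \<phi> d s \<open>s \<le> t\<close> z]])
        ultimately have "D = G (\<phi> s t z) t" by (rule LIMSEQ_unique)
        with D show "((\<lambda>t. \<phi> s t z) has_vector_derivative G (\<phi> s t z) t) (at t within {s..})" by simp
      qed
    qed
    then show "AE t in lebesgue_on {s..}. ((\<lambda>t. \<phi> s t z) has_vector_derivative G (\<phi> s t z) t) (at t within {s..})"
      by (simp add: AE_lebesgue_on_iff)
  qed
  ultimately show ?thesis by blast
qed

text \<open>
  At almost every time the two fields agree at all points \<open>\<phi>\<^bsub>s,t\<^esub>(z)\<close> with rational \<open>s < t\<close> and \<open>z\<close> in a
  countable dense set. These points are dense in the disc and the fields are continuous.
\<close>

proposition herglotz_vector_field_essentially_unique: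
  assumes \<phi>: "evolution_family d \<phi>" and d: "1 \<le> d"
    and G: "\<And>t. 0 \<le> t \<Longrightarrow> continuous_on unit_disc (\<lambda>z. G z t)" "solves_evolution_equation \<phi> G"
    and H: "\<And>t. 0 \<le> t \<Longrightarrow> continuous_on unit_disc (\<lambda>z. H z t)" "solves_evolution_equation \<phi> H"
  shows "AE t in lebesgue_on {0..}. \<forall>z\<in>unit_disc. G z t = H z t"
proof -
  obtain Z where Z: "countable Z" "Z \<subseteq> unit_disc" "unit_disc \<subseteq> closure Z" using separable by blast
  have eq: "AE t in lebesgue. t \<in> {s..} \<longrightarrow> G (\<phi> s t z) t = H (\<phi> s t z) t" if z: "z \<in> unit_disc" and s: "0 \<le> s" for s z
  proof -
    have "AE t in lebesgue. t \<in> {s..} \<longrightarrow> ((\<lambda>t. \<phi> s t z) has_vector_derivative G (\<phi> s t z) t) (at t within {s..})"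
      "AE t in lebesgue. t \<in> {s..} \<longrightarrow> ((\<lambda>t. \<phi> s t z) has_vector_derivative H (\<phi> s t z) t) (at t within {s..})"
      using G(2) H(2) z s unfolding solves_evolution_equation_def by (simp_all add: AE_lebesgue_on_iff)
    then show ?thesis
    proof eventually_elim
      case (elim t)
      show ?case
      proof
        assume t: "t \<in> {s..}"
        then have st: "s \<le> t" by simp
        from elim t show "G (\<phi> s t z) t = H (\<phi> s t z) t"
          using right_difference_quotient_tendsto[OF _ st, of "\<lambda>t. \<phi> s t z"] LIMSEQ_unique by blast
      qed
    qed
  qed
  have "AE t in lebesgue. \<forall>p\<in>(\<rat> \<inter> {0..}) \<times> Z. t \<in> {fst p..} \<longrightarrow>
      G (\<phi> (fst p) t (snd p)) t = H (\<phi> (fst p) t (snd p)) t"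
  proof (subst AE_ball_countable)
    show "countable ((\<rat> \<inter> {0..}) \<times> Z)" using Z(1) countable_rat by (intro countable_SIGMA) auto
    show "\<forall>p\<in>(\<rat> \<inter> {0..}) \<times> Z. AE t in lebesgue. t \<in> {fst p..} \<longrightarrow>
      G (\<phi> (fst p) t (snd p)) t = H (\<phi> (fst p) t (snd p)) t"
      using eq Z(2) by auto
  qed
  moreover have "AE t::real in lebesgue. t \<noteq> 0" unfolding AE_lebesgue_iff_negligible by simp
  ultimately have "AE t in lebesgue. t \<in> {0..} \<longrightarrow> (\<forall>z\<in>unit_disc. G z t = H z t)"
  proof eventually_elim
    case (elim t)
    show ?case
    proof (intro impI ballI)
      fix z assume t: "t \<in> {0..}" and z: "z \<in> unit_disc"
      then have t0: "0 < t" "0 \<le> t" using elim by auto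
      define P where "P = {\<phi> s t z |s z. s \<in> \<rat> \<and> 0 \<le> s \<and> s < t \<and> z \<in> Z}"
      have P: "P \<subseteq> unit_disc" unfolding P_def using evolution_in_disc[OF \<phi> d] Z(2) by fastforce
      have PGH: "G p t = H p t" if pP: "p \<in> P" for p
      proof -
        obtain s y where p: "p = \<phi> s t y" "s \<in> \<rat>" "0 \<le> s" "s < t" "y \<in> Z" using pP by (auto simp: P_def)
        then have "(s, y) \<in> (\<rat> \<inter> {0..}) \<times> Z" by simp
        with elim(1) show ?thesis using p by fastforce
      qed
      have "z \<in> closure P" unfolding P_def using evolution_backward_dense[OF \<phi> d t0(1) Z(2,3)] z by blast
      then obtain p where p: "\<And>n. p n \<in> P" "p \<longlonglongrightarrow> z" by (auto simp: closure_sequential)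
      have "eventually (\<lambda>n. p n \<in> unit_disc) sequentially"
        using P p(1) by (intro always_eventually) blast
      then have "(\<lambda>n. G (p n) t) \<longlonglongrightarrow> G z t" "(\<lambda>n. H (p n) t) \<longlonglongrightarrow> H z t"
        by (rule continuous_on_tendsto_compose[OF G(1)[OF t0(2)] p(2) z]
            continuous_on_tendsto_compose[OF H(1)[OF t0(2)] p(2) z])+
      then show "G z t = H z t" using PGH[OF p(1)] LIMSEQ_unique by simp
    qed
  qed
  then show ?thesis by (simp add: AE_lebesgue_on_iff)
qed

theorem theorem1p1:
  fixes d :: ennreal
  assumes "1 \<le> d"
  shows "(\<forall>\<phi>. evolution_family d \<phi> \<longrightarrow>
            (\<exists>G. herglotz_vector_field d G \<and> solves_evolution_equation \<phi> G \<and>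
               (\<forall>e H. 1 \<le> e \<and> herglotz_vector_field e H \<and> solves_evolution_equation \<phi> H \<longrightarrow>
                  (AE t in lebesgue_on {0..}. \<forall>z\<in>unit_disc. G z t = H z t)))) \<and>
         (\<forall>G. herglotz_vector_field d G \<longrightarrow>
            (\<exists>\<phi>. evolution_family d \<phi> \<and> solves_evolution_equation \<phi> G \<and>
               (\<forall>\<psi>. evolution_family d \<psi> \<and> solves_evolution_equation \<psi> G \<longrightarrow>
                  (\<forall>s t. 0 \<le> s \<and> s \<le> t \<longrightarrow> (\<forall>z\<in>unit_disc. \<psi> s t z = \<phi> s t z)))))"
proof (intro conjI allI impI)
  fix \<phi> assume \<phi>: "evolution_family d \<phi>"
  have cont: "continuous_on unit_disc (\<lambda>z. H z t)" if "herglotz_vector_field e H" "0 \<le> t" for e H t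
    using that by (auto simp: herglotz_vector_field_def weak_holomorphic_vector_field_def
        intro: holomorphic_on_imp_continuous_on)
  obtain G where G: "herglotz_vector_field d G" "solves_evolution_equation \<phi> G"
    using evolution_family_satisfies_herglotz_equation[OF \<phi> assms] by blast
  show "\<exists>G. herglotz_vector_field d G \<and> solves_evolution_equation \<phi> G \<and>
               (\<forall>e H. 1 \<le> e \<and> herglotz_vector_field e H \<and> solves_evolution_equation \<phi> H \<longrightarrow>
                  (AE t in lebesgue_on {0..}. \<forall>z\<in>unit_disc. G z t = H z t))"
  proof (intro exI[of _ G] conjI G allI impI)
    fix e H assume "1 \<le> e \<and> herglotz_vector_field e H \<and> solves_evolution_equation \<phi> H"
    then show "AE t in lebesgue_on {0..}. \<forall>z\<in>unit_disc. G z t = H z t"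
      using cont G by (intro herglotz_vector_field_essentially_unique[OF \<phi> assms]) auto
  qed
next
  fix G assume "herglotz_vector_field d G"
  then show "\<exists>\<phi>. evolution_family d \<phi> \<and> solves_evolution_equation \<phi> G \<and>
               (\<forall>\<psi>. evolution_family d \<psi> \<and> solves_evolution_equation \<psi> G \<longrightarrow>
                  (\<forall>s t. 0 \<le> s \<and> s \<le> t \<longrightarrow> (\<forall>z\<in>unit_disc. \<psi> s t z = \<phi> s t z)))"
    by (rule herglotz_generates_unique_evolution_family[OF assms])
qed

end
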